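(* Let $g$ be a $q$-wavelet associated with the $q$-Bessel operator in $\mathcal{S}_{*q,\alpha}(\mathbb{R}_q)$ and let $x\in\mathbb{R}_{q,+}$. Then: 1) for every $f\in\mathcal{S}_{*q,-1/2}(\mathbb{R}_q)$, $$W_{\alpha,q}^{-1}(f)(x)=\frac{c_{\alpha,q}}{C_g}\int_0^\infty\left(\int_0^\infty R_{\alpha,q}\left[\Phi_{q,K_{\alpha,q,1}\circ W_{\alpha,q}(g)}(f)(a,\cdot)\right](b)\,g_{a,b}(x)\,\frac{b^{2\alpha+1}}{a^{2\alpha+3}}\,d_qb\right)d_qa;$$ 2) for every $f\in\mathcal{S}_{*q,\alpha}(\mathbb{R}_q)$, $$R_{\alpha,q}^{-1}(f)(x)=\frac{c_{-1/2,q}}{C^c_{W_{\alpha,q}(g)}}\int_0^\infty\left(\int_0^\infty W_{\alpha,q}\left[\Psi^\alpha_{q,K_{\alpha,q,2}(g)}(f)(a,\cdot)\right](b)\,\left(W_{\alpha,q}(g)\right)^c_{a,b}(x)\,\frac{d_qb}{a^{2\alpha+3}}\right)d_qa.$$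
   Context: Fix $q\in\,]0,1[$ with $\frac{\log(1-q)}{\log q}\in\mathbb{Z}$ and $\alpha>-\frac12$. Functions are complex valued. $(a;q)_0=1$, $(a;q)_n=\prod_{k=0}^{n-1}(1-aq^k)$, $(a;q)_\infty=\prod_{k\ge0}(1-aq^k)$; $\Gamma_q(x)=\frac{(q;q)_\infty}{(q^x;q)_\infty}(1-q)^{1-x}$, and $\Gamma_{q^2}$ is the same with $q$ replaced by $q^2$. $\mathbb{R}_{q,+}=\{q^n:n\in\mathbb{Z}\}$, $\widetilde{\mathbb{R}}_{q,+}=\mathbb{R}_{q,+}\cup\{0\}$, $\mathbb{R}_q=\{\pm q^n:n\in\mathbb{Z}\}\cup\{0\}$. Jackson integrals: $\int_0^af(x)d_qx=(1-q)a\sum_{n\ge0}f(aq^n)q^n$, $\int_0^\infty f(x)d_qx=(1-q)\sum_{n\in\mathbb{Z}}f(q^n)q^n$, $\int_a^\infty=\int_0^\infty-\int_0^a$. $q$-derivative: $D_qf(x)=\frac{f(x)-f(qx)}{(1-q)x}$ for $x\ne0$, $D_qf(0)=f'(0)$. $\mathcal{S}_{*q}(\mathbb{R}_q)$: the restrictions to $\mathbb{R}_q$ of even, infinitely $q$-differentiable functions $f$ on $\mathbb{R}$ with $P_{n,m,q}(f)=\sup_{x\in\mathbb{R},\,0\le k\le n}|(1+x^2)^mD_q^kf(x)|<\infty$ for all $n,m\in\mathbb{N}$, with the induced topology of these semi-norms. For $\beta\in\{\alpha,-\frac12\}$, $\mathcal{S}_{*q,\beta}(\mathbb{R}_q)=\{f\in\mathcal{S}_{*q}(\mathbb{R}_q):\int_0^\infty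 f(x)x^{2k+2\beta+1}d_qx=0,\ k=0,1,\dots\}$. For $\beta\in\{\alpha,-\frac12\}$: $j_\beta^{(3)}(z;q^2)=\sum_{n\ge0}\frac{(-1)^nq^{n(n-1)}(1-q)^{2n}z^{2n}}{(q^2;q^2)_n(q^{2\beta+2};q^2)_n}$, $c_{\beta,q}=\frac{(1+q^{-1})^{-\beta}}{\Gamma_{q^2}(\beta+1)}$, $\mathcal{F}_{\beta,q}(f)(\lambda)=c_{\beta,q}\int_0^\infty f(x)j_\beta^{(3)}(\lambda x;q^2)x^{2\beta+1}d_qx$, with $\mathcal{F}_{\beta,q}^{-1}=q^{-4\beta-2}\mathcal{F}_{\beta,q}$. $\mathcal{F}_{\alpha,q}$ is the $q$-Bessel Fourier transform and $\mathcal{F}_q=\mathcal{F}_{-1/2,q}$ the $q$-Fourier-cosine transform. For $x\in\widetilde{\mathbb{R}}_{q,+}$ the translation $T^\beta_{q,x}$ is given by $\mathcal{F}_{\beta,q}(T^\beta_{q,x}f)(\lambda)=j_\beta^{(3)}(\lambda x;q^2)\mathcal{F}_{\beta,q}(f)(\lambda)$; $T_{q,x}=T^{-1/2}_{q,x}$. $q$-Riemann-Liouville transform: $R_{\alpha,q}(f)(x)=\frac{(1+q)\Gamma_{q^2}(\alpha+1)}{\Gamma_{q^2}(1/2)\Gamma_{q^2}(\alpha+1/2)}\int_0^1\frac{(t^2q^2;q^2)_\infty}{(t^2q^{2\alpha+1};q^2)_\infty}f(xt)\,d_qt$; it is an isomorphism of $\mathcal{S}_{*q,-1/2}(\mathbb{R}_q)$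 onto $\mathcal{S}_{*q,\alpha}(\mathbb{R}_q)$. $q$-Weyl transform: $W_{\alpha,q}(f)(x)=\frac{q(1+q^{-1})^{-\alpha+1/2}}{\Gamma_{q^2}(\alpha+1/2)}\int_{qx}^\infty\frac{(q^2x^2/t^2;q^2)_\infty}{(q^{2\alpha+1}x^2/t^2;q^2)_\infty}f(t)t^{2\alpha}d_qt$ for $x\in\widetilde{\mathbb{R}}_{q,+}$, extended evenly; $\mathcal{F}_{\alpha,q}=\mathcal{F}_q\circ W_{\alpha,q}$ on $\mathcal{S}_{*q}(\mathbb{R}_q)$, and $W_{\alpha,q}$ is an isomorphism of $\mathcal{S}_{*q,\alpha}(\mathbb{R}_q)$ onto $\mathcal{S}_{*q,-1/2}(\mathbb{R}_q)$. With $\kappa_\alpha=\frac{\Gamma_{q^2}(1/2)}{q^{3\alpha+3/2}(1+q)^{\alpha+1/2}\Gamma_{q^2}(\alpha+1)}$: $K_{\alpha,q,1}(f)=\kappa_\alpha\,\mathcal{F}_q^{-1}(|\lambda|^{2\alpha+1}\mathcal{F}_q(f))$ on $\mathcal{S}_{*q,-1/2}(\mathbb{R}_q)$, and $K_{\alpha,q,2}(f)=\kappa_\alpha\,\mathcal{F}_{\alpha,q}^{-1}(|\lambda|^{2\alpha+1}\mathcal{F}_{\alpha,q}(f))$ on $\mathcal{S}_{*q,\alpha}(\mathbb{R}_q)$. A $q$-wavelet associated with the $q$-Bessel operator is an even $g$, square integrable on $\mathbb{R}_{q,+}$ for $x^{2\alpha+1}d_qx$, with $0<C_g=\int_0^\infty|\mathcal{F}_{\alpha,q}(g)(a)|^2\frac{d_qa}{a}<\infty$.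 For $a\in\mathbb{R}_{q,+}$, $b\in\widetilde{\mathbb{R}}_{q,+}$: $g_a(x)=a^{-2\alpha-2}g(x/a)$, $g_{a,b}=\sqrt a\,T_{q,b}^\alpha(g_a)$, $\Psi^{\alpha}_{q,g}(f)(a,b)=c_{\alpha,q}\int_0^\infty f(x)\overline{g_{a,b}(x)}\,x^{2\alpha+1}d_qx$. A $q$-wavelet is an even $h$, square integrable on $\mathbb{R}_{q,+}$ for $d_qx$, with $0<C_h^c=\int_0^\infty|\mathcal{F}_q(h)(a)|^2\frac{d_qa}{a}<\infty$. With $H_a(h)(x)=\frac1{\sqrt a}h(x/a)$ and $h^c_{a,b}=T_{q,b}(H_a(h))$, the continuous $q$-wavelet transform is $\Phi_{q,h}(f)(a,b)=c_{-1/2,q}\int_0^\infty f(x)\overline{h^c_{a,b}(x)}\,d_qx$, $a\in\mathbb{R}_{q,+}$, $b\in\widetilde{\mathbb{R}}_{q,+}$. *)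

theory Defs
  imports "HOL-Analysis.Analysis"
begin

definition Rq_plus :: "real \<Rightarrow> real set" where
  "Rq_plus q = range (\<lambda>n::int. q powi n)"

definition Rq :: "real \<Rightarrow> real set" where
  "Rq q = {x. \<bar>x\<bar> \<in> Rq_plus q} \<union> {0}"

definition qpoch :: "real \<Rightarrow> real \<Rightarrow> nat \<Rightarrow> real" where
  "qpoch a q n = (\<Prod>k<n. 1 - a * q ^ k)"

definition qpoch_inf :: "real \<Rightarrow> real \<Rightarrow> real" where
  "qpoch_inf a q = prodinf (\<lambda>k. 1 - a * q ^ k)"

definition q_Gamma :: "real \<Rightarrow> real \<Rightarrow> real" where
  "q_Gamma q x = qpoch_inf q q / qpoch_inf (q powr x) q * (1 - q) powr (1 - x)"

text \<open>Jackson integrals over \<open>[0, a]\<close>, \<open>[0, \<infinity>)\<close> and \<open>[a, \<infinity>)\<close>. The series are unconditional sums;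
  a divergent one has the value 0, so where finiteness of an integral is meant as a hypothesis
  it is expressed through \<open>jackson_integrable\<close>.\<close>

definition jackson_to :: "real \<Rightarrow> real \<Rightarrow> (real \<Rightarrow> 'a::real_normed_vector) \<Rightarrow> 'a" where
  "jackson_to q a f = ((1 - q) * a) *\<^sub>R (\<Sum>\<^sub>\<infinity>n\<in>(UNIV::nat set). q ^ n *\<^sub>R f (a * q ^ n))"

definition jackson_integrable :: "real \<Rightarrow> (real \<Rightarrow> 'a::real_normed_vector) \<Rightarrow> bool" where
  "jackson_integrable q f \<longleftrightarrow> (\<lambda>n::int. (q powi n) *\<^sub>R f (q powi n)) summable_on UNIV"

definition jackson :: "real \<Rightarrow> (real \<Rightarrow> 'a::real_normed_vector) \<Rightarrow> 'a" where
  "jackson q f = (1 - q) *\<^sub>R (\<Sum>\<^sub>\<infinity>n\<in>(UNIV::int set). (q powi n) *\<^sub>R f (q powi n))"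

definition jackson_from :: "real \<Rightarrow> real \<Rightarrow> (real \<Rightarrow> 'a::real_normed_vector) \<Rightarrow> 'a" where
  "jackson_from q a f = jackson q f - jackson_to q a f"

definition q_deriv :: "real \<Rightarrow> (real \<Rightarrow> complex) \<Rightarrow> real \<Rightarrow> complex" where
  "q_deriv q f x =
     (if x = 0 then vector_derivative f (at 0) else (f x - f (q * x)) / of_real ((1 - q) * x))"

text \<open>Away from 0 the \<open>q\<close>-derivative always exists, so only differentiability at 0 is a condition.\<close>

definition inf_q_differentiable :: "real \<Rightarrow> (real \<Rightarrow> complex) \<Rightarrow> bool" where
  "inf_q_differentiable q f \<longleftrightarrow> (\<forall>k. (q_deriv q ^^ k) f differentiable (at 0))"

text \<open>A function on \<open>Rq q\<close> is represented by its extensional representative (\<open>undefined\<close> outside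
  \<open>Rq q\<close>), so that equality of functions on \<open>Rq q\<close> is equality and the operators below can be
  inverted with \<open>inv_into\<close>.\<close>

definition q_schwartz :: "real \<Rightarrow> (real \<Rightarrow> complex) set" where
  "q_schwartz q = {restrict F (Rq q) | F.
     (\<forall>x. F (- x) = F x) \<and> inf_q_differentiable q F \<and>
     (\<forall>n m. bdd_above {norm (of_real ((1 + x\<^sup>2) ^ m) * (q_deriv q ^^ k) F x) | x k. k \<le> n})}"

definition q_schwartz0 :: "real \<Rightarrow> real \<Rightarrow> (real \<Rightarrow> complex) set" where
  "q_schwartz0 q \<beta> = {f \<in> q_schwartz q.
     \<forall>k::nat. jackson q (\<lambda>x. f x * of_real (x powr (2 * real k + 2 * \<beta> + 1))) = 0}"

definition q_bessel_j :: "real \<Rightarrow> real \<Rightarrow> real \<Rightarrow> real" where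
  "q_bessel_j q \<beta> z = (\<Sum>n. (- 1) ^ n * q ^ (n * (n - 1)) * (1 - q) ^ (2 * n) * z ^ (2 * n) /
     (qpoch (q\<^sup>2) (q\<^sup>2) n * qpoch (q powr (2 * \<beta> + 2)) (q\<^sup>2) n))"

definition q_const :: "real \<Rightarrow> real \<Rightarrow> real" where
  "q_const q \<beta> = (1 + 1 / q) powr (- \<beta>) / q_Gamma (q\<^sup>2) (\<beta> + 1)"

text \<open>The parameter \<open>\<beta> = - 1 / 2\<close> gives the \<open>q\<close>-Fourier-cosine transform.\<close>

definition q_fourier :: "real \<Rightarrow> real \<Rightarrow> (real \<Rightarrow> complex) \<Rightarrow> real \<Rightarrow> complex" where
  "q_fourier q \<beta> f s = of_real (q_const q \<beta>) *
     jackson q (\<lambda>x. f x * of_real (q_bessel_j q \<beta> (s * x)) * of_real (x powr (2 * \<beta> + 1)))"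

definition q_fourier_inv :: "real \<Rightarrow> real \<Rightarrow> (real \<Rightarrow> complex) \<Rightarrow> real \<Rightarrow> complex" where
  "q_fourier_inv q \<beta> f s = of_real (q powr (- 4 * \<beta> - 2)) * q_fourier q \<beta> f s"

text \<open>The translation by \<open>x\<close> is the operator with
  \<open>q_fourier q \<beta> (q_translate q \<beta> x f) s = q_bessel_j q \<beta> (s * x) * q_fourier q \<beta> f s\<close>.\<close>

definition q_translate :: "real \<Rightarrow> real \<Rightarrow> real \<Rightarrow> (real \<Rightarrow> complex) \<Rightarrow> real \<Rightarrow> complex" where
  "q_translate q \<beta> x f =
     q_fourier_inv q \<beta> (\<lambda>s. of_real (q_bessel_j q \<beta> (s * x)) * q_fourier q \<beta> f s)"

definition q_riemann_liouville :: "real \<Rightarrow> real \<Rightarrow> (real \<Rightarrow> complex) \<Rightarrow> real \<Rightarrow> complex" where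
  "q_riemann_liouville q \<alpha> f = restrict (\<lambda>x.
     of_real ((1 + q) * q_Gamma (q\<^sup>2) (\<alpha> + 1) /
              (q_Gamma (q\<^sup>2) (1 / 2) * q_Gamma (q\<^sup>2) (\<alpha> + 1 / 2))) *
     jackson_to q 1 (\<lambda>t. of_real (qpoch_inf (t\<^sup>2 * q\<^sup>2) (q\<^sup>2) /
                                  qpoch_inf (t\<^sup>2 * q powr (2 * \<alpha> + 1)) (q\<^sup>2)) * f (x * t))) (Rq q)"

text \<open>The absolute value is the even extension. For \<open>x \<in> Rq_plus q\<close> the kernel vanishes at all
  nodes \<open>t < x\<close>, so both parts of the integral from \<open>q * x\<close> are well behaved.\<close>

definition q_weyl :: "real \<Rightarrow> real \<Rightarrow> (real \<Rightarrow> complex) \<Rightarrow> real \<Rightarrow> complex" where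
  "q_weyl q \<alpha> f = restrict (\<lambda>x.
     of_real (q * (1 + 1 / q) powr (- \<alpha> + 1 / 2) / q_Gamma (q\<^sup>2) (\<alpha> + 1 / 2)) *
     jackson_from q (q * \<bar>x\<bar>) (\<lambda>t.
       of_real (qpoch_inf (q\<^sup>2 * x\<^sup>2 / t\<^sup>2) (q\<^sup>2) /
                qpoch_inf (q powr (2 * \<alpha> + 1) * x\<^sup>2 / t\<^sup>2) (q\<^sup>2)) *
       f t * of_real (t powr (2 * \<alpha>)))) (Rq q)"

definition q_riemann_liouville_inv :: "real \<Rightarrow> real \<Rightarrow> (real \<Rightarrow> complex) \<Rightarrow> real \<Rightarrow> complex" where
  "q_riemann_liouville_inv q \<alpha> = inv_into (q_schwartz0 q (- 1 / 2)) (q_riemann_liouville q \<alpha>)"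

definition q_weyl_inv :: "real \<Rightarrow> real \<Rightarrow> (real \<Rightarrow> complex) \<Rightarrow> real \<Rightarrow> complex" where
  "q_weyl_inv q \<alpha> = inv_into (q_schwartz0 q \<alpha>) (q_weyl q \<alpha>)"

definition K_const :: "real \<Rightarrow> real \<Rightarrow> real" where
  "K_const q \<alpha> = q_Gamma (q\<^sup>2) (1 / 2) /
     (q powr (3 * \<alpha> + 3 / 2) * (1 + q) powr (\<alpha> + 1 / 2) * q_Gamma (q\<^sup>2) (\<alpha> + 1))"

definition K1 :: "real \<Rightarrow> real \<Rightarrow> (real \<Rightarrow> complex) \<Rightarrow> real \<Rightarrow> complex" where
  "K1 q \<alpha> f = restrict (\<lambda>x. of_real (K_const q \<alpha>) * q_fourier_inv q (- 1 / 2)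
     (\<lambda>s. of_real (\<bar>s\<bar> powr (2 * \<alpha> + 1)) * q_fourier q (- 1 / 2) f s) x) (Rq q)"

definition K2 :: "real \<Rightarrow> real \<Rightarrow> (real \<Rightarrow> complex) \<Rightarrow> real \<Rightarrow> complex" where
  "K2 q \<alpha> f = restrict (\<lambda>x. of_real (K_const q \<alpha>) * q_fourier_inv q \<alpha>
     (\<lambda>s. of_real (\<bar>s\<bar> powr (2 * \<alpha> + 1)) * q_fourier q \<alpha> f s) x) (Rq q)"

text \<open>With \<open>\<beta> = \<alpha>\<close> these are the admissibility constant and the notion of a \<open>q\<close>-wavelet associated
  with the \<open>q\<close>-Bessel operator, with \<open>\<beta> = - 1 / 2\<close> those of the plain \<open>q\<close>-wavelets.\<close>

definition q_adm_const :: "real \<Rightarrow> real \<Rightarrow> (real \<Rightarrow> complex) \<Rightarrow> real" where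
  "q_adm_const q \<beta> g = jackson q (\<lambda>a. (cmod (q_fourier q \<beta> g a))\<^sup>2 / a)"

definition q_wavelet :: "real \<Rightarrow> real \<Rightarrow> (real \<Rightarrow> complex) \<Rightarrow> bool" where
  "q_wavelet q \<beta> g \<longleftrightarrow>
     (\<forall>x\<in>Rq q. g (- x) = g x) \<and>
     jackson_integrable q (\<lambda>x. (cmod (g x))\<^sup>2 * x powr (2 * \<beta> + 1)) \<and>
     jackson_integrable q (\<lambda>a. (cmod (q_fourier q \<beta> g a))\<^sup>2 / a) \<and>
     0 < q_adm_const q \<beta> g"

definition bessel_atom :: "real \<Rightarrow> real \<Rightarrow> (real \<Rightarrow> complex) \<Rightarrow> real \<Rightarrow> real \<Rightarrow> real \<Rightarrow> complex" where
  "bessel_atom q \<alpha> g a b x = of_real (sqrt a) *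
     q_translate q \<alpha> b (\<lambda>y. of_real (a powr (- 2 * \<alpha> - 2)) * g (y / a)) x"

definition cos_atom :: "real \<Rightarrow> (real \<Rightarrow> complex) \<Rightarrow> real \<Rightarrow> real \<Rightarrow> real \<Rightarrow> complex" where
  "cos_atom q h a b x = q_translate q (- 1 / 2) b (\<lambda>y. of_real (1 / sqrt a) * h (y / a)) x"

definition bessel_wavelet_transform ::
  "real \<Rightarrow> real \<Rightarrow> (real \<Rightarrow> complex) \<Rightarrow> (real \<Rightarrow> complex) \<Rightarrow> real \<Rightarrow> real \<Rightarrow> complex" where
  "bessel_wavelet_transform q \<alpha> g f a b = of_real (q_const q \<alpha>) *
     jackson q (\<lambda>x. f x * cnj (bessel_atom q \<alpha> g a b x) * of_real (x powr (2 * \<alpha> + 1)))"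

definition cos_wavelet_transform ::
  "real \<Rightarrow> (real \<Rightarrow> complex) \<Rightarrow> (real \<Rightarrow> complex) \<Rightarrow> real \<Rightarrow> real \<Rightarrow> complex" where
  "cos_wavelet_transform q h f a b = of_real (q_const q (- 1 / 2)) *
     jackson q (\<lambda>x. f x * cnj (cos_atom q h a b x))"

end

theory Submission
  imports Defs
begin

text \<open>Write \<open>F\<^sub>\<beta>\<close> for the \<open>q\<close>-Bessel transform and \<open>F\<close> for the \<open>q\<close>-cosine transform, \<open>\<beta> = -1/2\<close>.  Both
formulas are the Calderon reproducing formula for one of these transforms, with the fractional
integral turned into a change of transform.

On the Fourier side, a wavelet coefficient at the pair \<open>(a, b)\<close> is the transform, evaluated at
\<open>b\<close>, of the product \<open>F f(s) cnj (F h(a s))\<close>.  Three facts drive the computation: the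
Riemann-Liouville transform maps \<open>j\<^sub>-\<^sub>1\<^sub>/\<^sub>2(s \<cdot>)\<close> to \<open>j\<^sub>\<alpha>(s \<cdot>)\<close> (\<open>rl_bessel\<close>, a \<open>q\<close>-beta integral), so it
turns a cosine transform of \<open>\<psi>\<close> into a Bessel transform of \<open>\<psi>(s) / s\<^bsup>2\<alpha>+1\<^esup>\<close>; the Weyl transform is
its adjoint up to a constant, hence \<open>F \<circ> W = F\<^sub>\<alpha>\<close> (\<open>hankel_weyl\<close>); and the operators \<open>K1\<close>, \<open>K2\<close>
multiply the transform by a constant times \<open>s\<^bsup>2\<alpha>+1\<^esup>\<close>, which repairs the power lost in between.  After that, the integral over
\<open>b\<close> is Parseval's identity and the integral over \<open>a\<close> is the multiplicative convolution with
\<open>\<bar>F\<^sub>\<alpha> g\<bar>\<^sup>2\<close>, which gives the admissibility constant (\<open>calderon_reproducing\<close>).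

The transforms only see the values on the grid \<open>q\<^sup>k\<close>, \<open>k\<close> an integer.  Because \<open>1 - q\<close> is itself a
power of \<open>q\<close>, the kernel \<open>j\<^sub>\<beta>\<close> on the grid is the Hahn-Exton function \<open>\<phi>\<close> at shifted integer
arguments, and \<open>F\<^sub>\<beta> \<circ> F\<^sub>\<beta>\<close> is a multiple of the identity by the orthogonality
\<open>hahn_exton_orthogonality\<close>.  Everything about \<open>\<phi>\<close> comes from Euler's expansion of
\<open>(x; p)\<^sub>\<infinity>\<close> and from one interchange of summations, \<open>hahn_exton_swap\<close>, which rewrites \<open>\<phi>\<close> as a
series of shifted infinite products; these vanish on half of the grid.

The inverse operators in the statement are inverses on spaces of \<open>q\<close>-Schwartz functions with
vanishing moments, so the surjectivity of both fractional integrals is part of the proof.  The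
transforms identify these spaces with the sequences on the grid that vanish to all orders at both
ends (\<open>hankel_q_schwartz0_flat\<close>, \<open>hankel_ext_in_q_schwartz0\<close>): vanishing moments make the transform
flat at 0, and an expansion in even powers at 0 makes it flat at infinity, since \<open>\<phi>\<close> is orthogonal
to all even powers (\<open>hahn_exton_moment\<close>).  On the sequence side the inverse operators are
multiplications, and preimages can be written down.\<close>

section \<open>Unconditional sums over the naturals and the integers\<close>

lemma infsum_eq_suminf:
  fixes f :: "nat \<Rightarrow> 'a::banach"
  assumes "summable (\<lambda>n. norm (f n))"
  shows "f summable_on UNIV" "infsum f UNIV = suminf f"
proof -
  have "(f has_sum suminf f) UNIV"
    by (rule norm_summable_imp_has_sum[OF assms]) (use assms summable_norm_cancel in \<open>blast intro: summable_sums\<close>)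
  thus "f summable_on UNIV" "infsum f UNIV = suminf f"
    by (auto simp: summable_on_def infsumI)
qed

lemma has_sum_sum_finite:
  fixes f :: "'i \<Rightarrow> 'a \<Rightarrow> 'b::topological_comm_monoid_add"
  assumes "finite I" "\<And>i. i \<in> I \<Longrightarrow> (f i has_sum s i) A"
  shows "((\<lambda>x. \<Sum>i\<in>I. f i x) has_sum (\<Sum>i\<in>I. s i)) A"
  using assms by (induction I) (auto intro: has_sum_add)

lemma summable_on_sum_finite:
  fixes f :: "'i \<Rightarrow> 'a \<Rightarrow> 'b::{topological_comm_monoid_add, t2_space}"
  assumes "finite I" "\<And>i. i \<in> I \<Longrightarrow> f i summable_on A"
  shows "(\<lambda>x. \<Sum>i\<in>I. f i x) summable_on A"
  using has_sum_sum_finite[where s = "\<lambda>i. infsum (f i) A" and I = I and f = f and A = A] assms by (auto simp: summable_on_def)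

lemma infsum_sum_finite:
  fixes f :: "'i \<Rightarrow> 'a \<Rightarrow> 'b::{topological_comm_monoid_add, t2_space}"
  assumes "finite I" "\<And>i. i \<in> I \<Longrightarrow> f i summable_on A"
  shows "(\<Sum>\<^sub>\<infinity>x\<in>A. \<Sum>i\<in>I. f i x) = (\<Sum>i\<in>I. \<Sum>\<^sub>\<infinity>x\<in>A. f i x)"
  using has_sum_sum_finite[where s = "\<lambda>i. infsum (f i) A" and I = I and f = f and A = A] assms by (simp add: infsumI)

lemma infsum_diff_banach:
  fixes f g :: "'a \<Rightarrow> 'b::banach"
  assumes "f summable_on A" "g summable_on A"
  shows "(\<Sum>\<^sub>\<infinity>x\<in>A. f x - g x) = infsum f A - infsum g A"
  using infsum_add[OF assms(1) summable_on_uminus[THEN iffD2, OF assms(2)]] by (simp add: infsum_uminus)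

lemma dominated_infsum:
  fixes f :: "'a \<Rightarrow> 'b::banach" and g :: "'a \<Rightarrow> real"
  assumes g: "g summable_on A" and le: "\<And>x. x \<in> A \<Longrightarrow> norm (f x) \<le> g x"
  shows "f summable_on A" "norm (infsum f A) \<le> infsum g A"
proof -
  have "(\<lambda>x. norm (f x)) summable_on A"
    by (rule summable_on_comparison_test[OF g]) (use le in auto)
  thus f: "f summable_on A" by (rule abs_summable_summable)
  show "norm (infsum f A) \<le> infsum g A"
    by (rule norm_infsum_le[OF has_sum_infsum[OF f] has_sum_infsum[OF g] le])
qed

lemma summable_on_product_bound:
  fixes f :: "'a \<Rightarrow> 'b \<Rightarrow> 'c::banach" and g :: "'a \<Rightarrow> real" and h :: "'b \<Rightarrow> real"
  assumes g: "g summable_on A" and h: "h summable_on B"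
    and bound: "\<And>x y. x \<in> A \<Longrightarrow> y \<in> B \<Longrightarrow> norm (f x y) \<le> g x * h y"
    and nonneg: "\<And>x. x \<in> A \<Longrightarrow> 0 \<le> g x" "\<And>y. y \<in> B \<Longrightarrow> 0 \<le> h y"
  shows "(\<lambda>(x, y). f x y) summable_on (A \<times> B)"
proof -
  have "(\<lambda>(x, y). g x * h y) summable_on (A \<times> B)"
  proof (rule summable_on_SigmaI)
    show "((\<lambda>y. case (x, y) of (x, y) \<Rightarrow> g x * h y) has_sum g x * infsum h B) B" if "x \<in> A" for x
      using has_sum_cmult_right[OF has_sum_infsum[OF h], of "g x"] by simp
    show "(\<lambda>x. g x * infsum h B) summable_on A"
      using g by (rule summable_on_cmult_left)
  qed (use nonneg in auto)
  hence "(\<lambda>z. norm ((\<lambda>(x, y). f x y) z)) summable_on (A \<times> B)"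
    by (rule summable_on_comparison_test) (use bound in auto)
  thus ?thesis by (rule abs_summable_summable)
qed

text \<open>Fubini in the form that is used: every double series below is dominated by a product of two
convergent series, possibly after a shift of one index.\<close>

lemma infsum_swap_product_bound:
  fixes f :: "'a \<Rightarrow> 'b \<Rightarrow> 'c::banach" and g :: "'a \<Rightarrow> real" and h :: "'b \<Rightarrow> real"
  assumes "g summable_on A" "h summable_on B"
    and "\<And>x y. x \<in> A \<Longrightarrow> y \<in> B \<Longrightarrow> norm (f x y) \<le> g x * h y"
    and "\<And>x. x \<in> A \<Longrightarrow> 0 \<le> g x" "\<And>y. y \<in> B \<Longrightarrow> 0 \<le> h y"
  shows "(\<Sum>\<^sub>\<infinity>x\<in>A. \<Sum>\<^sub>\<infinity>y\<in>B. f x y) = (\<Sum>\<^sub>\<infinity>y\<in>B. \<Sum>\<^sub>\<infinity>x\<in>A. f x y)"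
  by (rule infsum_swap_banach, rule summable_on_product_bound[OF assms])

text \<open>For summands such as \<open>(p\<^sup>k; p)\<^sub>\<infinity>\<close> that vanish on one side of the grid.\<close>

lemma has_sum_int_from:
  fixes f :: "int \<Rightarrow> 'a::{comm_monoid_add,topological_space}"
  assumes "\<And>k. k < m \<Longrightarrow> f k = 0" "((\<lambda>n::nat. f (m + int n)) has_sum S) UNIV"
  shows "(f has_sum S) UNIV"
proof -
  have "bij_betw (\<lambda>n::nat. m + int n) UNIV {m..}"
    by (rule bij_betw_byWitness[where f' = "\<lambda>k. nat (k - m)"]) auto
  hence "(f has_sum S) {m..}"
    using assms(2) has_sum_reindex_bij_betw[of "\<lambda>n. m + int n" UNIV "{m..}" f S] by simp
  thus ?thesis
    by (rule has_sum_cong_neutral[THEN iffD1, rotated -1]) (use assms(1) in auto)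
qed

text \<open>The bound with \<open>s < 1\<close> controls the sum at \<open>+\<infinity>\<close>, the bound with \<open>t > 1\<close> controls it at \<open>-\<infinity>\<close>.\<close>

lemma summable_on_int_geometric:
  fixes f :: "int \<Rightarrow> 'a::banach"
  assumes s: "0 < s" "s < 1" and t: "1 < t"
    and fs: "\<And>k. norm (f k) \<le> C * s powi k" and ft: "\<And>k. norm (f k) \<le> D * t powi k"
  shows "(\<lambda>k. norm (f k)) summable_on UNIV"
proof -
  have "(\<lambda>n. norm (f (int n))) summable_on UNIV"
  proof (rule infsum_eq_suminf(1), rule summable_comparison_test)
    show "\<exists>N. \<forall>n\<ge>N. norm (norm (norm (f (int n)))) \<le> C * s ^ n"
      using fs by (auto intro!: exI[of _ 0]) (metis power_int_of_nat)
    show "summable (\<lambda>n. C * s ^ n)" using s by (intro summable_mult summable_geometric) auto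
  qed
  moreover have "bij_betw (\<lambda>n::nat. int n) UNIV {0..}"
    by (rule bij_betw_byWitness[where f' = nat]) auto
  ultimately have 1: "(\<lambda>k. norm (f k)) summable_on {0..}"
    using summable_on_reindex_bij_betw[of int UNIV "{0..}" "\<lambda>k. norm (f k)"] by simp
  have "(\<lambda>n. norm (f (- int n - 1))) summable_on UNIV"
  proof (rule infsum_eq_suminf(1), rule summable_comparison_test)
    have "norm (f (- int n - 1)) \<le> D * (1 / t) ^ Suc n" for n
    proof -
      have "- int n - 1 = - int (Suc n)" by simp
      hence "t powi (- int n - 1) = (1 / t) ^ Suc n"
        using t by (simp only: power_int_minus power_int_of_nat power_one_over inverse_eq_divide)
      thus ?thesis using ft[of "- int n - 1"] by simp
    qed
    thus "\<exists>N. \<forall>n\<ge>N. norm (norm (norm (f (- int n - 1)))) \<le> D * (1 / t) ^ Suc n"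
      by simp
    have "summable (\<lambda>n. (1 / t) ^ n)" using t by (intro summable_geometric) auto
    thus "summable (\<lambda>n. D * (1 / t) ^ Suc n)" 
      by (intro summable_mult) (simp only: summable_Suc_iff)
  qed
  moreover have "bij_betw (\<lambda>n::nat. - int n - 1) UNIV {..<0}"
    by (rule bij_betw_byWitness[where f' = "\<lambda>k. nat (- k - 1)"]) auto
  ultimately have 2: "(\<lambda>k. norm (f k)) summable_on {..<0}"
    using summable_on_reindex_bij_betw[of "\<lambda>n. - int n - 1" UNIV "{..<0}" "\<lambda>k. norm (f k)"] by simp
  have "(\<lambda>k. norm (f k)) summable_on ({0..} \<union> {..<0})"
    by (rule summable_on_Un_disjoint[OF 1 2]) auto
  moreover have "{0..} \<union> {..<0} = (UNIV :: int set)" by auto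
  ultimately show ?thesis by simp
qed

lemma powi_eq_powr: "0 < (x::real) \<Longrightarrow> x powi k = x powr real_of_int k"
  by (simp add: powr_real_of_int')

lemma powr_powi: "0 < (x::real) \<Longrightarrow> (x powr a) powi k = x powr (a * real_of_int k)"
  by (simp add: powi_eq_powr powr_powr)

lemma infsum_shift:
  fixes f :: "int \<Rightarrow> 'a::{comm_monoid_add,t2_space}"
  shows "(\<Sum>\<^sub>\<infinity>k. f (k + m)) = (\<Sum>\<^sub>\<infinity>k. f k)"
  by (rule infsum_reindex_bij_betw[of "\<lambda>k. k + m" UNIV UNIV f])
    (rule bij_betw_byWitness[where f' = "\<lambda>k. k - m"], auto)

lemma infsum_single:
  fixes f :: "'b \<Rightarrow> 'a::{comm_monoid_add,t2_space}"
  assumes "\<And>k. k \<noteq> n \<Longrightarrow> f k = 0"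
  shows "(\<Sum>\<^sub>\<infinity>k. f k) = f n"
proof -
  have "(\<Sum>\<^sub>\<infinity>k. f k) = (\<Sum>\<^sub>\<infinity>k\<in>{n}. f k)"
    by (rule infsum_cong_neutral) (use assms in auto)
  thus ?thesis by simp
qed

lemma infsum_of_real: "(\<Sum>\<^sub>\<infinity>x\<in>A. complex_of_real (f x)) = of_real (\<Sum>\<^sub>\<infinity>x\<in>A. f x)"
  by (rule infsum_bounded_linear_strong[OF summable_on_bounded_linear_iff[OF bounded_linear_of_real bounded_linear_Re] bounded_linear_of_real])
    simp

text \<open>Dominated convergence, needed only to identify values at 0 with limits along the grid.\<close>

lemma tendsto_infsum_dominated:
  fixes f :: "nat \<Rightarrow> 'a \<Rightarrow> complex" and h :: "'a \<Rightarrow> real"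
  assumes lim: "\<And>x. x \<in> A \<Longrightarrow> (\<lambda>n. f n x) \<longlonglongrightarrow> g x"
    and bound: "\<And>n x. x \<in> A \<Longrightarrow> norm (f n x) \<le> h x" and h: "h summable_on A"
  shows "(\<lambda>n. infsum (f n) A) \<longlonglongrightarrow> infsum g A"
proof -
  have g: "norm (g x) \<le> h x" if "x \<in> A" for x
    by (rule LIMSEQ_le_const2[OF tendsto_norm[OF lim[OF that]]]) (use bound[OF that] in auto)
  have s: "Infinite_Set_Sum.abs_summable_on F A" if "\<And>x. x \<in> A \<Longrightarrow> norm (F x) \<le> h x" for F :: "'a \<Rightarrow> complex"
    unfolding abs_summable_equivalent[symmetric]
    by (rule summable_on_comparison_test[OF h]) (use that in auto)
  have eq: "infsum F A = integral\<^sup>L (count_space A) F" if "\<And>x. x \<in> A \<Longrightarrow> norm (F x) \<le> h x" for F :: "'a \<Rightarrow> complex"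
    using infsetsum_infsum[OF s[OF that]] by (simp add: infsetsum_def)
  have "norm (h x) \<le> h x" if "x \<in> A" for x
    using order_trans[OF norm_ge_zero g[OF that]] by simp
  hence "(\<lambda>x. norm (h x)) summable_on A"
    by (intro summable_on_comparison_test[OF h]) auto
  hence ih: "integrable (count_space A) h"
    unfolding abs_summable_equivalent Infinite_Set_Sum.abs_summable_on_def .
  have "(\<lambda>n. integral\<^sup>L (count_space A) (f n)) \<longlonglongrightarrow> integral\<^sup>L (count_space A) g"
    by (rule integral_dominated_convergence[OF _ _ ih])
      (use lim bound in \<open>auto simp: AE_count_space\<close>)
  thus ?thesis using eq[OF bound] eq[OF g] by simp
qed

text \<open>Turns the one-sided convolution that defines the Weyl transform into a sum over the whole grid.\<close>

lemma infsum_int_atMost: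
  fixes F :: "int \<Rightarrow> 'a::{comm_monoid_add,t2_space}"
  shows "(\<Sum>\<^sub>\<infinity>j::nat. F (k - int j)) = (\<Sum>\<^sub>\<infinity>l. if l \<le> k then F l else 0)"
proof -
  have "bij_betw (\<lambda>j::nat. k - int j) UNIV {..k}"
    by (rule bij_betw_byWitness[where f' = "\<lambda>l. nat (k - l)"]) auto
  hence "(\<Sum>\<^sub>\<infinity>j::nat. F (k - int j)) = (\<Sum>\<^sub>\<infinity>l\<in>{..k}. F l)"
    by (rule infsum_reindex_bij_betw)
  also have "\<dots> = (\<Sum>\<^sub>\<infinity>l. if l \<le> k then F l else 0)"
    by (rule infsum_cong_neutral) auto
  finally show ?thesis .
qed

text \<open>The integral over the dilation parameter: on a logarithmic scale it is a convolution, so it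
factors.\<close>

lemma infsum_swap_convolution:
  fixes A B :: "int \<Rightarrow> complex"
  assumes A: "(\<lambda>m. norm (A m)) summable_on UNIV" and B: "(\<lambda>i. norm (B i)) summable_on UNIV"
  shows "(\<Sum>\<^sub>\<infinity>i. \<Sum>\<^sub>\<infinity>m. A m * B (m + i)) = (\<Sum>\<^sub>\<infinity>m. A m) * (\<Sum>\<^sub>\<infinity>i. B i)"
proof -
  let ?T = "\<lambda>(m, i). A m * B i"
  have T: "?T summable_on UNIV \<times> UNIV"
    by (rule summable_on_product_bound[OF A B]) (simp_all add: norm_mult)
  have "bij_betw (\<lambda>(m, i). (m, m + i)) (UNIV \<times> UNIV) (UNIV \<times> (UNIV :: int set))"
    by (rule bij_betw_byWitness[where f' = "\<lambda>(m, k). (m, k - m)"]) auto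
  from summable_on_reindex_bij_betw[OF this, of ?T] T
  have "(\<lambda>(m, i). A m * B (m + i)) summable_on UNIV \<times> UNIV"
    by (simp add: case_prod_unfold)
  from infsum_swap_banach[OF this]
  have "(\<Sum>\<^sub>\<infinity>i. \<Sum>\<^sub>\<infinity>m. A m * B (m + i)) = (\<Sum>\<^sub>\<infinity>m. \<Sum>\<^sub>\<infinity>i. A m * B (m + i))" by simp
  also have "\<dots> = (\<Sum>\<^sub>\<infinity>m. A m * (\<Sum>\<^sub>\<infinity>i. B i))"
  proof (rule infsum_cong)
    fix m
    have "(\<Sum>\<^sub>\<infinity>i. B (m + i)) = (\<Sum>\<^sub>\<infinity>i. B i)"
      using infsum_shift[of B m] by (simp add: add.commute)
    thus "(\<Sum>\<^sub>\<infinity>i. A m * B (m + i)) = A m * (\<Sum>\<^sub>\<infinity>i. B i)" by (simp only: infsum_cmult_right')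
  qed
  finally show ?thesis by (simp only: infsum_cmult_left')
qed

section \<open>Euler's identity and the q-binomial theorem\<close>

locale q_base =
  fixes p :: real
  assumes p_pos: "0 < p" and p_less_1: "p < 1"
begin

lemma qpoch_0 [simp]: "qpoch a p 0 = 1"
  by (simp add: qpoch_def)

lemma qpoch_Suc: "qpoch a p (Suc n) = qpoch a p n * (1 - a * p ^ n)"
  by (simp add: qpoch_def)

lemma convergent_prod_qpoch: "convergent_prod (\<lambda>k. 1 - a * p ^ k)"
proof -
  have "summable (\<lambda>k. norm (1 - a * p ^ k - 1))"
    using p_pos p_less_1 by (simp add: abs_mult summable_geometric summable_mult)
  thus ?thesis
    using abs_convergent_prod_conv_summable abs_convergent_prod_imp_convergent_prod by blast
qed

lemma qpoch_LIMSEQ: "qpoch a p \<longlonglongrightarrow> qpoch_inf a p"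
proof -
  have "(\<lambda>n. \<Prod>k\<le>n. 1 - a * p ^ k) \<longlonglongrightarrow> qpoch_inf a p"
    unfolding qpoch_inf_def using convergent_prod_LIMSEQ[OF convergent_prod_qpoch] by blast
  hence "(\<lambda>n. qpoch a p (Suc n)) \<longlonglongrightarrow> qpoch_inf a p"
    by (simp add: qpoch_def lessThan_Suc_atMost)
  thus ?thesis
    by (rule LIMSEQ_imp_Suc)
qed

lemma qpoch_add: "qpoch a p (n + m) = qpoch a p n * qpoch (a * p ^ n) p m"
  by (induction m) (auto simp: qpoch_Suc power_add mult_ac)

lemma qpoch_inf_split: "qpoch_inf a p = qpoch a p n * qpoch_inf (a * p ^ n) p"
proof (rule LIMSEQ_unique)
  show "(\<lambda>m. qpoch a p (m + n)) \<longlonglongrightarrow> qpoch_inf a p"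
    using qpoch_LIMSEQ by (rule LIMSEQ_ignore_initial_segment)
  show "(\<lambda>m. qpoch a p (m + n)) \<longlonglongrightarrow> qpoch a p n * qpoch_inf (a * p ^ n) p"
    unfolding add.commute[of _ n] qpoch_add by (intro tendsto_intros qpoch_LIMSEQ)
qed

lemma qpoch_pos:
  assumes "a < 1"
  shows "0 < qpoch a p n"
  unfolding qpoch_def
proof (rule prod_pos)
  fix k assume "k \<in> {..<n}"
  have "p ^ k \<le> 1" "0 < p ^ k"
    using p_pos p_less_1 by (auto intro: power_le_one)
  hence "a * p ^ k < 1"
    using assms by (smt (verit) mult_le_cancel_right1 mult_less_cancel_right1 mult_right_mono mult_neg_pos)
  thus "0 < 1 - a * p ^ k" by simp
qed

lemma qpoch_le_1:
  assumes "0 \<le> a" "a \<le> 1"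
  shows "qpoch a p n \<in> {0..1}"
proof -
  have "a * p ^ k \<in> {0..1}" for k
    using assms p_pos p_less_1 by (simp add: mult_le_one power_le_one)
  thus ?thesis
    unfolding qpoch_def by (auto intro!: prod_nonneg prod_le_1)
qed

lemma qpoch_inf_le_1:
  assumes "0 \<le> a" "a \<le> 1"
  shows "qpoch_inf a p \<in> {0..1}"
  by (rule Lim_in_closed_set[OF _ _ _ qpoch_LIMSEQ[of a]])
    (use qpoch_le_1[OF assms] in auto)

lemma qpoch_inf_pos:
  assumes "a < 1"
  shows "0 < qpoch_inf a p"
proof -
  have "0 \<le> qpoch_inf a p"
    by (rule LIMSEQ_le_const[OF qpoch_LIMSEQ]) (auto intro: less_imp_le qpoch_pos[OF assms])
  moreover have "1 - a * p ^ k \<noteq> 0" for k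
    using qpoch_pos[OF assms, of "Suc k"] qpoch_pos[OF assms, of k] by (auto simp: qpoch_Suc)
  hence "qpoch_inf a p \<noteq> 0"
    unfolding qpoch_inf_def using prodinf_nonzero convergent_prod_qpoch by blast
  ultimately show ?thesis by simp
qed

lemma qpoch_inf_0 [simp]: "qpoch_inf 0 p = 1"
  by (simp add: qpoch_inf_def)

text \<open>The product contains the factor \<open>1 - p\<^sup>i p\<^bsup>-i\<^esup>\<close>.  This vanishing on half of the grid is what makes
the two-sided sums below computable.\<close>

lemma qpoch_inf_powi_nonpos:
  assumes "i \<le> 0"
  shows "qpoch_inf (p powi i) p = 0"
proof -
  define n where "n = nat (- i)"
  have "p powi i * p ^ n = 1"
    using assms p_pos unfolding n_def by (simp add: power_int_def power_inverse)
  hence "qpoch (p powi i) p (Suc n) = 0"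
    by (simp add: qpoch_Suc)
  thus ?thesis
    by (subst qpoch_inf_split[of _ "Suc n"]) simp
qed

lemma qpoch_inf_powi_bounds: "qpoch_inf (p powi i) p \<in> {0..1}"
proof (cases "i \<le> 0")
  case True thus ?thesis by (simp add: qpoch_inf_powi_nonpos)
next
  case False
  thus ?thesis
    using p_pos p_less_1 by (intro qpoch_inf_le_1) (auto simp: power_int_def power_le_one)
qed

text \<open>These are the numbers \<open>(-1)\<^sup>n p\<^bsup>n(n-1)/2\<^esup> / (p; p)\<^sub>n\<close>, written as a product of ratios because the
proofs only use the recursion.\<close>

definition euler_coeff :: "nat \<Rightarrow> real" where
  "euler_coeff n = (\<Prod>k<n. - (p ^ k) / (1 - p ^ Suc k))"

lemma euler_coeff_0 [simp]: "euler_coeff 0 = 1"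
  by (simp add: euler_coeff_def)

lemma one_minus_p_power_pos: "0 < 1 - p ^ Suc n"
  using p_pos p_less_1 power_Suc_less_one[of p n] by simp

lemma euler_coeff_Suc: "euler_coeff (Suc n) * (1 - p ^ Suc n) = - (p ^ n) * euler_coeff n"
proof -
  have "euler_coeff (Suc n) = euler_coeff n * (- (p ^ n) / (1 - p ^ Suc n))"
    unfolding euler_coeff_def by simp
  thus ?thesis using one_minus_p_power_pos[of n] by (simp add: field_simps)
qed

lemma abs_summable_euler_coeff: "summable (\<lambda>n. \<bar>euler_coeff n\<bar> * \<bar>x\<bar> ^ n)"
proof -
  have "(\<lambda>n. p ^ n * (\<bar>x\<bar> / (1 - p))) \<longlonglongrightarrow> 0 * (\<bar>x\<bar> / (1 - p))"
    using p_pos p_less_1 by (intro tendsto_intros) auto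
  hence "eventually (\<lambda>n. p ^ n * (\<bar>x\<bar> / (1 - p)) < 1 / 2) sequentially"
    by (intro order_tendstoD) auto
  then obtain N where N: "\<And>n. n \<ge> N \<Longrightarrow> p ^ n * (\<bar>x\<bar> / (1 - p)) < 1 / 2"
    by (auto simp: eventually_sequentially)
  show ?thesis
  proof (rule summable_ratio_test[of "1/2" N])
    fix n assume n: "n \<ge> N"
    have eq: "\<bar>euler_coeff (Suc n)\<bar> = p ^ n / (1 - p ^ Suc n) * \<bar>euler_coeff n\<bar>"
    proof -
      have "euler_coeff (Suc n) = - (p ^ n) / (1 - p ^ Suc n) * euler_coeff n"
        using euler_coeff_Suc[of n] one_minus_p_power_pos[of n] by (simp add: field_simps)
      thus ?thesis using p_pos one_minus_p_power_pos[of n] by (simp add: abs_mult)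
    qed
    have "p ^ n / (1 - p ^ Suc n) \<le> p ^ n / (1 - p)"
    proof (rule divide_left_mono)
      show "1 - p \<le> 1 - p ^ Suc n"
        using p_pos p_less_1 by (simp add: mult_left_le power_le_one)
      show "0 \<le> p ^ n" using p_pos by simp
      show "0 < (1 - p ^ Suc n) * (1 - p)"
        using one_minus_p_power_pos[of n] p_less_1 by simp
    qed
    hence "p ^ n / (1 - p ^ Suc n) * \<bar>x\<bar> \<le> 1 / 2"
      using N[OF n] by (smt (verit) abs_ge_zero mult_right_mono times_divide_eq_left times_divide_eq_right)
    hence "(p ^ n / (1 - p ^ Suc n) * \<bar>x\<bar>) * (\<bar>euler_coeff n\<bar> * \<bar>x\<bar> ^ n) \<le> 1 / 2 * (\<bar>euler_coeff n\<bar> * \<bar>x\<bar> ^ n)"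
      by (rule mult_right_mono) simp
    thus "norm (\<bar>euler_coeff (Suc n)\<bar> * \<bar>x\<bar> ^ Suc n) \<le> 1 / 2 * norm (\<bar>euler_coeff n\<bar> * \<bar>x\<bar> ^ n)"
      unfolding real_norm_def abs_mult abs_abs power_abs unfolding eq power_Suc by (simp only: mult_ac)
  qed auto
qed

lemma summable_euler_coeff: "summable (\<lambda>n. euler_coeff n * x ^ n)"
  using abs_summable_euler_coeff[of x]
  by (intro summable_norm_cancel[of "\<lambda>n. euler_coeff n * x ^ n"]) (simp add: abs_mult power_abs)

text \<open>Euler's expansion.  The power series \<open>H\<close> satisfies \<open>H x = (1 - x) H (p x)\<close>; iterating and using
continuity at 0 produces the infinite product.\<close>

lemma euler_sum: "qpoch_inf x p = (\<Sum>n. euler_coeff n * x ^ n)"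
proof -
  define H where "H = (\<lambda>x. \<Sum>n. euler_coeff n * x ^ n)"
  have step: "H x = (1 - x) * H (x * p)" for x
  proof -
    let ?e = "euler_coeff"
    have s: "summable (\<lambda>n. ?e n * (x * p) ^ n)" by (rule summable_euler_coeff)
    have "H x = ?e 0 + (\<Sum>n. ?e (Suc n) * x ^ Suc n)"
      unfolding H_def using suminf_split_head[OF summable_euler_coeff[of x]] by simp
    also have "(\<lambda>n. ?e (Suc n) * x ^ Suc n)
        = (\<lambda>n. ?e (Suc n) * (x * p) ^ Suc n - x * (?e n * (x * p) ^ n))"
    proof
      fix n
      have "?e (Suc n) * x ^ Suc n
          = ?e (Suc n) * (x * p) ^ Suc n + (?e (Suc n) * (1 - p ^ Suc n)) * x ^ Suc n"
        by (simp add: algebra_simps power_mult_distrib)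
      also have "\<dots> = ?e (Suc n) * (x * p) ^ Suc n - x * (?e n * (x * p) ^ n)"
        unfolding euler_coeff_Suc by (simp add: algebra_simps power_mult_distrib)
      finally show "?e (Suc n) * x ^ Suc n
          = ?e (Suc n) * (x * p) ^ Suc n - x * (?e n * (x * p) ^ n)" .
    qed
    also have "(\<Sum>n. ?e (Suc n) * (x * p) ^ Suc n - x * (?e n * (x * p) ^ n))
        = (\<Sum>n. ?e (Suc n) * (x * p) ^ Suc n) - x * H (x * p)"
      unfolding H_def by (subst suminf_diff[symmetric])
        (auto intro!: summable_mult s suminf_mult[symmetric] simp: summable_Suc_iff[of "\<lambda>n. ?e n * (x * p) ^ n", simplified] suminf_mult[OF s] s[simplified])
    also have "(\<Sum>n. ?e (Suc n) * (x * p) ^ Suc n) = H (x * p) - ?e 0"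
      unfolding H_def using suminf_split_head[OF s] by simp
    finally show ?thesis by (simp add: algebra_simps)
  qed
  have iter: "H x = qpoch x p n * H (x * p ^ n)" for n
  proof (induction n)
    case (Suc n)
    show ?case
      unfolding Suc.IH step[of "x * p ^ n"] by (simp add: qpoch_Suc mult_ac)
  qed simp
  have "isCont H 0"
    unfolding H_def by (rule isCont_powser'[of _ _ "\<lambda>n. euler_coeff n" "1 :: real"])
      (use summable_euler_coeff[of 1] in auto)
  moreover have "(\<lambda>n. x * p ^ n) \<longlonglongrightarrow> x * 0"
    using p_pos p_less_1 by (intro tendsto_intros) auto
  ultimately have "(\<lambda>n. H (x * p ^ n)) \<longlonglongrightarrow> H 0"
    using isCont_tendsto_compose[of 0 H] by simp
  moreover have "H 0 = 1"
    unfolding H_def by (simp add: powser_zero)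
  ultimately have "(\<lambda>n. qpoch x p n * H (x * p ^ n)) \<longlonglongrightarrow> qpoch_inf x p * 1"
    by (intro tendsto_mult qpoch_LIMSEQ) simp
  hence "qpoch_inf x p = H x"
    unfolding iter[symmetric] by (simp add: LIMSEQ_const_iff)
  thus ?thesis unfolding H_def .
qed

lemma summable_q_binomial:
  assumes "\<bar>z\<bar> < 1"
  shows "summable (\<lambda>n. qpoch a p n / qpoch p p n * z ^ n)"
proof -
  have "(\<lambda>n. qpoch a p n / qpoch p p n) \<longlonglongrightarrow> qpoch_inf a p / qpoch_inf p p"
    using qpoch_inf_pos[of p] p_less_1 by (intro tendsto_intros qpoch_LIMSEQ) auto
  hence "Bseq (\<lambda>n. qpoch a p n / qpoch p p n)"
    by (rule convergent_imp_Bseq[OF convergentI])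
  then obtain K where "\<forall>n. norm (qpoch a p n / qpoch p p n) \<le> K"
    by (rule BseqE)
  hence K: "\<bar>qpoch a p n / qpoch p p n\<bar> \<le> K" for n by simp
  show ?thesis
  proof (rule summable_comparison_test[of _ "\<lambda>n. K * \<bar>z\<bar> ^ n"])
    show "\<exists>N. \<forall>n\<ge>N. norm (qpoch a p n / qpoch p p n * z ^ n) \<le> K * \<bar>z\<bar> ^ n"
      unfolding real_norm_def abs_mult[of _ "z ^ _"] power_abs
      using K by (intro exI[of _ 0] allI impI mult_right_mono) auto
  qed (use assms in \<open>auto intro!: summable_mult summable_geometric\<close>)
qed

text \<open>Same method as for Euler's expansion, with the functional equation
\<open>(1 - x) H x = (1 - a x) H (p x)\<close>.\<close>

lemma q_binomial_theorem:
  assumes z: "\<bar>z\<bar> < 1"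
  shows "(\<Sum>n. qpoch a p n / qpoch p p n * z ^ n) = qpoch_inf (a * z) p / qpoch_inf z p"
proof -
  define b where "b = (\<lambda>n. qpoch a p n / qpoch p p n)"
  define H where "H = (\<lambda>x. \<Sum>n. b n * x ^ n)"
  have b0: "b 0 = 1" by (simp add: b_def)
  have bSuc: "b (Suc n) * (1 - p ^ Suc n) = b n * (1 - a * p ^ n)" for n
    using one_minus_p_power_pos[of n] qpoch_pos[of p n] p_less_1 
    by (simp add: b_def qpoch_Suc field_simps)
  have sb: "summable (\<lambda>n. b n * x ^ n)" if "\<bar>x\<bar> < 1" for x
    unfolding b_def by (rule summable_q_binomial[OF that])
  have small: "\<bar>x * p ^ n\<bar> < 1" if "\<bar>x\<bar> < 1" for x n
  proof -
    have "\<bar>x * p ^ n\<bar> \<le> \<bar>x\<bar> * 1"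
      unfolding abs_mult using p_pos p_less_1 by (intro mult_left_mono) (auto simp: power_le_one)
    thus ?thesis using that by simp
  qed
  have step: "(1 - x) * H x = (1 - a * x) * H (x * p)" if x: "\<bar>x\<bar> < 1" for x
  proof -
    have s1: "summable (\<lambda>n. b n * x ^ n)" by (rule sb[OF x])
    have s2: "summable (\<lambda>n. b n * (x * p) ^ n)" by (rule sb) (use small[OF x, of 1] in simp)
    have "H x = 1 + (\<Sum>n. b (Suc n) * x ^ Suc n)"
      unfolding H_def using suminf_split_head[OF s1] b0 by simp
    moreover have "H (x * p) = 1 + (\<Sum>n. b (Suc n) * (x * p) ^ Suc n)"
      unfolding H_def using suminf_split_head[OF s2] b0 by simp
    moreover have "(\<lambda>n. b (Suc n) * x ^ Suc n - b (Suc n) * (x * p) ^ Suc n)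
         = (\<lambda>n. x * (b n * x ^ n) - a * x * (b n * (x * p) ^ n))"
    proof
      fix n
      have "b (Suc n) * x ^ Suc n - b (Suc n) * (x * p) ^ Suc n = (b (Suc n) * (1 - p ^ Suc n)) * x ^ Suc n"
        by (simp add: algebra_simps power_mult_distrib)
      also have "\<dots> = x * (b n * x ^ n) - a * x * (b n * (x * p) ^ n)"
        unfolding bSuc by (simp add: algebra_simps power_mult_distrib)
      finally show "b (Suc n) * x ^ Suc n - b (Suc n) * (x * p) ^ Suc n
          = x * (b n * x ^ n) - a * x * (b n * (x * p) ^ n)" .
    qed
    moreover have "(\<Sum>n. b (Suc n) * x ^ Suc n) - (\<Sum>n. b (Suc n) * (x * p) ^ Suc n)
        = (\<Sum>n. b (Suc n) * x ^ Suc n - b (Suc n) * (x * p) ^ Suc n)"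
      by (rule suminf_diff)
        (use s1 s2 summable_Suc_iff[of "\<lambda>n. b n * x ^ n"] summable_Suc_iff[of "\<lambda>n. b n * (x*p) ^ n"] in auto)
    moreover have "(\<Sum>n. x * (b n * x ^ n) - a * x * (b n * (x * p) ^ n)) = x * H x - a * x * H (x * p)"
      unfolding H_def suminf_mult[OF s1, symmetric] suminf_mult[OF s2, symmetric]
      by (rule suminf_diff[symmetric]) (intro summable_mult s1 s2)+
    ultimately have "H x - H (x * p) = x * H x - a * x * H (x * p)" by simp
    thus ?thesis by (simp add: algebra_simps)
  qed
  have iter: "qpoch z p n * H z = qpoch (a * z) p n * H (z * p ^ n)" for n
  proof (induction n)
    case (Suc n)
    have "qpoch z p (Suc n) * H z = qpoch (a * z) p n * ((1 - z * p ^ n) * H (z * p ^ n))"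
      by (simp add: qpoch_Suc Suc.IH[symmetric] mult_ac)
    also have "\<dots> = qpoch (a * z) p (Suc n) * H (z * p ^ Suc n)"
      unfolding step[OF small[OF z]] by (simp add: qpoch_Suc mult_ac)
    finally show ?case .
  qed simp
  have "isCont H 0"
    unfolding H_def by (rule isCont_powser'[of _ _ "\<lambda>n. b n" "1/2 :: real"])
      (use sb[of "1/2"] in auto)
  moreover have "(\<lambda>n. z * p ^ n) \<longlonglongrightarrow> z * 0"
    using p_pos p_less_1 by (intro tendsto_intros) auto
  ultimately have "(\<lambda>n. H (z * p ^ n)) \<longlonglongrightarrow> H 0"
    using isCont_tendsto_compose[of 0 H] by simp
  moreover have "H 0 = 1"
    unfolding H_def by (simp add: powser_zero b0)
  ultimately have "(\<lambda>n. qpoch (a * z) p n * H (z * p ^ n)) \<longlonglongrightarrow> qpoch_inf (a * z) p * 1"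
    by (intro tendsto_mult qpoch_LIMSEQ) simp
  moreover have "(\<lambda>n. qpoch z p n * H z) \<longlonglongrightarrow> qpoch_inf z p * H z"
    by (intro tendsto_intros qpoch_LIMSEQ)
  ultimately have "qpoch_inf z p * H z = qpoch_inf (a * z) p"
    unfolding iter using LIMSEQ_unique by fastforce
  moreover have "qpoch_inf z p > 0" using z by (intro qpoch_inf_pos) auto
  ultimately show ?thesis unfolding H_def b_def by (simp add: field_simps)
qed

text \<open>The coefficients of \<open>(z; p)\<^sub>\<infinity>\<close> and \<open>1 / (z; p)\<^sub>\<infinity>\<close> are convolution inverses.  The sum telescopes:
its partial sums have a closed form.\<close>

lemma euler_coeff_convolution:
  assumes "0 < d"
  shows "(\<Sum>j\<le>d. euler_coeff j / qpoch p p (d - j)) = 0"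
proof -
  have P: "qpoch p p n > 0" for n using qpoch_pos p_less_1 by blast
  \<comment> \<open>The closed form of the partial sums; for \<open>i = d - 1\<close> it is the negative of the last term.\<close>
  have part: "(\<Sum>j\<le>i. euler_coeff j / qpoch p p (d - j))
      = euler_coeff i * p ^ i / (qpoch p p (d - 1 - i) * (1 - p ^ d))" if "i < d" for i
    using that
  proof (induction i)
    case 0
    have "qpoch p p d = qpoch p p (d - 1) * (1 - p ^ d)"
      using assms by (cases d) (auto simp: qpoch_Suc)
    thus ?case by simp
  next
    case (Suc i)
    define m where "m = d - 1 - Suc i"
    have d: "d = m + Suc (Suc i)" using Suc.prems unfolding m_def by simp
    have ei: "euler_coeff i * p ^ i = - (euler_coeff (Suc i) * (1 - p ^ Suc i))"
      unfolding euler_coeff_Suc by simp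
    have q1: "qpoch p p (Suc m) = qpoch p p m * (1 - p ^ Suc m)" by (simp add: qpoch_Suc)
    have pd: "1 - p ^ d > 0" using one_minus_p_power_pos[of "d - 1"] assms by simp
    have pm: "1 - p ^ Suc m > 0" by (rule one_minus_p_power_pos)
    have pdd: "p ^ d = p ^ Suc m * p ^ Suc i" unfolding d by (simp add: power_add)
    have d1: "d - 1 - i = Suc m" "d - Suc i = Suc m" "i < d" unfolding d by simp_all
    have "(\<Sum>j\<le>Suc i. euler_coeff j / qpoch p p (d - j))
       = euler_coeff i * p ^ i / (qpoch p p (Suc m) * (1 - p ^ d)) + euler_coeff (Suc i) / qpoch p p (Suc m)"
      unfolding sum.atMost_Suc Suc.IH[OF d1(3)] d1 by (rule refl)
    also have "\<dots> = euler_coeff (Suc i) * (1 - p ^ d - (1 - p ^ Suc i)) / (qpoch p p (Suc m) * (1 - p ^ d))"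
    proof -
      have "- (E * F) / (A * B) + E / A = E * (B - F) / (A * B)" if "A > 0" "B > 0" for A B E F :: real
        using that by (simp add: field_simps)
      from this[OF P pd] show ?thesis unfolding ei .
    qed
    also have "1 - p ^ d - (1 - p ^ Suc i) = p ^ Suc i * (1 - p ^ Suc m)"
      unfolding pdd by (simp add: algebra_simps)
    also have "euler_coeff (Suc i) * (p ^ Suc i * (1 - p ^ Suc m)) / (qpoch p p (Suc m) * (1 - p ^ d))
      = (euler_coeff (Suc i) * p ^ Suc i) * (1 - p ^ Suc m) / ((qpoch p p m * (1 - p ^ d)) * (1 - p ^ Suc m))"
      unfolding q1 by (simp only: mult_ac)
    also have "\<dots> = euler_coeff (Suc i) * p ^ Suc i / (qpoch p p m * (1 - p ^ d))"
      using pm by (intro mult_divide_mult_cancel_right) linarith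
    finally show ?case unfolding m_def .
  qed
  obtain c where c: "d = Suc c" using assms by (cases d) auto
  have "(\<Sum>j\<le>d. euler_coeff j / qpoch p p (d - j)) = euler_coeff c * p ^ c / (1 - p ^ d) + euler_coeff d"
    unfolding c using part[of c] by (simp add: c)
  also have "euler_coeff c * p ^ c = - (euler_coeff d * (1 - p ^ d))"
    unfolding c euler_coeff_Suc by simp
  finally show ?thesis using one_minus_p_power_pos[of c] c by simp
qed

section \<open>The Hahn-Exton q-Bessel function on a geometric grid\<close>

lemma qpoch_inf_p_powi: "qpoch_inf (p powi (int n + 1)) p = qpoch_inf p p / qpoch p p n"
proof -
  have "qpoch_inf p p = qpoch p p n * qpoch_inf (p * p ^ n) p"
    by (rule qpoch_inf_split)
  moreover have "p * p ^ n = p powi (int n + 1)"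
    using p_pos by (simp add: power_int_add mult_ac)
  ultimately show ?thesis using qpoch_pos[of p n] p_less_1 by (simp add: field_simps)
qed

text \<open>A Mellin transform on the grid: the summands with \<open>k + j \<le> 0\<close> vanish and the others form the
\<open>q\<close>-binomial series with \<open>a = 0\<close>.\<close>

lemma has_sum_powi_qpoch_inf:
  assumes z: "0 < z" "z < 1"
  shows "((\<lambda>k. z powi k * qpoch_inf (p powi (k + j)) p) has_sum
           z powi (1 - j) * qpoch_inf p p / qpoch_inf z p) UNIV"
proof (rule has_sum_int_from[of "1 - j"])
  fix k assume "k < 1 - j"
  thus "z powi k * qpoch_inf (p powi (k + j)) p = 0"
    by (simp add: qpoch_inf_powi_nonpos)
next
  have q0: "qpoch 0 p n = 1" for n by (simp add: qpoch_def)
  define g where "g = (\<lambda>n. qpoch 0 p n / qpoch p p n * z ^ n)"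
  have gpos: "0 \<le> g n" for n 
    using z qpoch_pos[of p n] p_less_1 by (simp add: g_def q0)
  have "summable g" unfolding g_def by (rule summable_q_binomial) (use z in auto)
  hence "(g has_sum suminf g) UNIV"
    using infsum_eq_suminf[of g] gpos by (simp add: has_sum_iff)
  moreover have "suminf g = 1 / qpoch_inf z p"
    unfolding g_def by (subst q_binomial_theorem) (use z in auto)
  ultimately have "((\<lambda>n. z powi (1 - j) * qpoch_inf p p * g n) has_sum
      z powi (1 - j) * qpoch_inf p p * (1 / qpoch_inf z p)) UNIV"
    by (intro has_sum_cmult_right) simp
  moreover have "z powi (1 - j + int n) * qpoch_inf (p powi (1 - j + int n + j)) p
      = z powi (1 - j) * qpoch_inf p p * g n" for n
  proof -
    have "1 - j + int n + j = int n + 1" by simp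
    thus ?thesis
      unfolding g_def q0 using z by (simp only: qpoch_inf_p_powi) (simp add: power_int_add)
  qed
  ultimately show "((\<lambda>n. z powi (1 - j + int n) * qpoch_inf (p powi (1 - j + int n + j)) p) has_sum
      z powi (1 - j) * qpoch_inf p p / qpoch_inf z p) UNIV"
    by simp
qed

text \<open>The \<open>\<^sub>1\<phi>\<^sub>1\<close> series \<open>\<^sub>1\<phi>\<^sub>1(0; w; p, y)\<close>.\<close>

definition hahn_exton :: "real \<Rightarrow> real \<Rightarrow> real" where
  "hahn_exton w y = (\<Sum>n. euler_coeff n / qpoch w p n * y ^ n)"

end

locale hahn_exton_base = q_base +
  fixes w :: real
  assumes w_pos: "0 < w" and w_less_1: "w < 1"
begin

abbreviation "hcoeff n \<equiv> euler_coeff n / qpoch w p n"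
abbreviation "\<phi> k \<equiv> hahn_exton w (p powi k)"

lemma w_inf_pos: "0 < qpoch_inf w p"
  by (rule qpoch_inf_pos[OF w_less_1])

lemma qpoch_w_pos: "0 < qpoch w p n"
  by (rule qpoch_pos[OF w_less_1])

lemma hcoeff_bound: "\<bar>hcoeff n\<bar> \<le> \<bar>euler_coeff n\<bar> / qpoch_inf w p"
proof -
  have "w * p ^ n \<le> 1"
    using w_pos w_less_1 p_pos p_less_1 by (intro mult_le_one) (auto simp: power_le_one)
  hence "qpoch_inf (w * p ^ n) p \<in> {0..1}"
    using w_pos p_pos by (intro qpoch_inf_le_1) auto
  hence "qpoch_inf w p \<le> qpoch w p n"
    unfolding qpoch_inf_split[of w n] using qpoch_w_pos[of n] by (simp add: mult_left_le)
  thus ?thesis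
    using qpoch_w_pos[of n] w_inf_pos by (simp add: frac_le)
qed

lemma abs_summable_hcoeff: "summable (\<lambda>n. \<bar>hcoeff n * y ^ n\<bar>)"
proof (rule summable_comparison_test)
  show "\<exists>N. \<forall>n\<ge>N. norm \<bar>hcoeff n * y ^ n\<bar> \<le> \<bar>euler_coeff n\<bar> * \<bar>y\<bar> ^ n / qpoch_inf w p"
    using mult_right_mono[OF hcoeff_bound, of "\<bar>y\<bar> ^ _"]
    by (intro exI[of _ 0]) (auto simp: abs_mult power_abs)
  show "summable (\<lambda>n. \<bar>euler_coeff n\<bar> * \<bar>y\<bar> ^ n / qpoch_inf w p)"
    by (rule summable_divide[OF abs_summable_euler_coeff])
qed

lemma euler_coeff_summable_on: "(\<lambda>n. \<bar>euler_coeff n\<bar> * \<bar>x\<bar> ^ n) summable_on UNIV"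
  by (rule infsum_eq_suminf(1)) (use abs_summable_euler_coeff[of x] in simp)

lemma infsum_euler: "(\<Sum>\<^sub>\<infinity>n. euler_coeff n * x ^ n) = qpoch_inf x p"
  unfolding euler_sum
  by (rule infsum_eq_suminf(2)) (use abs_summable_euler_coeff[of x] in \<open>simp add: abs_mult power_abs\<close>)

text \<open>Expand \<open>(w p\<^sup>n; p)\<^sub>\<infinity> = (w; p)\<^sub>\<infinity> / (w; p)\<^sub>n\<close> by Euler and sum over \<open>n\<close> first.  This is the symmetry of
\<open>\<^sub>1\<phi>\<^sub>1\<close> in its lower parameter and its argument.  At \<open>y = p\<^sup>k\<close> with \<open>k\<close> very negative only the terms with
\<open>n > -k\<close> survive, so that the cancellation in the original alternating series becomes visible.\<close>

lemma hahn_exton_swap: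
  "qpoch_inf w p * hahn_exton w y = (\<Sum>\<^sub>\<infinity>n. euler_coeff n * w ^ n * qpoch_inf (y * p ^ n) p)"
proof -
  let ?e = euler_coeff
  have "qpoch_inf w p * hahn_exton w y = qpoch_inf w p * (\<Sum>\<^sub>\<infinity>n. hcoeff n * y ^ n)"
    unfolding hahn_exton_def using abs_summable_hcoeff[of y] by (subst infsum_eq_suminf(2)) auto
  also have "\<dots> = (\<Sum>\<^sub>\<infinity>n. qpoch_inf w p * (hcoeff n * y ^ n))"
    by (rule infsum_cmult_right'[symmetric])
  also have "\<dots> = (\<Sum>\<^sub>\<infinity>n. \<Sum>\<^sub>\<infinity>j. (?e n * y ^ n) * (?e j * (w * p ^ n) ^ j))"
  proof (rule infsum_cong)
    fix n
    have "qpoch_inf w p * (hcoeff n * y ^ n) = ?e n * y ^ n * qpoch_inf (w * p ^ n) p"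
      unfolding qpoch_inf_split[of w n] using qpoch_w_pos[of n] by simp
    also have "\<dots> = (\<Sum>\<^sub>\<infinity>j. (?e n * y ^ n) * (?e j * (w * p ^ n) ^ j))"
      by (simp only: infsum_cmult_right' infsum_euler)
    finally show "qpoch_inf w p * (hcoeff n * y ^ n) = \<dots>" .
  qed
  also have "\<dots> = (\<Sum>\<^sub>\<infinity>j. \<Sum>\<^sub>\<infinity>n. (?e n * y ^ n) * (?e j * (w * p ^ n) ^ j))"
  proof (rule infsum_swap_product_bound[OF euler_coeff_summable_on[of y] euler_coeff_summable_on[of w]])
    fix n j
    have "\<bar>w * p ^ n\<bar> ^ j \<le> \<bar>w\<bar> ^ j"
      using p_pos p_less_1 w_pos by (intro power_mono) (auto simp: abs_mult mult_left_le power_le_one)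
    thus "norm ((?e n * y ^ n) * (?e j * (w * p ^ n) ^ j)) \<le> (\<bar>?e n\<bar> * \<bar>y\<bar> ^ n) * (\<bar>?e j\<bar> * \<bar>w\<bar> ^ j)"
      unfolding real_norm_def abs_mult power_abs by (intro mult_left_mono) (auto simp: abs_mult power_abs)
  qed auto
  also have "\<dots> = (\<Sum>\<^sub>\<infinity>j. ?e j * w ^ j * qpoch_inf (y * p ^ j) p)"
  proof (rule infsum_cong)
    fix j
    have "(?e n * y ^ n) * (?e j * (w * p ^ n) ^ j) = ?e j * w ^ j * (?e n * (y * p ^ j) ^ n)" for n
      by (simp add: power_mult_distrib power_mult[symmetric] mult_ac)
    thus "(\<Sum>\<^sub>\<infinity>n. (?e n * y ^ n) * (?e j * (w * p ^ n) ^ j)) = ?e j * w ^ j * qpoch_inf (y * p ^ j) p"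
      by (simp only: infsum_cmult_right' infsum_euler)
  qed
  finally show ?thesis .
qed

lemma hahn_exton_grid:
  "qpoch_inf w p * \<phi> k = (\<Sum>\<^sub>\<infinity>n. euler_coeff n * w ^ n * qpoch_inf (p powi (k + int n)) p)"
  unfolding hahn_exton_swap using p_pos by (simp add: power_int_add)

lemma qpoch_inf_powi_bound: "\<bar>qpoch_inf (p powi i) p\<bar> \<le> p powi (- int M * i)"
proof (cases "i \<le> 0")
  case False
  have "\<bar>qpoch_inf (p powi i) p\<bar> \<le> 1" using qpoch_inf_powi_bounds[of i] by simp
  also have "1 \<le> p powi (- int M * i)"
    using False p_pos p_less_1 power_int_decreasing[of "- int M * i" 0 p] by (simp add: mult_nonneg_nonneg)
  finally show ?thesis .
qed (use p_pos in \<open>simp add: qpoch_inf_powi_nonpos\<close>)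

lemma powi_neg_mult_add: "p powi (- int M * (k + m)) = p powi (- int M * k) * (1 / p ^ M) powi m"
proof -
  have "p powi (- int M * (k + m)) = (p powi (- int M)) powi k * (p powi (- int M)) powi m"
    unfolding power_int_mult using p_pos by (simp add: power_int_add)
  also have "p powi (- int M) = 1 / p ^ M" by (simp add: power_int_minus field_simps)
  also have "(1 / p ^ M) powi k = p powi (- int M * k)"
    unfolding power_int_mult by (simp add: power_int_minus field_simps)
  finally show ?thesis .
qed

text \<open>On the grid \<open>\<phi>\<close> decays faster than any geometric sequence at \<open>-\<infinity>\<close>: in the rewritten series a
nonzero summand has \<open>k + n > 0\<close> and then \<open>1 \<le> p\<^bsup>-M(k+n)\<^esup>\<close>, where the powers \<open>p\<^bsup>-Mn\<^esup>\<close> are absorbed by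
the Euler coefficients.\<close>

lemma hahn_exton_decay: "\<exists>C\<ge>0. \<forall>k. \<bar>\<phi> k\<bar> \<le> C * p powi (- int M * k)"
proof -
  define S where "S = (\<Sum>\<^sub>\<infinity>n. \<bar>euler_coeff n\<bar> * \<bar>w / p ^ M\<bar> ^ n)"
  have S0: "S \<ge> 0" unfolding S_def by (intro infsum_nonneg) auto
  have "\<bar>\<phi> k\<bar> \<le> S / qpoch_inf w p * p powi (- int M * k)" for k
  proof -
    have le: "norm (euler_coeff n * w ^ n * qpoch_inf (p powi (k + int n)) p)
        \<le> p powi (- int M * k) * (\<bar>euler_coeff n\<bar> * \<bar>w / p ^ M\<bar> ^ n)" for n
    proof -
      have "p powi (- int M * (k + int n)) = p powi (- int M * k) * (1 / p ^ M) ^ n"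
        using powi_neg_mult_add[of M k "int n"] by simp
      hence "\<bar>qpoch_inf (p powi (k + int n)) p\<bar> \<le> p powi (- int M * k) * (1 / p ^ M) ^ n"
        using qpoch_inf_powi_bound[of "k + int n" M] by simp
      hence "\<bar>euler_coeff n\<bar> * w ^ n * \<bar>qpoch_inf (p powi (k + int n)) p\<bar>
        \<le> \<bar>euler_coeff n\<bar> * w ^ n * (p powi (- int M * k) * (1 / p ^ M) ^ n)"
        using w_pos by (intro mult_left_mono) auto
      thus ?thesis using w_pos p_pos
        by (simp add: abs_mult power_abs power_divide mult_ac)
    qed
    have "qpoch_inf w p * \<bar>\<phi> k\<bar> = norm (\<Sum>\<^sub>\<infinity>n. euler_coeff n * w ^ n * qpoch_inf (p powi (k + int n)) p)"
      unfolding hahn_exton_grid[symmetric] using w_inf_pos by (simp add: abs_mult)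
    also have "\<dots> \<le> (\<Sum>\<^sub>\<infinity>n. p powi (- int M * k) * (\<bar>euler_coeff n\<bar> * \<bar>w / p ^ M\<bar> ^ n))"
      by (rule dominated_infsum(2)[OF summable_on_cmult_right[OF euler_coeff_summable_on] le])
    also have "\<dots> = p powi (- int M * k) * S"
      unfolding S_def by (rule infsum_cmult_right')
    finally show ?thesis using w_inf_pos by (simp add: field_simps)
  qed
  thus ?thesis using S0 w_inf_pos by (intro exI[of _ "S / qpoch_inf w p"]) auto
qed

lemma hahn_exton_bounded: "\<exists>C\<ge>0. \<forall>k. \<bar>\<phi> k\<bar> \<le> C"
  using hahn_exton_decay[of 0] by simp

lemma summable_powi_hahn_exton:
  assumes z: "0 < z" "z < 1"
  shows "(\<lambda>k. \<bar>z powi k * \<phi> (k + m)\<bar>) summable_on UNIV"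
proof -
  obtain M where M: "p ^ M < z" using real_arch_pow_inv[OF z(1) p_less_1] by blast
  obtain C where C: "\<And>k. \<bar>\<phi> k\<bar> \<le> C" using hahn_exton_bounded by blast
  obtain D where D: "\<And>k. \<bar>\<phi> k\<bar> \<le> D * p powi (- int M * k)" using hahn_exton_decay by blast
  have "(\<lambda>k. norm (z powi k * \<phi> (k + m))) summable_on UNIV"
  proof (rule summable_on_int_geometric[OF z, where t = "z / p ^ M"])
    show "1 < z / p ^ M" using M p_pos by simp
    fix k
    show "norm (z powi k * \<phi> (k + m)) \<le> C * z powi k"
      using C[of "k + m"] z by (simp add: abs_mult mult.commute mult_right_mono)
    have "\<bar>\<phi> (k + m)\<bar> * z powi k \<le> D * p powi (- int M * (k + m)) * z powi k"
      using D[of "k + m"] z by (intro mult_right_mono) auto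
    also have "p powi (- int M * (k + m)) = p powi (- int M * m) * (1 / p ^ M) powi k"
      using powi_neg_mult_add[of M m k] by (simp add: add.commute)
    finally show "norm (z powi k * \<phi> (k + m)) \<le> (D * p powi (- int M * m)) * (z / p ^ M) powi k"
      using z by (simp add: abs_mult power_int_divide_distrib mult_ac)
  qed
  thus ?thesis by simp
qed

text \<open>With \<open>z = w p\<^sup>n\<close> the rewritten series gives a multiple of \<open>(w / z; p)\<^sub>\<infinity>\<close>, and \<open>w / z = p\<^bsup>-n\<^esup>\<close> is a
zero of this product.  Consequently monomials have transform zero, which yields the decay of
transforms of smooth functions.\<close>

lemma hahn_exton_moment: "(\<Sum>\<^sub>\<infinity>k. (w * p ^ n) powi k * \<phi> k) = 0"
proof -
  define z where "z = w * p ^ n"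
  have z: "0 < z" "z < 1"
    using w_pos w_less_1 p_pos p_less_1 unfolding z_def
    by (auto intro: le_less_trans[OF mult_left_le[of "p ^ n" w]] simp: power_le_one)
  \<comment> \<open>No single geometric sequence dominates: \<open>z\<^sup>k\<close> serves for \<open>k \<ge> 0\<close>, \<open>(z / p\<^sup>M)\<^sup>k\<close> for \<open>k < 0\<close>.\<close>
  obtain M where M: "p ^ M < z" using real_arch_pow_inv[OF z(1) p_less_1] by blast
  define g where "g = (\<lambda>k. min (z powi k) ((z / p ^ M) powi k))"
  have g0: "g k \<ge> 0" for k using z p_pos by (simp add: g_def)
  have "(\<lambda>k. norm (g k)) summable_on UNIV"
    by (rule summable_on_int_geometric[OF z, where t = "z / p ^ M" and C = 1 and D = 1])
      (use M p_pos g0 in \<open>auto simp: g_def\<close>)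
  hence g: "g summable_on UNIV" using g0 by simp
  have "qpoch_inf w p * (\<Sum>\<^sub>\<infinity>k. z powi k * \<phi> k) = (\<Sum>\<^sub>\<infinity>k. z powi k * (qpoch_inf w p * \<phi> k))"
    unfolding infsum_cmult_right'[symmetric] by (simp only: mult_ac)
  also have "\<dots> = (\<Sum>\<^sub>\<infinity>k. \<Sum>\<^sub>\<infinity>j. z powi k * (euler_coeff j * w ^ j * qpoch_inf (p powi (k + int j)) p))"
    unfolding hahn_exton_grid infsum_cmult_right' by (rule refl)
  also have "\<dots> = (\<Sum>\<^sub>\<infinity>j. \<Sum>\<^sub>\<infinity>k. z powi k * (euler_coeff j * w ^ j * qpoch_inf (p powi (k + int j)) p))"
  proof (rule infsum_swap_product_bound[OF g euler_coeff_summable_on[of "w / p ^ M"]])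
    fix k :: int and j :: nat
    let ?Q = "\<bar>qpoch_inf (p powi (k + int j)) p\<bar>"
    have pj: "1 \<le> (1 / p ^ M) ^ j"
      using p_pos p_less_1 by (intro one_le_power) (simp add: power_le_one)
    have Q1: "?Q \<le> 1 * (1 / p ^ M) ^ j"
      using qpoch_inf_powi_bounds[of "k + int j"] pj by auto
    have "p powi (- int M * (k + int j)) = (1 / p ^ M) powi k * (1 / p ^ M) ^ j"
      using powi_neg_mult_add[of M k "int j"] powi_neg_mult_add[of M 0 k] by simp
    hence Q2: "?Q \<le> (1 / p ^ M) powi k * (1 / p ^ M) ^ j"
      using qpoch_inf_powi_bound[of "k + int j" M] by simp
    have "z powi k * ?Q \<le> g k * (1 / p ^ M) ^ j"
    proof -
      have "z powi k * ?Q \<le> z powi k * (1 / p ^ M) ^ j"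
        using mult_left_mono[OF Q1, of "z powi k"] z by simp
      moreover have "z powi k * ?Q \<le> (z / p ^ M) powi k * (1 / p ^ M) ^ j"
        using mult_left_mono[OF Q2, of "z powi k"] z by (simp add: power_int_divide_distrib)
      ultimately show ?thesis unfolding g_def by (auto simp: min_def)
    qed
    hence "(\<bar>euler_coeff j\<bar> * w ^ j) * (z powi k * ?Q) \<le> (\<bar>euler_coeff j\<bar> * w ^ j) * (g k * (1 / p ^ M) ^ j)"
      using w_pos by (intro mult_left_mono) auto
    thus "norm (z powi k * (euler_coeff j * w ^ j * qpoch_inf (p powi (k + int j)) p))
        \<le> g k * (\<bar>euler_coeff j\<bar> * \<bar>w / p ^ M\<bar> ^ j)"
      using z w_pos p_pos by (simp add: abs_mult power_divide power_abs mult_ac)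
  qed (use g0 in auto)
  also have "\<dots> = (\<Sum>\<^sub>\<infinity>j. (z * qpoch_inf p p / qpoch_inf z p) * (euler_coeff j * (w / z) ^ j))"
  proof (rule infsum_cong)
    fix j :: nat
    have "(\<Sum>\<^sub>\<infinity>k. z powi k * (euler_coeff j * w ^ j * qpoch_inf (p powi (k + int j)) p))
      = (\<Sum>\<^sub>\<infinity>k. euler_coeff j * w ^ j * (z powi k * qpoch_inf (p powi (k + int j)) p))"
      by (simp only: mult_ac)
    also have "\<dots> = euler_coeff j * w ^ j * (z powi (1 - int j) * qpoch_inf p p / qpoch_inf z p)"
      by (simp only: infsum_cmult_right' infsumI[OF has_sum_powi_qpoch_inf[OF z]])
    also have "z powi (1 - int j) = z * (1 / z) ^ j"
      using z by (simp add: power_int_diff power_divide)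
    finally show "(\<Sum>\<^sub>\<infinity>k. z powi k * (euler_coeff j * w ^ j * qpoch_inf (p powi (k + int j)) p))
      = (z * qpoch_inf p p / qpoch_inf z p) * (euler_coeff j * (w / z) ^ j)"
      by (simp add: power_divide mult_ac)
  qed
  also have "\<dots> = (z * qpoch_inf p p / qpoch_inf z p) * qpoch_inf (w / z) p"
    by (simp only: infsum_cmult_right' infsum_euler)
  also have "w / z = p powi (- int n)"
    using w_pos p_pos by (simp add: z_def power_int_minus field_simps)
  also have "qpoch_inf (p powi (- int n)) p = 0" by (rule qpoch_inf_powi_nonpos) simp
  finally show ?thesis using w_inf_pos by (simp add: z_def)
qed

text \<open>The transform with kernel \<open>\<phi>\<close> maps the sequence \<open>(p\<^bsup>k+i\<^esup>; p)\<^sub>\<infinity>\<close> to a multiple of one of the same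
kind: the product supplies a lower bound on \<open>k\<close>, so the series for \<open>\<phi>\<close> may be summed termwise, and
Euler's expansion reappears.\<close>

lemma hahn_exton_transform_qpoch:
  "(\<Sum>\<^sub>\<infinity>k. w powi k * \<phi> (k + m) * qpoch_inf (p powi (k + i)) p)
     = qpoch_inf p p / qpoch_inf w p * w powi (1 - i) * qpoch_inf (p powi (m + 1 - i)) p"
proof -
  define g where "g = (\<lambda>k. if k < 1 - i then 0 else w powi k)"
  define y where "y = p powi (m + 1 - i)"
  have y: "y > 0" using p_pos by (simp add: y_def)
  have g: "g summable_on UNIV"
  proof -
    have "((\<lambda>n. w powi (1 - i) * w ^ n) has_sum w powi (1 - i) * infsum ((^) w) UNIV) UNIV"
      by (intro has_sum_cmult_right has_sum_infsum infsum_eq_suminf(1)) (use w_pos w_less_1 in \<open>simp add: summable_geometric\<close>)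
    hence "((\<lambda>n. g (1 - i + int n)) has_sum w powi (1 - i) * infsum ((^) w) UNIV) UNIV"
      using w_pos by (simp add: g_def power_int_add)
    from has_sum_int_from[OF _ this] show ?thesis by (auto simp: g_def summable_on_def)
  qed
  have h: "(\<lambda>n. \<bar>hcoeff n * y ^ n\<bar>) summable_on UNIV"
    by (rule infsum_eq_suminf(1)) (use abs_summable_hcoeff[of y] in simp)
  have expand: "\<phi> k = (\<Sum>\<^sub>\<infinity>n. hcoeff n * (p powi k) ^ n)" for k
    unfolding hahn_exton_def using abs_summable_hcoeff[of "p powi k"] by (subst infsum_eq_suminf(2)) auto
  have "(\<Sum>\<^sub>\<infinity>k. w powi k * \<phi> (k + m) * qpoch_inf (p powi (k + i)) p)
    = (\<Sum>\<^sub>\<infinity>k. \<Sum>\<^sub>\<infinity>n. w powi k * (hcoeff n * (p powi (k + m)) ^ n) * qpoch_inf (p powi (k + i)) p)"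
    unfolding infsum_cmult_left' infsum_cmult_right' expand by (rule refl)
  also have "\<dots> = (\<Sum>\<^sub>\<infinity>n. \<Sum>\<^sub>\<infinity>k. w powi k * (hcoeff n * (p powi (k + m)) ^ n) * qpoch_inf (p powi (k + i)) p)"
  proof (rule infsum_swap_product_bound[OF g h])
    fix k :: int and n :: nat
    show "norm (w powi k * (hcoeff n * (p powi (k + m)) ^ n) * qpoch_inf (p powi (k + i)) p) \<le> g k * \<bar>hcoeff n * y ^ n\<bar>"
    proof (cases "k < 1 - i")
      case False
      have "(p powi (k + m)) ^ n \<le> y ^ n"
        unfolding y_def using p_pos p_less_1 False by (intro power_mono power_int_decreasing) auto
      hence "\<bar>hcoeff n\<bar> * (p powi (k + m)) ^ n \<le> \<bar>hcoeff n\<bar> * y ^ n" by (intro mult_left_mono) auto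
      hence "w powi k * (\<bar>hcoeff n\<bar> * (p powi (k + m)) ^ n) * \<bar>qpoch_inf (p powi (k + i)) p\<bar> \<le> w powi k * (\<bar>hcoeff n\<bar> * y ^ n) * 1"
        using w_pos p_pos y qpoch_inf_powi_bounds[of "k + i"]
        by (intro mult_mono[OF mult_left_mono]) (auto intro!: mult_nonneg_nonneg simp del: abs_divide)
      thus ?thesis using False w_pos p_pos y by (simp add: g_def abs_mult power_abs)
    qed (simp add: g_def qpoch_inf_powi_nonpos)
  qed (use w_pos in \<open>auto simp: g_def\<close>)
  also have "\<dots> = (\<Sum>\<^sub>\<infinity>n. (qpoch_inf p p / qpoch_inf w p * w powi (1 - i)) * (euler_coeff n * y ^ n))"
  proof (rule infsum_cong)
    fix n :: nat
    have wp: "0 < w * p ^ n" "w * p ^ n < 1"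
      using w_pos w_less_1 p_pos p_less_1
      by (auto intro: le_less_trans[OF mult_left_le[of "p ^ n" w]] simp: power_le_one)
    have "(\<Sum>\<^sub>\<infinity>k. w powi k * (hcoeff n * (p powi (k + m)) ^ n) * qpoch_inf (p powi (k + i)) p)
      = (\<Sum>\<^sub>\<infinity>k. (hcoeff n * (p powi m) ^ n) * ((w * p ^ n) powi k * qpoch_inf (p powi (k + i)) p))"
    proof (rule infsum_cong)
      fix k
      have "(p ^ n) powi k = (p powi k) ^ n"
        by (metis mult.commute power_int_mult power_int_of_nat)
      thus "w powi k * (hcoeff n * (p powi (k + m)) ^ n) * qpoch_inf (p powi (k + i)) p =
         (hcoeff n * (p powi m) ^ n) * ((w * p ^ n) powi k * qpoch_inf (p powi (k + i)) p)"
        using p_pos by (simp add: power_int_add power_int_mult_distrib power_mult_distrib mult_ac)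
    qed
    also have "\<dots> = (hcoeff n * (p powi m) ^ n) * ((w * p ^ n) powi (1 - i) * qpoch_inf p p / qpoch_inf (w * p ^ n) p)"
      by (simp only: infsum_cmult_right' infsumI[OF has_sum_powi_qpoch_inf[OF wp]])
    also have "(w * p ^ n) powi (1 - i) = w powi (1 - i) * (p powi (1 - i)) ^ n"
      unfolding power_int_mult_distrib by (metis mult.commute power_int_mult power_int_of_nat)
    also have "(hcoeff n * (p powi m) ^ n) * (w powi (1 - i) * (p powi (1 - i)) ^ n * qpoch_inf p p / qpoch_inf (w * p ^ n) p)
       = (qpoch_inf p p / (qpoch w p n * qpoch_inf (w * p ^ n) p) * w powi (1 - i)) * (euler_coeff n * ((p powi m) ^ n * (p powi (1 - i)) ^ n))"
      by simp
    also have "(p powi m) ^ n * (p powi (1 - i)) ^ n = y ^ n"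
      unfolding y_def power_mult_distrib[symmetric] using p_pos by (simp add: power_int_add[symmetric] algebra_simps)
    finally show "(\<Sum>\<^sub>\<infinity>k. w powi k * (hcoeff n * (p powi (k + m)) ^ n) * qpoch_inf (p powi (k + i)) p)
       = (qpoch_inf p p / qpoch_inf w p * w powi (1 - i)) * (euler_coeff n * y ^ n)"
      unfolding qpoch_inf_split[of w n, symmetric] .
  qed
  also have "\<dots> = qpoch_inf p p / qpoch_inf w p * w powi (1 - i) * qpoch_inf (p powi (m + 1 - i)) p"
    unfolding infsum_cmult_right' infsum_euler y_def by (rule refl)
  finally show ?thesis .
qed

text \<open>The delta sequence is a superposition of the sequences \<open>(p\<^bsup>k+i\<^esup>; p)\<^sub>\<infinity>\<close>.\<close>

lemma infsum_euler_qpoch_inf: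
  "(\<Sum>\<^sub>\<infinity>j. euler_coeff j * qpoch_inf (p powi (d + 1 - int j)) p) = (if d = 0 then qpoch_inf p p else 0)"
proof (cases "d < 0")
  case True
  hence "qpoch_inf (p powi (d + 1 - int j)) p = 0" for j by (intro qpoch_inf_powi_nonpos) auto
  thus ?thesis using True by simp
next
  case False
  then obtain n where n: "d = int n" by (metis nonneg_int_cases not_less)
  have "(\<Sum>\<^sub>\<infinity>j. euler_coeff j * qpoch_inf (p powi (d + 1 - int j)) p)
      = (\<Sum>\<^sub>\<infinity>j\<in>{..n}. euler_coeff j * qpoch_inf (p powi (d + 1 - int j)) p)"
    by (rule infsum_cong_neutral) (auto simp: n qpoch_inf_powi_nonpos)
  also have "\<dots> = (\<Sum>j\<le>n. qpoch_inf p p * (euler_coeff j / qpoch p p (n - j)))"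
    unfolding infsum_finite[OF finite_atMost]
  proof (rule sum.cong[OF refl])
    fix j assume "j \<in> {..n}"
    hence "d + 1 - int j = int (n - j) + 1" by (auto simp: n of_nat_diff)
    thus "euler_coeff j * qpoch_inf (p powi (d + 1 - int j)) p = qpoch_inf p p * (euler_coeff j / qpoch p p (n - j))"
      by (simp only: qpoch_inf_p_powi) simp
  qed
  also have "\<dots> = qpoch_inf p p * (\<Sum>j\<le>n. euler_coeff j / qpoch p p (n - j))"
    by (rule sum_distrib_left[symmetric])
  also have "(\<Sum>j\<le>n. euler_coeff j / qpoch p p (n - j)) = (if n = 0 then 1 else 0)"
    using euler_coeff_convolution[of n] by simp
  finally show ?thesis by (simp add: n)
qed

text \<open>Insert the rewritten series for one factor: the sequences \<open>(p\<^bsup>k+i\<^esup>; p)\<^sub>\<infinity>\<close> are transformed explicitly,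
and the resulting superposition is a delta sequence.\<close>

theorem hahn_exton_orthogonality:
  "(\<Sum>\<^sub>\<infinity>k. w powi k * \<phi> (k + m) * \<phi> (k + n))
     = (if m = n then (qpoch_inf p p / qpoch_inf w p)\<^sup>2 * w powi (1 - n) else 0)"
proof -
  let ?W = "qpoch_inf w p" and ?P = "qpoch_inf p p"
  have s: "(\<lambda>k. \<bar>w powi k * \<phi> (k + m)\<bar>) summable_on UNIV"
    by (rule summable_powi_hahn_exton[OF w_pos w_less_1])
  have "?W * (\<Sum>\<^sub>\<infinity>k. w powi k * \<phi> (k + m) * \<phi> (k + n)) = (\<Sum>\<^sub>\<infinity>k. w powi k * \<phi> (k + m) * (?W * \<phi> (k + n)))"
    unfolding infsum_cmult_right'[symmetric] by (simp only: mult_ac)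
  also have "\<dots> = (\<Sum>\<^sub>\<infinity>k. \<Sum>\<^sub>\<infinity>j. w powi k * \<phi> (k + m) * (euler_coeff j * w ^ j * qpoch_inf (p powi (k + n + int j)) p))"
    unfolding hahn_exton_grid infsum_cmult_right' by (rule refl)
  also have "\<dots> = (\<Sum>\<^sub>\<infinity>j. \<Sum>\<^sub>\<infinity>k. w powi k * \<phi> (k + m) * (euler_coeff j * w ^ j * qpoch_inf (p powi (k + n + int j)) p))"
  proof (rule infsum_swap_product_bound[OF s euler_coeff_summable_on[of w]])
    fix k :: int and j :: nat
    have "\<bar>w powi k * \<phi> (k + m)\<bar> * (\<bar>euler_coeff j\<bar> * \<bar>w\<bar> ^ j) * \<bar>qpoch_inf (p powi (k + n + int j)) p\<bar>
      \<le> \<bar>w powi k * \<phi> (k + m)\<bar> * (\<bar>euler_coeff j\<bar> * \<bar>w\<bar> ^ j) * 1"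
      using qpoch_inf_powi_bounds[of "k + n + int j"] by (intro mult_left_mono) auto
    thus "norm (w powi k * \<phi> (k + m) * (euler_coeff j * w ^ j * qpoch_inf (p powi (k + n + int j)) p))
        \<le> \<bar>w powi k * \<phi> (k + m)\<bar> * (\<bar>euler_coeff j\<bar> * \<bar>w\<bar> ^ j)"
      by (simp add: abs_mult power_abs mult_ac)
  qed auto
  also have "\<dots> = (\<Sum>\<^sub>\<infinity>j. (?P / ?W * w powi (1 - n)) * (euler_coeff j * qpoch_inf (p powi ((m - n) + 1 - int j)) p))"
  proof (rule infsum_cong)
    fix j :: nat
    have "(\<Sum>\<^sub>\<infinity>k. w powi k * \<phi> (k + m) * (euler_coeff j * w ^ j * qpoch_inf (p powi (k + n + int j)) p))
       = (\<Sum>\<^sub>\<infinity>k. (euler_coeff j * w ^ j) * (w powi k * \<phi> (k + m) * qpoch_inf (p powi (k + (n + int j))) p))"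
      by (simp only: mult_ac add.assoc)
    also have "\<dots> = (euler_coeff j * w ^ j) * (?P / ?W * w powi (1 - (n + int j)) * qpoch_inf (p powi (m + 1 - (n + int j))) p)"
      by (simp only: infsum_cmult_right' hahn_exton_transform_qpoch)
    also have "w powi (1 - (n + int j)) = w powi (1 - n) * (1 / w ^ j)"
      using w_pos by (simp add: diff_diff_add[symmetric] power_int_diff[of _ "1 - n" "int j"])
    also have "m + 1 - (n + int j) = (m - n) + 1 - int j" by simp
    finally show "(\<Sum>\<^sub>\<infinity>k. w powi k * \<phi> (k + m) * (euler_coeff j * w ^ j * qpoch_inf (p powi (k + n + int j)) p))
       = (?P / ?W * w powi (1 - n)) * (euler_coeff j * qpoch_inf (p powi ((m - n) + 1 - int j)) p)"
      using w_pos by simp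
  qed
  also have "\<dots> = ?P / ?W * w powi (1 - n) * (if m = n then ?P else 0)"
    unfolding infsum_cmult_right' infsum_euler_qpoch_inf by simp
  finally show ?thesis using w_inf_pos by (simp add: field_simps power2_eq_square split: if_splits)
qed

end

section \<open>The q-Bessel transform of functions on the grid\<close>

text \<open>The arithmetic condition on \<open>q\<close> enters only as \<open>1 - q = q\<^sup>N\<close>: it makes \<open>(1 - q) q\<^sup>k\<close> a grid point.\<close>

locale q_grid =
  fixes q :: real and N :: int
  assumes q_pos: "0 < q" and q_less_1: "q < 1" and one_minus_q: "1 - q = q powi N"
begin

sublocale base: q_base "q\<^sup>2"
  using q_pos q_less_1 by unfold_locales (auto simp: power_less_one_iff)

abbreviation qpow :: "real \<Rightarrow> int \<Rightarrow> real" where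
  "qpow e k \<equiv> q powr (e * real_of_int k)"

abbreviation on_grid :: "(real \<Rightarrow> complex) \<Rightarrow> int \<Rightarrow> complex" where
  "on_grid f \<equiv> (\<lambda>k. f (q powi k))"

text \<open>Growth along the whole grid.  Estimates for different exponents \<open>e\<close> are combined: a large \<open>e\<close> is
information near 0 (\<open>k \<rightarrow> \<infinity>\<close>), a negative \<open>e\<close> is information near infinity (\<open>k \<rightarrow> -\<infinity>\<close>).\<close>

definition of_order :: "real \<Rightarrow> (int \<Rightarrow> 'a::real_normed_vector) \<Rightarrow> bool" where
  "of_order e f \<longleftrightarrow> (\<exists>C. \<forall>k. norm (f k) \<le> C * qpow e k)"

lemma q_powr_less_1: "0 < a \<Longrightarrow> q powr a < 1"
  using powr_less_mono'[of q 0 a] q_pos q_less_1 by simp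

lemma of_orderI: "(\<And>k. norm (f k) \<le> C * qpow e k) \<Longrightarrow> of_order e f"
  unfolding of_order_def by blast

lemma of_orderE:
  assumes "of_order e f"
  obtains C where "0 \<le> C" "\<And>k. norm (f k) \<le> C * qpow e k"
proof -
  obtain C where C: "\<And>k. norm (f k) \<le> C * qpow e k"
    using assms unfolding of_order_def by blast
  moreover have "0 \<le> C"
    using C[of 0] order_trans[OF norm_ge_zero] q_pos by fastforce
  ultimately show ?thesis using that by blast
qed

lemma of_order_powr: "of_order e (\<lambda>k. qpow e k)"
  by (rule of_orderI[of _ 1]) simp

lemma of_order_mult:
  fixes f g :: "int \<Rightarrow> 'a::real_normed_algebra"
  assumes "of_order a f" "of_order b g"
  shows "of_order (a + b) (\<lambda>k. f k * g k)"
proof -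
  obtain C where C: "0 \<le> C" "\<And>k. norm (f k) \<le> C * qpow a k"
    using assms(1) by (rule of_orderE) blast
  obtain D where D: "0 \<le> D" "\<And>k. norm (g k) \<le> D * qpow b k"
    using assms(2) by (rule of_orderE) blast
  have "norm (f k * g k) \<le> C * D * qpow (a + b) k" for k
  proof -
    have "norm (f k * g k) \<le> norm (f k) * norm (g k)" by (rule norm_mult_ineq)
    also have "\<dots> \<le> (C * qpow a k) * (D * qpow b k)"
      using C D by (intro mult_mono) auto
    also have "\<dots> = C * D * qpow (a + b) k"
      by (simp add: algebra_simps powr_add)
    finally show ?thesis .
  qed
  thus ?thesis by (rule of_orderI)
qed

lemma of_order_norm_iff: "of_order e (\<lambda>k. norm (f k)) \<longleftrightarrow> of_order e f"
  by (simp add: of_order_def)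

lemma of_order_of_real: "of_order e (\<lambda>k. of_real (f k) :: 'a::real_normed_div_algebra) \<longleftrightarrow> of_order e f"
  by (simp add: of_order_def)

lemma of_order_cnj: "of_order e (\<lambda>k. cnj (f k)) \<longleftrightarrow> of_order e f"
  by (simp add: of_order_def)

lemma of_order_shift:
  assumes "of_order e f"
  shows "of_order e (\<lambda>k. f (k + m))"
proof -
  obtain C where C: "0 \<le> C" "\<And>k. norm (f k) \<le> C * qpow e k"
    using assms by (rule of_orderE) blast
  show ?thesis
    by (rule of_orderI[of _ "C * q powr (e * m)"]) (use C(2)[of "_ + m"] in \<open>simp add: powr_add distrib_left mult_ac\<close>)
qed

lemma of_order_between:
  assumes "of_order a f" "of_order b f" "a \<le> c" "c \<le> b"
  shows "of_order c f"
proof -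
  obtain C where C: "0 \<le> C" "\<And>k. norm (f k) \<le> C * qpow a k"
    using assms(1) by (rule of_orderE) blast
  obtain D where D: "0 \<le> D" "\<And>k. norm (f k) \<le> D * qpow b k"
    using assms(2) by (rule of_orderE) blast
  have "norm (f k) \<le> (C + D) * qpow c k" for k
  proof (cases "k \<ge> 0")
    case True
    have "qpow b k \<le> qpow c k"
      using True assms q_pos q_less_1 by (intro powr_mono') (auto intro: mult_right_mono)
    hence "D * qpow b k \<le> (C + D) * qpow c k"
      using C D by (intro mult_mono) auto
    thus ?thesis using D(2)[of k] by linarith
  next
    case False
    have "qpow a k \<le> qpow c k"
      using False assms q_pos q_less_1 by (intro powr_mono') (auto intro: mult_right_mono_neg)
    hence "C * qpow a k \<le> (C + D) * qpow c k"
      using C D by (intro mult_mono) auto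
    thus ?thesis using C(2)[of k] by linarith
  qed
  thus ?thesis by (rule of_orderI)
qed

lemma of_order_summable:
  fixes f :: "int \<Rightarrow> 'a::banach"
  assumes "of_order a f" "of_order b f" "a < 0" "0 < b"
  shows "(\<lambda>k. norm (f k)) summable_on UNIV"
proof -
  obtain C where C: "\<And>k. norm (f k) \<le> C * qpow a k"
    using assms(1) by (rule of_orderE) blast
  obtain D where D: "\<And>k. norm (f k) \<le> D * qpow b k"
    using assms(2) by (rule of_orderE) blast
  show ?thesis
  proof (rule summable_on_int_geometric[of "q powr b" "q powr a"])
    show "q powr b < 1" using assms by (intro q_powr_less_1)
    show "1 < q powr a" using assms q_pos q_less_1 powr_less_mono'[of q a 0] by simp
    show "0 < q powr b" using q_pos by simp
  qed (use C D q_pos in \<open>auto simp: powr_powi\<close>)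
qed

abbreviation weight :: "real \<Rightarrow> int \<Rightarrow> real" where
  "weight \<beta> k \<equiv> qpow (2 * \<beta> + 2) k"

abbreviation J :: "real \<Rightarrow> int \<Rightarrow> real" where
  "J \<beta> k \<equiv> q_bessel_j q \<beta> (q powi k)"

lemma euler_coeff_q2: "base.euler_coeff n = (- 1) ^ n * q ^ (n * (n - 1)) / qpoch (q\<^sup>2) (q\<^sup>2) n"
proof (induction n)
  case (Suc n)
  have e: "q ^ (Suc n * (Suc n - 1)) = q ^ (n * (n - 1)) * (q\<^sup>2) ^ n"
  proof -
    have "Suc n * (Suc n - 1) = n * (n - 1) + 2 * n" by (cases n) (auto simp: algebra_simps)
    thus ?thesis by (simp only: power_add power_mult)
  qed
  have "1 - (q\<^sup>2) ^ Suc n > 0" by (rule base.one_minus_p_power_pos)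
  hence "base.euler_coeff (Suc n) = base.euler_coeff n * (- ((q\<^sup>2) ^ n) / (1 - q\<^sup>2 * (q\<^sup>2) ^ n))"
    by (simp add: base.euler_coeff_def)
  thus ?case unfolding Suc.IH e by (simp add: base.qpoch_Suc)
qed simp

text \<open>In base \<open>p = q\<^sup>2\<close> the parameter of the Hahn-Exton function is \<open>w = p\<^bsup>\<beta>+1\<^esup>\<close>, and \<open>w\<^sup>k\<close> is the weight
of \<open>x\<^bsup>2\<beta>+1\<^esup> d\<^sub>q x\<close> at \<open>x = q\<^sup>k\<close>, up to the factor \<open>1 - q\<close>.\<close>

lemma weight_base:
  assumes "\<beta> > -1"
  shows "hahn_exton_base (q\<^sup>2) (q powr (2 * \<beta> + 2))"
  using assms q_pos by unfold_locales (auto intro: q_powr_less_1)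

lemma q_bessel_j_eq:
  "q_bessel_j q \<beta> y = base.hahn_exton (q powr (2 * \<beta> + 2)) ((1 - q)\<^sup>2 * y\<^sup>2)"
  unfolding q_bessel_j_def base.hahn_exton_def euler_coeff_q2 power_mult_distrib power_mult[symmetric]
  by (simp add: mult_ac)

lemma J_eq: "J \<beta> k = base.hahn_exton (q powr (2 * \<beta> + 2)) ((q\<^sup>2) powi (k + N))"
proof -
  have "(1 - q)\<^sup>2 * (q powi k)\<^sup>2 = (q\<^sup>2) powi (k + N)"
    unfolding one_minus_q using q_pos
    by (simp add: power_mult_distrib[symmetric] power_int_add power2_eq_square power_int_mult_distrib mult_ac)
  thus ?thesis by (simp add: q_bessel_j_eq)
qed

lemma powi_q2: "(q\<^sup>2) powi k = qpow 2 k"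
  using q_pos unfolding power_int_power by (simp add: powi_eq_powr)

lemma of_order_J:
  assumes "\<beta> > -1" "e \<le> 0"
  shows "of_order e (J \<beta>)"
proof -
  interpret h: hahn_exton_base "q\<^sup>2" "q powr (2 * \<beta> + 2)" by (rule weight_base[OF assms(1)])
  have *: "of_order (- (2 * real M)) (J \<beta>)" for M
  proof -
    obtain C where C: "\<And>k. \<bar>h.\<phi> k\<bar> \<le> C * (q\<^sup>2) powi (- int M * k)" using h.hahn_exton_decay[of M] by blast
    have "of_order (- (2 * real M)) h.\<phi>"
      by (rule of_orderI[of _ C]) (use C in \<open>simp add: powi_q2 mult_ac\<close>)
    from of_order_shift[OF this, of N] show ?thesis by (simp add: J_eq)
  qed
  show ?thesis
    by (rule of_order_between[OF *[of "nat \<lceil>- e\<rceil>"] *[of 0]]) (use assms in auto, linarith)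
qed

lemma J_bounded:
  assumes "\<beta> > -1"
  obtains C where "0 \<le> C" "\<And>k. \<bar>J \<beta> k\<bar> \<le> C"
proof -
  obtain C where "0 \<le> C" "\<And>k. norm (J \<beta> k) \<le> C * qpow 0 k"
    using of_order_J[OF assms order_refl] by (rule of_orderE) blast
  thus ?thesis using q_pos by (intro that[of C]) auto
qed

lemma J_moment:
  assumes "\<beta> > -1"
  shows "(\<Sum>\<^sub>\<infinity>k. weight \<beta> k * qpow (2 * real n) k * J \<beta> (k + m)) = 0"
proof -
  interpret h: hahn_exton_base "q\<^sup>2" "q powr (2 * \<beta> + 2)" by (rule weight_base[OF assms])
  define r where "r = 2 * \<beta> + 2 + 2 * real n"
  have base: "q powr (2 * \<beta> + 2) * (q\<^sup>2) ^ n = q powr r"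
  proof -
    have "(q\<^sup>2) ^ n = q powr (2 * real n)" using powi_q2[of "int n"] by (simp only: power_int_of_nat of_int_of_nat_eq)
    thus ?thesis unfolding r_def by (simp only: powr_add)
  qed
  have "(\<Sum>\<^sub>\<infinity>k. weight \<beta> k * qpow (2 * real n) k * J \<beta> (k + m))
    = (\<Sum>\<^sub>\<infinity>k. q powr (- r * (m + N)) * (q powr (r * (k + (m + N))) * h.\<phi> (k + (m + N))))"
  proof (rule infsum_cong)
    fix k :: int
    have "weight \<beta> k * qpow (2 * real n) k = q powr (- r * (m + N)) * q powr (r * (k + (m + N)))"
      unfolding powr_add[symmetric] by (simp add: r_def algebra_simps)
    thus "weight \<beta> k * qpow (2 * real n) k * J \<beta> (k + m)
        = q powr (- r * (m + N)) * (q powr (r * (k + (m + N))) * h.\<phi> (k + (m + N)))"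
      by (simp add: J_eq add.assoc)
  qed
  also have "\<dots> = q powr (- r * (m + N)) * (\<Sum>\<^sub>\<infinity>k. q powr (r * k) * h.\<phi> k)"
    unfolding infsum_cmult_right' using infsum_shift[of "\<lambda>k. q powr (r * k) * h.\<phi> k" "m + N"] by simp
  also have "(\<Sum>\<^sub>\<infinity>k. q powr (r * k) * h.\<phi> k) = 0"
    using h.hahn_exton_moment[of n] unfolding base using q_pos by (simp add: powr_powi)
  finally show ?thesis by simp
qed

text \<open>The constant of \<open>q_fourier\<close> together with the \<open>1 - q\<close> of the Jackson integral.\<close>

definition amp :: "real \<Rightarrow> real" where
  "amp \<beta> = q_const q \<beta> * (1 - q)"

lemma qpoch_inf_q2_pos: "a > 0 \<Longrightarrow> 0 < qpoch_inf (q powr a) (q\<^sup>2)"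
  by (intro base.qpoch_inf_pos q_powr_less_1)

lemma qpoch_inf_q2_q2_pos: "0 < qpoch_inf (q\<^sup>2) (q\<^sup>2)"
  using base.p_less_1 by (intro base.qpoch_inf_pos)

lemma q2_powr: "(q\<^sup>2) powr a = q powr (2 * a)"
  using powr_powr[of q 2 a] q_pos by simp

lemma q_Gamma_q2: "q_Gamma (q\<^sup>2) a = qpoch_inf (q\<^sup>2) (q\<^sup>2) / qpoch_inf (q powr (2 * a)) (q\<^sup>2) * (1 - q\<^sup>2) powr (1 - a)"
  unfolding q_Gamma_def q2_powr by (rule refl)

lemma one_minus_q2_pos: "0 < 1 - q\<^sup>2" using base.p_less_1 by simp

lemma q_Gamma_q2_pos: "a > 0 \<Longrightarrow> 0 < q_Gamma (q\<^sup>2) a"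
  unfolding q_Gamma_q2 using qpoch_inf_q2_pos[of "2 * a"] qpoch_inf_q2_q2_pos one_minus_q2_pos by simp

lemma q_const_pos: "\<beta> > -1 \<Longrightarrow> 0 < q_const q \<beta>"
  unfolding q_const_def using q_Gamma_q2_pos[of "\<beta> + 1"] q_pos
  by (intro divide_pos_pos) (auto simp: add_pos_pos less_imp_neq[THEN not_sym])

lemma amp_pos: "\<beta> > -1 \<Longrightarrow> 0 < amp \<beta>"
  unfolding amp_def using q_const_pos q_less_1 by simp

text \<open>The normalisation of the transform against the norm of the Hahn-Exton functions.  The
\<open>\<Gamma>\<close>-quotient leaves \<open>q\<^sup>\<beta> (1 - q)\<^bsup>\<beta>+1\<^esup>\<close>, and \<open>1 - q = q\<^sup>N\<close> cancels the shift by \<open>N\<close> between \<open>j\<^sub>\<beta>\<close> and \<open>\<phi>\<close>.\<close>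

lemma amp_norm:
  assumes "\<beta> > -1"
  shows "(amp \<beta>)\<^sup>2 * ((qpoch_inf (q\<^sup>2) (q\<^sup>2) / qpoch_inf (q powr (2 * \<beta> + 2)) (q\<^sup>2))\<^sup>2 * (q powr (2 * \<beta> + 2)) powi (1 - (n + N)))
           = q powr (4 * \<beta> + 2) * q powr (- ((2 * \<beta> + 2) * real_of_int n))"
proof -
  define D where "D = qpoch_inf (q\<^sup>2) (q\<^sup>2) / qpoch_inf (q powr (2 * \<beta> + 2)) (q\<^sup>2)"
  have D: "D > 0" using assms qpoch_inf_q2_pos[of "2 * \<beta> + 2"] qpoch_inf_q2_q2_pos by (simp add: D_def)
  have G: "q_Gamma (q\<^sup>2) (\<beta> + 1) = D * (1 - q\<^sup>2) powr (- \<beta>)"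
    unfolding q_Gamma_q2 D_def by (simp add: algebra_simps)
  have f: "1 - q\<^sup>2 = (1 + 1 / q) * (q * (1 - q))"
    using q_pos by (simp add: field_simps power2_eq_square)
  have "(1 - q\<^sup>2) powr (- \<beta>) = (1 + 1 / q) powr (- \<beta>) * (q powr (- \<beta>) * (1 - q) powr (- \<beta>))"
    unfolding f using q_pos q_less_1 powr_mult[of "1 + 1 / q" "q * (1 - q)" "- \<beta>"] powr_mult[of q "1 - q" "- \<beta>"]
    by simp
  hence "q_const q \<beta> * D = q powr \<beta> * (1 - q) powr \<beta>"
    unfolding q_const_def G using D q_pos q_less_1 by (simp add: powr_minus field_simps add_pos_pos)
  hence "amp \<beta> * D = q powr \<beta> * (1 - q) powr (\<beta> + 1)"
    unfolding amp_def using q_less_1 by (simp add: powr_add mult_ac)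
  also have "(1 - q) powr (\<beta> + 1) = q powr (N * (\<beta> + 1))"
    unfolding one_minus_q using q_pos by (simp add: powi_eq_powr powr_powr)
  finally have "amp \<beta> * D = q powr (\<beta> + N * (\<beta> + 1))" by (simp add: powr_add)
  hence AD: "(amp \<beta>)\<^sup>2 * D\<^sup>2 = q powr (2 * (\<beta> + N * (\<beta> + 1)))"
    unfolding power_mult_distrib[symmetric] using q_pos by (simp add: powr_add[symmetric] power2_eq_square)
  have "(amp \<beta>)\<^sup>2 * (D\<^sup>2 * (q powr (2 * \<beta> + 2)) powi (1 - (n + N)))
      = q powr (2 * (\<beta> + N * (\<beta> + 1))) * qpow (2 * \<beta> + 2) (1 - (n + N))"
    unfolding mult.assoc[symmetric] AD using q_pos by (simp add: powr_powi)
  also have "\<dots> = q powr (4 * \<beta> + 2) * q powr (- ((2 * \<beta> + 2) * real_of_int n))"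
    unfolding powr_add[symmetric] by (simp add: algebra_simps)
  finally show ?thesis unfolding D_def .
qed

lemma J_orthogonality:
  assumes "\<beta> > -1"
  shows "(amp \<beta>)\<^sup>2 * (\<Sum>\<^sub>\<infinity>k. weight \<beta> k * J \<beta> (k + m) * J \<beta> (k + n))
    = (if m = n then q powr (4 * \<beta> + 2) * q powr (- ((2 * \<beta> + 2) * real_of_int n)) else 0)"
proof -
  interpret h: hahn_exton_base "q\<^sup>2" "q powr (2 * \<beta> + 2)" by (rule weight_base[OF assms])
  show ?thesis
    using h.hahn_exton_orthogonality[of "m + N" "n + N"] amp_norm[OF assms, of n] q_pos
    by (simp add: J_eq add.assoc powr_powi)
qed

definition l1 :: "real \<Rightarrow> (int \<Rightarrow> complex) \<Rightarrow> bool" where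
  "l1 \<beta> f \<longleftrightarrow> (\<lambda>k. weight \<beta> k * norm (f k)) summable_on UNIV"

text \<open>\<open>q_fourier\<close> in logarithmic coordinates, as an operator on sequences.\<close>

definition hankel :: "real \<Rightarrow> (int \<Rightarrow> complex) \<Rightarrow> int \<Rightarrow> complex" where
  "hankel \<beta> f m = of_real (amp \<beta>) * (\<Sum>\<^sub>\<infinity>k. of_real (weight \<beta> k * J \<beta> (k + m)) * f k)"

lemma jackson_eq: "jackson q (f :: real \<Rightarrow> complex) = of_real (1 - q) * (\<Sum>\<^sub>\<infinity>k. of_real (q powi k) * f (q powi k))"
  by (simp add: jackson_def scaleR_conv_of_real)

lemma weight_split: "q powi k * (q powi k) powr (2 * \<beta> + 1) = weight \<beta> k"
proof -
  have "q powi k * (q powi k) powr (2 * \<beta> + 1) = q powr (k + k * (2 * \<beta> + 1))"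
    unfolding powi_eq_powr[OF q_pos] powr_powr powr_add[of q k] by (rule refl)
  also have "k + k * (2 * \<beta> + 1) = (2 * \<beta> + 2) * real_of_int k" by (simp add: algebra_simps)
  finally show ?thesis .
qed

lemma jackson_weight:
  "jackson q (\<lambda>x. f x * of_real (x powr (2 * \<beta> + 1)) :: complex)
     = of_real (1 - q) * (\<Sum>\<^sub>\<infinity>k. of_real (weight \<beta> k) * f (q powi k))"
  unfolding jackson_eq weight_split[symmetric] by (simp add: mult_ac)

lemma q_fourier_grid: "q_fourier q \<beta> f (q powi m) = hankel \<beta> (on_grid f) m"
  unfolding q_fourier_def hankel_def jackson_weight amp_def using q_pos
  by (simp add: power_int_add mult_ac)

lemma hankel_scale: "hankel \<beta> (\<lambda>k. c * f k) m = c * hankel \<beta> f m"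
proof -
  have "(\<Sum>\<^sub>\<infinity>k. of_real (weight \<beta> k * J \<beta> (k + m)) * (c * f k)) = (\<Sum>\<^sub>\<infinity>k. c * (of_real (weight \<beta> k * J \<beta> (k + m)) * f k))"
    by (simp only: mult_ac)
  thus ?thesis unfolding hankel_def by (simp only: infsum_cmult_right' mult_ac)
qed

lemma hankel_cnj: "hankel \<beta> (\<lambda>k. cnj (f k)) m = cnj (hankel \<beta> f m)"
  unfolding hankel_def by (simp flip: infsum_cnj)

lemma hankel_adjoint:
  assumes "\<beta> > -1" "l1 \<beta> f" "l1 \<beta> g"
  shows "(\<Sum>\<^sub>\<infinity>k. of_real (weight \<beta> k) * hankel \<beta> f k * g k) = (\<Sum>\<^sub>\<infinity>k. of_real (weight \<beta> k) * f k * hankel \<beta> g k)"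
proof -
  obtain C where C: "0 \<le> C" "\<And>k. \<bar>J \<beta> k\<bar> \<le> C" using J_bounded[OF assms(1)] by blast
  define T where "T = (\<lambda>k m. of_real (amp \<beta> * weight \<beta> k * weight \<beta> m * J \<beta> (k + m)) * f m * g k)"
  have "(\<Sum>\<^sub>\<infinity>k. of_real (weight \<beta> k) * hankel \<beta> f k * g k) = (\<Sum>\<^sub>\<infinity>k. \<Sum>\<^sub>\<infinity>m. T k m)"
    unfolding hankel_def infsum_cmult_right'[symmetric] infsum_cmult_left'[symmetric] T_def
    by (simp add: mult_ac add.commute)
  also have "\<dots> = (\<Sum>\<^sub>\<infinity>m. \<Sum>\<^sub>\<infinity>k. T k m)"
  proof (rule infsum_swap_product_bound)
    show "(\<lambda>k. (\<bar>amp \<beta>\<bar> * C) * (weight \<beta> k * norm (g k))) summable_on UNIV"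
      using assms(3) unfolding l1_def by (rule summable_on_cmult_right)
    show "(\<lambda>m. weight \<beta> m * norm (f m)) summable_on UNIV"
      using assms(2) unfolding l1_def .
    fix k m
    have "norm (T k m) = (\<bar>amp \<beta>\<bar> * weight \<beta> k * weight \<beta> m * norm (f m) * norm (g k)) * \<bar>J \<beta> (k + m)\<bar>"
      unfolding T_def by (simp add: norm_mult abs_mult)
    also have "\<dots> \<le> (\<bar>amp \<beta>\<bar> * weight \<beta> k * weight \<beta> m * norm (f m) * norm (g k)) * C"
      by (intro mult_left_mono C) simp
    finally show "norm (T k m) \<le> (\<bar>amp \<beta>\<bar> * C) * (weight \<beta> k * norm (g k)) * (weight \<beta> m * norm (f m))"
      by (simp only: mult_ac)
  qed (use C in auto)
  also have "\<dots> = (\<Sum>\<^sub>\<infinity>k. of_real (weight \<beta> k) * f k * hankel \<beta> g k)"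
    unfolding hankel_def infsum_cmult_right'[symmetric] infsum_cmult_left'[symmetric] T_def
    by (simp add: mult_ac add.commute)
  finally show ?thesis .
qed

text \<open>The orthogonality relation, applied under a double sum that converges absolutely because the
kernel is bounded and summable against the weight.\<close>

theorem hankel_inversion:
  assumes "\<beta> > -1" "l1 \<beta> f"
  shows "hankel \<beta> (hankel \<beta> f) n = of_real (q powr (4 * \<beta> + 2)) * f n"
proof -
  obtain C where C: "0 \<le> C" "\<And>k. \<bar>J \<beta> k\<bar> \<le> C" using J_bounded[OF assms(1)] by blast
  have sJ: "(\<lambda>m. weight \<beta> m * \<bar>J \<beta> (m + n)\<bar>) summable_on UNIV"
  proof -
    have "of_order e (\<lambda>m. weight \<beta> m * J \<beta> (m + n))" if "e \<le> 2 * \<beta> + 2" for e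
      using of_order_mult[OF of_order_powr of_order_shift[OF of_order_J[OF assms(1), of "e - (2 * \<beta> + 2)"]], of "2 * \<beta> + 2" n] that by simp
    from of_order_summable[OF this[of "-1"] this[of "2 * \<beta> + 2"]] assms(1) show ?thesis
      by (simp add: abs_mult)
  qed
  have "hankel \<beta> (hankel \<beta> f) n = (\<Sum>\<^sub>\<infinity>m. \<Sum>\<^sub>\<infinity>k.
      of_real ((amp \<beta>)\<^sup>2 * weight \<beta> m * J \<beta> (m + n) * weight \<beta> k * J \<beta> (m + k)) * f k)"
    unfolding hankel_def infsum_cmult_right'[symmetric]
    by (simp add: mult_ac add.commute power2_eq_square)
  also have "\<dots> = (\<Sum>\<^sub>\<infinity>k. \<Sum>\<^sub>\<infinity>m.
      of_real ((amp \<beta>)\<^sup>2 * weight \<beta> m * J \<beta> (m + n) * weight \<beta> k * J \<beta> (m + k)) * f k)"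
  proof (rule infsum_swap_product_bound)
    show "(\<lambda>m. ((amp \<beta>)\<^sup>2 * C) * (weight \<beta> m * \<bar>J \<beta> (m + n)\<bar>)) summable_on UNIV"
      by (rule summable_on_cmult_right[OF sJ])
    show "(\<lambda>m. weight \<beta> m * norm (f m)) summable_on UNIV"
      using assms(2) unfolding l1_def .
    fix m k
    have "norm (of_real ((amp \<beta>)\<^sup>2 * weight \<beta> m * J \<beta> (m + n) * weight \<beta> k * J \<beta> (m + k)) * f k)
      = ((amp \<beta>)\<^sup>2 * weight \<beta> m * \<bar>J \<beta> (m + n)\<bar> * weight \<beta> k * norm (f k)) * \<bar>J \<beta> (m + k)\<bar>"
      unfolding norm_mult norm_of_real abs_mult by simp
    also have "\<dots> \<le> ((amp \<beta>)\<^sup>2 * weight \<beta> m * \<bar>J \<beta> (m + n)\<bar> * weight \<beta> k * norm (f k)) * C"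
      by (intro mult_left_mono C) simp
    finally show "norm (of_real ((amp \<beta>)\<^sup>2 * weight \<beta> m * J \<beta> (m + n) * weight \<beta> k * J \<beta> (m + k)) * f k)
       \<le> ((amp \<beta>)\<^sup>2 * C) * (weight \<beta> m * \<bar>J \<beta> (m + n)\<bar>) * (weight \<beta> k * norm (f k))"
      by (simp only: mult_ac)
  qed (use C in auto)
  also have "\<dots> = (\<Sum>\<^sub>\<infinity>k. of_real (weight \<beta> k * (if n = k then q powr (4 * \<beta> + 2) * q powr (- ((2 * \<beta> + 2) * real_of_int k)) else 0)) * f k)"
  proof (rule infsum_cong)
    fix k
    have "(\<Sum>\<^sub>\<infinity>m. of_real ((amp \<beta>)\<^sup>2 * weight \<beta> m * J \<beta> (m + n) * weight \<beta> k * J \<beta> (m + k)) * f k)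
      = (\<Sum>\<^sub>\<infinity>m. of_real (weight \<beta> k * (amp \<beta>)\<^sup>2) * of_real (weight \<beta> m * J \<beta> (m + n) * J \<beta> (m + k)) * f k)"
      by (simp add: mult_ac)
    also have "\<dots> = of_real (weight \<beta> k * (amp \<beta>)\<^sup>2) * of_real (\<Sum>\<^sub>\<infinity>m. weight \<beta> m * J \<beta> (m + n) * J \<beta> (m + k)) * f k"
      by (simp only: infsum_cmult_right' infsum_cmult_left' infsum_of_real)
    also have "\<dots> = of_real (weight \<beta> k * ((amp \<beta>)\<^sup>2 * (\<Sum>\<^sub>\<infinity>m. weight \<beta> m * J \<beta> (m + n) * J \<beta> (m + k)))) * f k"
      by (simp only: of_real_mult mult_ac)
    finally show "(\<Sum>\<^sub>\<infinity>m. of_real ((amp \<beta>)\<^sup>2 * weight \<beta> m * J \<beta> (m + n) * weight \<beta> k * J \<beta> (m + k)) * f k)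
       = of_real (weight \<beta> k * (if n = k then q powr (4 * \<beta> + 2) * q powr (- ((2 * \<beta> + 2) * real_of_int k)) else 0)) * f k"
      unfolding J_orthogonality[OF assms(1)] .
  qed
  also have "\<dots> = of_real (weight \<beta> n * (q powr (4 * \<beta> + 2) * q powr (- ((2 * \<beta> + 2) * real_of_int n)))) * f n"
    by (subst infsum_single[of n]) auto
  also have "weight \<beta> n * (q powr (4 * \<beta> + 2) * q powr (- ((2 * \<beta> + 2) * real_of_int n))) = q powr (4 * \<beta> + 2)"
    using q_pos by (simp add: powr_minus)
  finally show ?thesis .
qed

section \<open>A bounded extension of the Bessel kernel to the real line\<close>

lemma q_powi_ne_0 [simp]: "q powi k \<noteq> 0"
  using q_pos by simp

lemma q_powi_pos: "0 < q powi k"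
  using q_pos by simp

lemma q_powi_power: "(q powi k) ^ n = qpow (real n) k"
  by (subst power_int_power', subst powi_eq_powr[OF q_pos]) (simp add: mult.commute)

definition bessel_coeff :: "real \<Rightarrow> nat \<Rightarrow> real" where
  "bessel_coeff \<beta> n = base.euler_coeff n / qpoch (q powr (2 * \<beta> + 2)) (q\<^sup>2) n * (1 - q) ^ (2 * n)"

text \<open>Between the grid points \<open>j\<^sub>\<beta>\<close> grows faster than any power, so a transform cannot be continued to the real
line with the kernel \<open>j\<^sub>\<beta>\<close>.  Membership in \<open>q_schwartz\<close> depends on
the grid and on a neighbourhood of 0; the kernel is therefore cut off outside the grid.\<close>

definition kernel :: "real \<Rightarrow> real \<Rightarrow> real" where
  "kernel \<beta> y = (if \<bar>y\<bar> \<le> 1 \<or> \<bar>y\<bar> \<in> Rq_plus q then q_bessel_j q \<beta> y else 0)"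

lemma kernel_grid: "kernel \<beta> (q powi k) = J \<beta> k"
  using q_powi_pos[of k] by (simp add: kernel_def Rq_plus_def)

lemma q_bessel_j_even: "q_bessel_j q \<beta> (- y) = q_bessel_j q \<beta> y"
  by (simp add: q_bessel_j_eq)

lemma q_bessel_j_abs: "q_bessel_j q \<beta> \<bar>y\<bar> = q_bessel_j q \<beta> y"
  by (simp add: q_bessel_j_eq)

lemma kernel_even: "kernel \<beta> (- y) = kernel \<beta> y"
  by (simp add: kernel_def q_bessel_j_even)

lemma q_bessel_j_series:
  assumes "\<beta> > -1"
  shows "summable (\<lambda>n. \<bar>bessel_coeff \<beta> n * y ^ (2 * n)\<bar>)"
    and "q_bessel_j q \<beta> y = (\<Sum>n. bessel_coeff \<beta> n * y ^ (2 * n))"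
proof -
  interpret h: hahn_exton_base "q\<^sup>2" "q powr (2 * \<beta> + 2)" by (rule weight_base[OF assms])
  have eq: "h.hcoeff n * ((1 - q)\<^sup>2 * y\<^sup>2) ^ n = bessel_coeff \<beta> n * y ^ (2 * n)" for n
    by (simp add: bessel_coeff_def power_mult_distrib power_mult)
  show "summable (\<lambda>n. \<bar>bessel_coeff \<beta> n * y ^ (2 * n)\<bar>)"
    using h.abs_summable_hcoeff[of "(1 - q)\<^sup>2 * y\<^sup>2"] unfolding eq .
  show "q_bessel_j q \<beta> y = (\<Sum>n. bessel_coeff \<beta> n * y ^ (2 * n))"
    unfolding q_bessel_j_eq base.hahn_exton_def eq by (rule refl)
qed

lemma bessel_coeff_nonzero: "\<beta> > -1 \<Longrightarrow> bessel_coeff \<beta> n \<noteq> 0"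
proof -
  assume "\<beta> > -1"
  then interpret h: hahn_exton_base "q\<^sup>2" "q powr (2 * \<beta> + 2)" by (rule weight_base)
  have "qpoch (q\<^sup>2) (q\<^sup>2) n > 0" using base.p_less_1 by (rule base.qpoch_pos)
  thus ?thesis
    using h.qpoch_w_pos[of n] q_pos q_less_1 by (simp add: bessel_coeff_def euler_coeff_q2)
qed

text \<open>Near 0 by the power series, on the grid by the decay of the Hahn-Exton function.\<close>

lemma kernel_decay:
  assumes "\<beta> > -1"
  obtains C where "0 \<le> C" "\<And>y. \<bar>y\<bar> ^ M * \<bar>kernel \<beta> y\<bar> \<le> C"
proof -
  obtain D where D: "0 \<le> D" "\<And>k. norm (J \<beta> k) \<le> D * qpow (- real M) k"
    using of_order_J[OF assms, of "- real M"] by (rule of_orderE) auto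
  let ?S = "\<Sum>n. \<bar>bessel_coeff \<beta> n\<bar>"
  have S: "summable (\<lambda>n. \<bar>bessel_coeff \<beta> n\<bar>)" using q_bessel_j_series(1)[OF assms, of 1] by simp
  have S0: "0 \<le> ?S" by (rule suminf_nonneg[OF S]) simp
  have "\<bar>y\<bar> ^ M * \<bar>kernel \<beta> y\<bar> \<le> D + ?S" for y
  proof (cases "\<bar>y\<bar> \<le> 1")
    case True
    have "\<bar>kernel \<beta> y\<bar> = \<bar>\<Sum>n. bessel_coeff \<beta> n * y ^ (2 * n)\<bar>"
      using True by (simp add: kernel_def q_bessel_j_series(2)[OF assms])
    also have "\<dots> \<le> (\<Sum>n. \<bar>bessel_coeff \<beta> n * y ^ (2 * n)\<bar>)"
      using q_bessel_j_series(1)[OF assms, of y] by (rule summable_rabs)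
    also have "\<dots> \<le> ?S"
    proof (rule suminf_le[OF _ q_bessel_j_series(1)[OF assms, of y] S])
      fix n
      have "\<bar>y\<bar> ^ (2 * n) \<le> 1" using True by (intro power_le_one) auto
      thus "\<bar>bessel_coeff \<beta> n * y ^ (2 * n)\<bar> \<le> \<bar>bessel_coeff \<beta> n\<bar>"
        unfolding abs_mult power_abs by (intro mult_left_le) auto
    qed
    finally have "\<bar>kernel \<beta> y\<bar> \<le> ?S" .
    moreover have "\<bar>y\<bar> ^ M \<le> 1" using True by (intro power_le_one) auto
    ultimately have "\<bar>y\<bar> ^ M * \<bar>kernel \<beta> y\<bar> \<le> 1 * ?S" by (intro mult_mono) auto
    thus ?thesis using D by simp
  next
    case False
    show ?thesis
    proof (cases "\<bar>y\<bar> \<in> Rq_plus q")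
      case True
      then obtain k where k: "\<bar>y\<bar> = q powi k" by (auto simp: Rq_plus_def)
      have "kernel \<beta> y = J \<beta> k"
        using True unfolding kernel_def by (simp add: q_bessel_j_abs[symmetric, of _ y] k)
      moreover have "\<bar>y\<bar> ^ M = q powr (real M * k)"
        unfolding k by (rule q_powi_power)
      moreover have "q powr (real M * k) * (D * qpow (- real M) k) = D"
        using q_pos by (simp add: powr_minus)
      ultimately have "\<bar>y\<bar> ^ M * \<bar>kernel \<beta> y\<bar> \<le> D"
        using mult_left_mono[OF D(2)[of k], of "q powr (real M * k)"]
        by (metis powr_ge_zero real_norm_def)
      thus ?thesis using S0 by simp
    qed (use False D S0 in \<open>simp add: kernel_def\<close>)
  qed
  thus ?thesis using S0 D by (intro that[of "D + ?S"]) auto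
qed

text \<open>The estimate is global: for \<open>\<bar>y\<bar> > 1\<close> both the kernel and the polynomial are dominated by the
right-hand side.\<close>

lemma kernel_taylor:
  assumes "\<beta> > -1"
  obtains C where "0 \<le> C" "\<And>y. \<bar>kernel \<beta> y - (\<Sum>n<M. bessel_coeff \<beta> n * y ^ (2 * n))\<bar> \<le> C * \<bar>y\<bar> ^ (2 * M)"
proof -
  obtain D where D: "0 \<le> D" "\<And>y. \<bar>y\<bar> ^ 0 * \<bar>kernel \<beta> y\<bar> \<le> D"
    using kernel_decay[OF assms, of 0] by blast
  let ?c = "bessel_coeff \<beta>"
  let ?S = "\<Sum>n. \<bar>?c n\<bar>"
  let ?T = "\<Sum>n<M. \<bar>?c n\<bar>"
  have S: "summable (\<lambda>n. \<bar>?c n\<bar>)" using q_bessel_j_series(1)[OF assms, of 1] by simp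
  have S': "summable (\<lambda>n. \<bar>?c (n + M)\<bar>)" 
    using S summable_iff_shift[of "\<lambda>n. \<bar>?c n\<bar>" M] by simp
  have S0: "0 \<le> (\<Sum>n. \<bar>?c (n + M)\<bar>)" by (rule suminf_nonneg[OF S']) simp
  have T0: "0 \<le> ?T" by (intro sum_nonneg) simp
  have "\<bar>kernel \<beta> y - (\<Sum>n<M. ?c n * y ^ (2 * n))\<bar> \<le> (D + ?T + (\<Sum>n. \<bar>?c (n + M)\<bar>)) * \<bar>y\<bar> ^ (2 * M)" for y
  proof (cases "\<bar>y\<bar> \<le> 1")
    case True
    have s: "summable (\<lambda>n. ?c n * y ^ (2 * n))"
      using q_bessel_j_series(1)[OF assms, of y] by (rule summable_rabs_cancel)
    have s': "summable (\<lambda>n. \<bar>?c (n + M) * y ^ (2 * (n + M))\<bar>)"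
      using q_bessel_j_series(1)[OF assms, of y] summable_iff_shift[of "\<lambda>n. \<bar>?c n * y ^ (2 * n)\<bar>" M] by simp
    have "kernel \<beta> y = (\<Sum>n. ?c n * y ^ (2 * n))"
      using True by (simp add: kernel_def q_bessel_j_series(2)[OF assms])
    also have "\<dots> = (\<Sum>n. ?c (n + M) * y ^ (2 * (n + M))) + (\<Sum>n<M. ?c n * y ^ (2 * n))"
      by (rule suminf_split_initial_segment[OF s])
    finally have "\<bar>kernel \<beta> y - (\<Sum>n<M. ?c n * y ^ (2 * n))\<bar> = \<bar>\<Sum>n. ?c (n + M) * y ^ (2 * (n + M))\<bar>"
      by simp
    also have "\<dots> \<le> (\<Sum>n. \<bar>?c (n + M) * y ^ (2 * (n + M))\<bar>)"
      by (rule summable_rabs[OF s'])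
    also have "\<dots> \<le> (\<Sum>n. \<bar>?c (n + M)\<bar> * \<bar>y\<bar> ^ (2 * M))"
    proof (rule suminf_le[OF _ s' summable_mult2[OF S']])
      fix n
      have "\<bar>y\<bar> ^ (2 * (n + M)) \<le> \<bar>y\<bar> ^ (2 * M)" using True by (intro power_decreasing) auto
      thus "\<bar>?c (n + M) * y ^ (2 * (n + M))\<bar> \<le> \<bar>?c (n + M)\<bar> * \<bar>y\<bar> ^ (2 * M)"
        unfolding abs_mult power_abs by (intro mult_left_mono) auto
    qed
    also have "\<dots> = (\<Sum>n. \<bar>?c (n + M)\<bar>) * \<bar>y\<bar> ^ (2 * M)"
      by (rule suminf_mult2[OF S', symmetric])
    also have "\<dots> \<le> (D + ?T + (\<Sum>n. \<bar>?c (n + M)\<bar>)) * \<bar>y\<bar> ^ (2 * M)"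
      using D T0 by (intro mult_right_mono) auto
    finally show ?thesis .
  next
    case False
    hence one: "1 \<le> \<bar>y\<bar> ^ (2 * M)" by (intro one_le_power) auto
    have "\<bar>\<Sum>n<M. ?c n * y ^ (2 * n)\<bar> \<le> (\<Sum>n<M. \<bar>?c n\<bar> * \<bar>y\<bar> ^ (2 * M))"
    proof (rule order_trans[OF sum_abs sum_mono])
      fix n assume "n \<in> {..<M}"
      hence "\<bar>y\<bar> ^ (2 * n) \<le> \<bar>y\<bar> ^ (2 * M)" using False by (intro power_increasing) auto
      thus "\<bar>?c n * y ^ (2 * n)\<bar> \<le> \<bar>?c n\<bar> * \<bar>y\<bar> ^ (2 * M)"
        unfolding abs_mult power_abs by (intro mult_left_mono) auto
    qed
    also have "\<dots> = ?T * \<bar>y\<bar> ^ (2 * M)" by (rule sum_distrib_right[symmetric])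
    finally have "\<bar>kernel \<beta> y - (\<Sum>n<M. ?c n * y ^ (2 * n))\<bar> \<le> \<bar>kernel \<beta> y\<bar> + ?T * \<bar>y\<bar> ^ (2 * M)"
      by linarith
    also have "\<bar>kernel \<beta> y\<bar> \<le> D * \<bar>y\<bar> ^ (2 * M)"
      using mult_mono[OF _ one, of "\<bar>kernel \<beta> y\<bar>" D] D by simp
    also have "D * \<bar>y\<bar> ^ (2 * M) + ?T * \<bar>y\<bar> ^ (2 * M) \<le> (D + ?T + (\<Sum>n. \<bar>?c (n + M)\<bar>)) * \<bar>y\<bar> ^ (2 * M)"
      unfolding distrib_right[symmetric] using S0 by (intro mult_right_mono) auto
    finally show ?thesis by simp
  qed
  thus ?thesis using D S0 T0 by (intro that[of "D + ?T + (\<Sum>n. \<bar>?c (n + M)\<bar>)"]) auto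
qed

text \<open>Vanishing to every order at both ends of the grid.  These are the transforms of \<open>q_schwartz0\<close>.\<close>

definition flat :: "(int \<Rightarrow> complex) \<Rightarrow> bool" where
  "flat \<psi> \<longleftrightarrow> (\<forall>e. of_order e \<psi>)"

text \<open>Only the exponents \<open>e \<le> 0\<close>: boundedness near 0 and rapid decrease at infinity.\<close>

definition rapid :: "(int \<Rightarrow> complex) \<Rightarrow> bool" where
  "rapid f \<longleftrightarrow> (\<forall>e\<le>0. of_order e f)"

lemma flat_rapid: "flat \<psi> \<Longrightarrow> rapid \<psi>"
  by (simp add: flat_def rapid_def)

lemma rapid_weighted_summable:
  assumes "rapid f" "0 < s"
  shows "(\<lambda>k. qpow s k * norm (f k)) summable_on UNIV"
proof -
  have "of_order (s + e) (\<lambda>k. qpow s k * norm (f k))" if "e \<le> 0" for e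
    using assms that by (intro of_order_mult of_order_powr) (simp add: rapid_def of_order_norm_iff)
  from of_order_summable[OF this[of "- s - 1"] this[of 0]] assms show ?thesis by simp
qed

lemma flat_weighted_summable:
  assumes "flat f"
  shows "(\<lambda>k. qpow s k * norm (f k)) summable_on UNIV"
proof -
  have "of_order (s + e) (\<lambda>k. qpow s k * norm (f k))" for e
    using assms by (intro of_order_mult of_order_powr) (simp add: flat_def of_order_norm_iff)
  from of_order_summable[OF this[of "- s - 1"] this[of "1 - s"]] show ?thesis by simp
qed

lemma rapid_l1: "rapid f \<Longrightarrow> \<beta> > -1 \<Longrightarrow> l1 \<beta> f"
  unfolding l1_def by (rule rapid_weighted_summable) auto

lemma flat_of_order_mult:
  assumes "flat \<psi>" "of_order e f"
  shows "flat (\<lambda>k. \<psi> k * f k)" "flat (\<lambda>k. f k * \<psi> k)"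
proof -
  have "of_order (e' - e + e) (\<lambda>k. \<psi> k * f k)" for e'
    using assms by (intro of_order_mult) (auto simp: flat_def)
  thus "flat (\<lambda>k. \<psi> k * f k)" by (simp add: flat_def)
  thus "flat (\<lambda>k. f k * \<psi> k)" by (simp only: mult.commute)
qed

lemma flat_shift: "flat \<psi> \<Longrightarrow> flat (\<lambda>k. \<psi> (k + m))"
  by (simp add: flat_def of_order_shift)

lemma flat_cnj: "flat (\<lambda>k. cnj (\<psi> k)) \<longleftrightarrow> flat \<psi>"
  by (simp add: flat_def of_order_cnj)

lemma flat_scale: "flat \<psi> \<Longrightarrow> flat (\<lambda>k. c * \<psi> k)"
proof -
  assume "flat \<psi>"
  moreover have "of_order 0 (\<lambda>k. c)" by (rule of_orderI[of _ "norm c"]) (use q_pos in simp)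
  ultimately show ?thesis by (rule flat_of_order_mult(2))
qed

lemma flat_powr_mult: "flat \<psi> \<Longrightarrow> flat (\<lambda>k. of_real (qpow e k) * \<psi> k)"
  by (rule flat_of_order_mult(2)[of _ e]) (simp_all add: of_order_of_real of_order_powr)

lemma flat_l1: "flat \<psi> \<Longrightarrow> \<beta> > -1 \<Longrightarrow> l1 \<beta> \<psi>"
  by (intro rapid_l1 flat_rapid)

text \<open>The integral of \<open>x\<^bsup>2n+2\<beta>+1\<^esup>\<close> against the sequence, up to the factor \<open>1 - q\<close>.\<close>

definition moment :: "real \<Rightarrow> (int \<Rightarrow> complex) \<Rightarrow> nat \<Rightarrow> complex" where
  "moment \<beta> f n = (\<Sum>\<^sub>\<infinity>k. of_real (weight (\<beta> + real n) k) * f k)"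

lemma weight_add: "weight (\<beta> + real n) k = weight \<beta> k * qpow (2 * real n) k"
  unfolding powr_add[symmetric] by (simp add: algebra_simps)

definition hankel_ext :: "real \<Rightarrow> (int \<Rightarrow> complex) \<Rightarrow> real \<Rightarrow> complex" where
  "hankel_ext \<beta> \<psi> x = of_real (amp \<beta>) * (\<Sum>\<^sub>\<infinity>k. of_real (weight \<beta> k * kernel \<beta> (q powi k * x)) * \<psi> k)"

lemma hankel_ext_grid: "hankel_ext \<beta> \<psi> (q powi m) = hankel \<beta> \<psi> m"
proof -
  have "q powi k * q powi m = q powi (k + m)" for k
    using q_pos by (simp add: power_int_add)
  thus ?thesis unfolding hankel_ext_def hankel_def by (simp only: kernel_grid)
qed

lemma hankel_ext_even: "hankel_ext \<beta> \<psi> (- x) = hankel_ext \<beta> \<psi> x"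
  by (simp add: hankel_ext_def kernel_even)

lemma hankel_ext_summable:
  assumes "\<beta> > -1" "rapid \<psi>"
  shows "(\<lambda>k. of_real (weight \<beta> k * kernel \<beta> (q powi k * x)) * \<psi> k) summable_on UNIV"
proof -
  obtain C where C: "0 \<le> C" "\<And>y. \<bar>y\<bar> ^ 0 * \<bar>kernel \<beta> y\<bar> \<le> C" using kernel_decay[OF assms(1), of 0] by blast
  show ?thesis
  proof (rule dominated_infsum(1))
    show "(\<lambda>k. C * (weight \<beta> k * norm (\<psi> k))) summable_on UNIV"
      using assms by (intro summable_on_cmult_right rapid_weighted_summable) auto
    show "norm (of_real (weight \<beta> k * kernel \<beta> (q powi k * x)) * \<psi> k) \<le> C * (weight \<beta> k * norm (\<psi> k))" for k
      using C(2)[of "q powi k * x"] mult_right_mono[of "\<bar>kernel \<beta> (q powi k * x)\<bar>" C "weight \<beta> k * norm (\<psi> k)"]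
      by (simp add: norm_mult abs_mult mult_ac)
  qed
qed

lemma hankel_ext_decay:
  assumes "\<beta> > -1" "flat \<psi>"
  shows "\<exists>C. \<forall>x. \<bar>x\<bar> ^ M * norm (hankel_ext \<beta> \<psi> x) \<le> C"
proof -
  obtain C where C: "0 \<le> C" "\<And>y. \<bar>y\<bar> ^ M * \<bar>kernel \<beta> y\<bar> \<le> C" using kernel_decay[OF assms(1), of M] by blast
  let ?s = "2 * \<beta> + 2 - real M"
  have s: "(\<lambda>k. C * (qpow ?s k * norm (\<psi> k))) summable_on UNIV"
    by (rule summable_on_cmult_right[OF flat_weighted_summable[OF assms(2)]])
  have "\<bar>x\<bar> ^ M * norm (hankel_ext \<beta> \<psi> x) \<le> \<bar>amp \<beta>\<bar> * (\<Sum>\<^sub>\<infinity>k. C * (qpow ?s k * norm (\<psi> k)))" for x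
  proof -
    let ?f = "\<lambda>k. of_real (\<bar>x\<bar> ^ M) * (of_real (weight \<beta> k * kernel \<beta> (q powi k * x)) * \<psi> k)"
    have b: "norm (?f k) \<le> C * (qpow ?s k * norm (\<psi> k))" for k
    proof -
      have w: "weight \<beta> k = qpow ?s k * (q powi k) ^ M"
      proof -
        show ?thesis unfolding q_powi_power by (simp add: powr_add[symmetric] algebra_simps)
      qed
      have "norm (?f k) = (qpow ?s k * norm (\<psi> k)) * (\<bar>q powi k * x\<bar> ^ M * \<bar>kernel \<beta> (q powi k * x)\<bar>)"
        unfolding w norm_mult norm_of_real using q_powi_pos[of k] by (simp add: abs_mult power_mult_distrib)
      also have "\<dots> \<le> (qpow ?s k * norm (\<psi> k)) * C"
        by (intro mult_left_mono C) simp
      finally show ?thesis by (simp only: mult.commute)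
    qed
    have "\<bar>x\<bar> ^ M * norm (hankel_ext \<beta> \<psi> x) = \<bar>amp \<beta>\<bar> * norm (\<Sum>\<^sub>\<infinity>k. ?f k)"
      unfolding infsum_cmult_right' hankel_ext_def by (simp add: norm_mult norm_power)
    also have "\<dots> \<le> \<bar>amp \<beta>\<bar> * (\<Sum>\<^sub>\<infinity>k. C * (qpow ?s k * norm (\<psi> k)))"
      by (intro mult_left_mono dominated_infsum(2)[OF s b]) simp
    finally show ?thesis .
  qed
  thus ?thesis by blast
qed

lemma q_powi_power2: "(q powi k) ^ (2 * n) = qpow (2 * real n) k"
  unfolding q_powi_power by simp

text \<open>Integrate the expansion of the kernel term by term.  The coefficients at 0 of a transform are the
moments of the original function.\<close>

lemma hankel_ext_taylor:
  assumes "\<beta> > -1" "rapid s"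
  shows "\<exists>C. \<forall>x. norm (hankel_ext \<beta> s x - of_real (amp \<beta>) * (\<Sum>n<M. of_real (bessel_coeff \<beta> n * x ^ (2 * n)) * moment \<beta> s n))
      \<le> C * \<bar>x\<bar> ^ (2 * M)"
proof -
  let ?c = "bessel_coeff \<beta>"
  let ?e = "\<lambda>y. kernel \<beta> y - (\<Sum>n<M. ?c n * y ^ (2 * n))"
  let ?A = "\<Sum>\<^sub>\<infinity>k. weight (\<beta> + real M) k * norm (s k)"
  obtain C where C: "0 \<le> C" "\<And>y. \<bar>?e y\<bar> \<le> C * \<bar>y\<bar> ^ (2 * M)"
    using kernel_taylor[OF assms(1), of M] by blast
  have sw: "(\<lambda>k. weight (\<beta> + real n) k * norm (s k)) summable_on UNIV" for n
    by (rule rapid_weighted_summable[OF assms(2)]) (use assms(1) in auto)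
  have sc: "(\<lambda>k. of_real (weight (\<beta> + real n) k) * s k) summable_on UNIV" for n
    by (rule dominated_infsum(1)[OF sw[of n]]) (simp add: norm_mult)
  have scale: "weight \<beta> k * (q powi k * x) ^ (2 * n) = x ^ (2 * n) * weight (\<beta> + real n) k" for n k x
    unfolding weight_add power_mult_distrib q_powi_power2 by simp
  have "norm (hankel_ext \<beta> s x - of_real (amp \<beta>) * (\<Sum>n<M. of_real (?c n * x ^ (2 * n)) * moment \<beta> s n))
      \<le> \<bar>amp \<beta>\<bar> * (C * ?A) * \<bar>x\<bar> ^ (2 * M)" for x
  proof -
    let ?t = "\<lambda>n k. of_real (?c n * x ^ (2 * n)) * (of_real (weight (\<beta> + real n) k) * s k)"
    let ?r = "\<lambda>k. of_real (weight \<beta> k * ?e (q powi k * x)) * s k"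
    have t: "?t n summable_on UNIV" for n by (rule summable_on_cmult_right[OF sc])
    have split: "of_real (weight \<beta> k * kernel \<beta> (q powi k * x)) * s k - (\<Sum>n<M. ?t n k) = ?r k" for k
    proof -
      have "?t n k = of_real (weight \<beta> k * (?c n * (q powi k * x) ^ (2 * n))) * s k" for n
      proof -
        have "weight \<beta> k * (?c n * (q powi k * x) ^ (2 * n)) = ?c n * (x ^ (2 * n) * weight (\<beta> + real n) k)"
          unfolding scale[symmetric] by simp
        thus ?thesis by (simp only: of_real_mult mult.assoc)
      qed
      hence "(\<Sum>n<M. ?t n k) = of_real (weight \<beta> k * (\<Sum>n<M. ?c n * (q powi k * x) ^ (2 * n))) * s k"
        by (simp only: sum_distrib_left of_real_sum sum_distrib_right)
      thus ?thesis by (simp only: right_diff_distrib left_diff_distrib of_real_diff)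
    qed
    have 1: "(\<Sum>n<M. of_real (?c n * x ^ (2 * n)) * moment \<beta> s n) = (\<Sum>\<^sub>\<infinity>k. \<Sum>n<M. ?t n k)"
      unfolding moment_def infsum_cmult_right'[symmetric]
      by (rule infsum_sum_finite[symmetric]) (rule finite_lessThan, rule t)
    have "infsum ?r UNIV = (\<Sum>\<^sub>\<infinity>k. of_real (weight \<beta> k * kernel \<beta> (q powi k * x)) * s k) - (\<Sum>\<^sub>\<infinity>k. \<Sum>n<M. ?t n k)"
      unfolding split[symmetric]
      by (rule infsum_diff_banach[OF hankel_ext_summable[OF assms] summable_on_sum_finite]) (rule finite_lessThan, rule t)
    hence 2: "hankel_ext \<beta> s x - of_real (amp \<beta>) * (\<Sum>n<M. of_real (?c n * x ^ (2 * n)) * moment \<beta> s n)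
        = of_real (amp \<beta>) * infsum ?r UNIV"
      unfolding 1 hankel_ext_def by (simp only: right_diff_distrib)
    have "norm (?r k) \<le> (C * \<bar>x\<bar> ^ (2 * M)) * (weight (\<beta> + real M) k * norm (s k))" for k
    proof -
      have "norm (?r k) = weight \<beta> k * norm (s k) * \<bar>?e (q powi k * x)\<bar>"
        unfolding norm_mult norm_of_real abs_mult by simp
      also have "\<dots> \<le> weight \<beta> k * norm (s k) * (C * \<bar>q powi k * x\<bar> ^ (2 * M))"
        by (intro mult_left_mono C) simp
      also have "\<dots> = C * norm (s k) * (weight \<beta> k * (q powi k * \<bar>x\<bar>) ^ (2 * M))"
        using q_powi_pos[of k] by (simp add: abs_mult)
      finally show ?thesis unfolding scale by (simp only: mult_ac)
    qed
    hence "norm (infsum ?r UNIV) \<le> (\<Sum>\<^sub>\<infinity>k. (C * \<bar>x\<bar> ^ (2 * M)) * (weight (\<beta> + real M) k * norm (s k)))"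
      by (rule dominated_infsum(2)[OF summable_on_cmult_right[OF sw]])
    hence "norm (infsum ?r UNIV) \<le> C * \<bar>x\<bar> ^ (2 * M) * ?A"
      by (simp only: infsum_cmult_right')
    hence "\<bar>amp \<beta>\<bar> * norm (infsum ?r UNIV) \<le> \<bar>amp \<beta>\<bar> * (C * \<bar>x\<bar> ^ (2 * M) * ?A)"
      by (rule mult_left_mono) simp
    thus ?thesis unfolding 2 norm_mult norm_of_real by (simp only: mult_ac)
  qed
  thus ?thesis by blast
qed

lemma hankel_taylor:
  assumes "\<beta> > -1" "rapid s"
  shows "\<exists>C. \<forall>m. norm (hankel \<beta> s m - of_real (amp \<beta>) * (\<Sum>n<M. of_real (bessel_coeff \<beta> n * qpow (2 * real n) m) * moment \<beta> s n))
      \<le> C * qpow (2 * real M) m"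
proof -
  obtain C where C: "norm (hankel_ext \<beta> s x - of_real (amp \<beta>) * (\<Sum>n<M. of_real (bessel_coeff \<beta> n * x ^ (2 * n)) * moment \<beta> s n))
      \<le> C * \<bar>x\<bar> ^ (2 * M)" for x
    using hankel_ext_taylor[OF assms, of M] by blast
  show ?thesis
    using C[of "q powi _"] unfolding hankel_ext_grid abs_of_pos[OF q_powi_pos] q_powi_power2 by blast
qed

section \<open>The q-Schwartz spaces\<close>

lemma taylor_shift:
  fixes b :: "nat \<Rightarrow> complex"
  shows "(\<Sum>n<M. b n * of_real ((1 - q) / (1 - q ^ Suc n)) * of_real x ^ Suc n)
     - (\<Sum>n<M. b n * of_real ((1 - q) / (1 - q ^ Suc n)) * of_real (q * x) ^ Suc n)
     = of_real ((1 - q) * x) * (\<Sum>n<M. b n * of_real x ^ n)"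
proof -
  have "b n * of_real ((1 - q) / (1 - q ^ Suc n)) * of_real x ^ Suc n
      - b n * of_real ((1 - q) / (1 - q ^ Suc n)) * of_real (q * x) ^ Suc n
      = of_real ((1 - q) * x) * (b n * of_real x ^ n)" for n
  proof -
    have "q ^ Suc n < 1" using q_pos q_less_1 by (intro power_Suc_less_one) auto
    hence "(1 - q) / (1 - q ^ Suc n) * (1 - q ^ Suc n) = 1 - q" by simp
    hence cd: "of_real ((1 - q) / (1 - q ^ Suc n)) * (1 - of_real (q ^ Suc n)) = complex_of_real (1 - q)"
      by (metis of_real_1 of_real_diff of_real_mult)
    have "c * d * y - c * d * (Q * y) = c * (d * (1 - Q)) * y" for c d y Q :: complex
      by (simp add: algebra_simps)
    from this[of "b n" "of_real ((1 - q) / (1 - q ^ Suc n))" "of_real x ^ Suc n" "of_real (q ^ Suc n)"]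
    show ?thesis
      unfolding cd by (simp add: power_mult_distrib mult_ac)
  qed
  thus ?thesis unfolding sum_subtractf[symmetric] sum_distrib_left by (intro sum.cong refl)
qed

text \<open>Sum the differences along \<open>x, q x, q\<^sup>2 x, \<dots>\<close>; continuity at 0 removes the last term.\<close>

lemma small_of_q_difference:
  fixes G :: "real \<Rightarrow> complex"
  assumes G0: "G 0 = 0" "isCont G 0"
    and diff: "\<And>x. norm (G x - G (q * x)) \<le> (1 - q) * C * \<bar>x\<bar> ^ Suc M"
  shows "norm (G x) \<le> C * \<bar>x\<bar> ^ Suc M"
proof -
  have C: "0 \<le> C"
    using order_trans[OF norm_ge_zero diff[of 1]] q_less_1 by (simp add: zero_le_mult_iff)
  have bound: "norm (G x) \<le> norm (G (q ^ n * x)) + (1 - q ^ n) * C * \<bar>x\<bar> ^ Suc M" for n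
  proof (induction n)
    case (Suc n)
    have "norm (G (q ^ n * x)) \<le> norm (G (q ^ Suc n * x)) + norm (G (q ^ n * x) - G (q * (q ^ n * x)))"
      using norm_triangle_ineq[of "G (q ^ Suc n * x)" "G (q ^ n * x) - G (q * (q ^ n * x))"] by (simp add: mult_ac)
    also have "norm (G (q ^ n * x) - G (q * (q ^ n * x))) \<le> (1 - q) * C * \<bar>q ^ n * x\<bar> ^ Suc M"
      by (rule diff)
    also have "\<bar>q ^ n * x\<bar> ^ Suc M \<le> q ^ n * \<bar>x\<bar> ^ Suc M"
    proof -
      have "(q ^ n) ^ Suc M \<le> q ^ n * 1"
        unfolding power_Suc[of "q ^ n"] using q_pos q_less_1 by (intro mult_left_mono power_le_one) auto
      hence "(q ^ n) ^ Suc M * \<bar>x\<bar> ^ Suc M \<le> q ^ n * \<bar>x\<bar> ^ Suc M"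
        by (intro mult_right_mono) auto
      thus ?thesis using q_pos by (simp only: abs_mult power_mult_distrib abs_of_pos zero_less_power)
    qed
    hence "(1 - q) * C * \<bar>q ^ n * x\<bar> ^ Suc M \<le> (1 - q) * C * (q ^ n * \<bar>x\<bar> ^ Suc M)"
      using C q_less_1 by (intro mult_left_mono) auto
    finally show ?case using Suc.IH by (simp add: algebra_simps)
  qed simp
  have "(\<lambda>n. q ^ n * x) \<longlonglongrightarrow> 0 * x"
    using q_pos q_less_1 by (intro tendsto_intros) auto
  hence "(\<lambda>n. G (q ^ n * x)) \<longlonglongrightarrow> 0"
    using isCont_tendsto_compose[OF G0(2), of "\<lambda>n. q ^ n * x"] G0(1) by simp
  hence "(\<lambda>n. norm (G (q ^ n * x)) + C * \<bar>x\<bar> ^ Suc M) \<longlonglongrightarrow> norm (0 :: complex) + C * \<bar>x\<bar> ^ Suc M"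
    by (intro tendsto_intros)
  moreover have "norm (G x) \<le> norm (G (q ^ n * x)) + C * \<bar>x\<bar> ^ Suc M" for n
  proof -
    have "(1 - q ^ n) * (C * \<bar>x\<bar> ^ Suc M) \<le> 1 * (C * \<bar>x\<bar> ^ Suc M)"
      using C q_pos by (intro mult_right_mono) auto
    thus ?thesis using bound[of n] by simp
  qed
  ultimately show ?thesis using LIMSEQ_le_const[of _ "norm (0::complex) + C * \<bar>x\<bar> ^ Suc M" "norm (G x)"] by auto
qed

text \<open>Differentiability at 0 of all \<open>q\<close>-derivatives yields a Taylor expansion: integrate the expansion of
\<open>q_deriv q F\<close> monomial by monomial and estimate the remainder through its \<open>q\<close>-differences.\<close>

lemma taylor_of_inf_q_differentiable:
  assumes "\<And>k. (q_deriv q ^^ k) F differentiable (at 0)"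
    and "\<And>k. \<exists>C. \<forall>x. norm ((q_deriv q ^^ k) F x) \<le> C"
  shows "\<exists>a C. \<forall>x. norm (F x - (\<Sum>n<M. a n * of_real x ^ n)) \<le> C * \<bar>x\<bar> ^ M"
  using assms
proof (induction M arbitrary: F)
  case 0
  from 0(2)[of 0] show ?case by auto
next
  case (Suc M)
  have "\<exists>b C. \<forall>x. norm (q_deriv q F x - (\<Sum>n<M. b n * of_real x ^ n)) \<le> C * \<bar>x\<bar> ^ M"
    by (rule Suc.IH) (use Suc.prems[of "Suc _"] in \<open>simp_all add: funpow_Suc_right del: funpow.simps\<close>)
  then obtain b C where bC: "\<And>x. norm (q_deriv q F x - (\<Sum>n<M. b n * of_real x ^ n)) \<le> C * \<bar>x\<bar> ^ M"
    by blast
  define a where "a = (\<lambda>n. case n of 0 \<Rightarrow> F 0 | Suc n \<Rightarrow> b n * of_real ((1 - q) / (1 - q ^ Suc n)))"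
  define P where "P = (\<lambda>x. \<Sum>n<M. b n * of_real ((1 - q) / (1 - q ^ Suc n)) * of_real x ^ Suc n :: complex)"
  define G where "G = (\<lambda>x. F x - F 0 - P x)"
  have Ga: "G x = F x - (\<Sum>n<Suc M. a n * of_real x ^ n)" for x
    unfolding G_def P_def a_def sum.lessThan_Suc_shift by simp
  have "norm (G x) \<le> C * \<bar>x\<bar> ^ Suc M" for x
  proof (rule small_of_q_difference)
    show "G 0 = 0" by (simp add: G_def P_def)
    have "isCont F 0" using Suc.prems(1)[of 0] by (simp add: differentiable_imp_continuous_within)
    moreover have "isCont P 0" unfolding P_def by (intro continuous_intros)
    ultimately show "isCont G 0" unfolding G_def by (intro continuous_intros)
  next
    fix x :: real
    show "norm (G x - G (q * x)) \<le> (1 - q) * C * \<bar>x\<bar> ^ Suc M"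
    proof (cases "x = 0")
      case False
      have "F x - F (q * x) = of_real ((1 - q) * x) * q_deriv q F x"
        using False q_less_1 by (simp add: q_deriv_def)
      moreover have "P x - P (q * x) = of_real ((1 - q) * x) * (\<Sum>n<M. b n * of_real x ^ n)"
        unfolding P_def by (rule taylor_shift)
      ultimately have "G x - G (q * x) = of_real ((1 - q) * x) * (q_deriv q F x - (\<Sum>n<M. b n * of_real x ^ n))"
      proof -
        assume "F x - F (q * x) = of_real ((1 - q) * x) * q_deriv q F x"
          and "P x - P (q * x) = of_real ((1 - q) * x) * (\<Sum>n<M. b n * of_real x ^ n)"
        moreover have "G x - G (q * x) = (F x - F (q * x)) - (P x - P (q * x))" by (simp add: G_def)
        ultimately show ?thesis by (simp only: right_diff_distrib)
      qed
      hence "norm (G x - G (q * x)) = (1 - q) * \<bar>x\<bar> * norm (q_deriv q F x - (\<Sum>n<M. b n * of_real x ^ n))"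
        using q_less_1 by (simp only: norm_mult norm_of_real abs_mult)
      also have "\<dots> \<le> (1 - q) * \<bar>x\<bar> * (C * \<bar>x\<bar> ^ M)"
        using q_less_1 by (intro mult_left_mono bC) auto
      finally show ?thesis by (simp add: mult_ac)
    qed simp
  qed
  thus ?case unfolding Ga by blast
qed

text \<open>A sufficient condition for being a \<open>q\<close>-Schwartz function that does not mention \<open>q\<close>-derivatives: an
asymptotic expansion at 0 to all orders and rapid decay.  It is stable under \<open>q_deriv\<close>.\<close>

definition tame :: "(real \<Rightarrow> complex) \<Rightarrow> bool" where
  "tame F \<longleftrightarrow> (\<exists>a. \<forall>M. \<exists>C. \<forall>x. \<bar>x\<bar> \<le> 1 \<longrightarrow> norm (F x - (\<Sum>n<M. a n * of_real x ^ n)) \<le> C * \<bar>x\<bar> ^ M)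
     \<and> (\<forall>M. \<exists>C. \<forall>x. \<bar>x\<bar> ^ M * norm (F x) \<le> C)"

lemma taylor_imp_derivative:
  assumes "\<And>x. \<bar>x\<bar> \<le> 1 \<Longrightarrow> norm (F x - (\<Sum>n<2. a n * of_real x ^ n)) \<le> C * \<bar>x\<bar> ^ 2"
  shows "(F has_vector_derivative (a 1 :: complex)) (at 0)"
proof -
  have F0: "F 0 = a 0"
    using assms[of 0] by (simp add: numeral_2_eq_2)
  have "(\<lambda>h. norm (F (0 + h) - F 0 - h *\<^sub>R a 1) / norm h) \<midarrow>0\<rightarrow> 0"
  proof (rule tendsto_sandwich)
    show "\<forall>\<^sub>F h in at 0. 0 \<le> norm (F (0 + h) - F 0 - h *\<^sub>R a 1) / norm h" by simp
    have "norm (F (0 + h) - F 0 - h *\<^sub>R a 1) / norm h \<le> C * \<bar>h\<bar>" if "h \<noteq> 0" "\<bar>h\<bar> \<le> 1" for h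
    proof -
      have "norm (F (0 + h) - F 0 - h *\<^sub>R a 1) \<le> C * \<bar>h\<bar> * \<bar>h\<bar>"
        using assms[OF that(2)] by (simp add: F0 numeral_2_eq_2 scaleR_conv_of_real algebra_simps)
      thus ?thesis using that by (simp add: divide_le_eq)
    qed
    thus "\<forall>\<^sub>F h in at 0. norm (F (0 + h) - F 0 - h *\<^sub>R a 1) / norm h \<le> C * \<bar>h\<bar>"
      unfolding eventually_at by (intro exI[of _ 1]) (auto simp: dist_real_def)
    show "(\<lambda>h. C * \<bar>h\<bar>) \<midarrow>0\<rightarrow> 0" by (auto intro!: tendsto_eq_intros)
  qed auto
  thus ?thesis
    unfolding has_vector_derivative_def has_derivative_at by (simp add: bounded_linear_scaleR_left)
qed

lemma tame_differentiable:
  assumes "tame F"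
  shows "F differentiable (at 0)"
proof -
  obtain a C where "\<And>x. \<bar>x\<bar> \<le> 1 \<Longrightarrow> norm (F x - (\<Sum>n<2. a n * of_real x ^ n)) \<le> C * \<bar>x\<bar> ^ 2"
    using assms unfolding tame_def by meson
  hence "(F has_vector_derivative a 1) (at 0)" by (rule taylor_imp_derivative)
  thus ?thesis unfolding has_vector_derivative_def differentiable_def by blast
qed

text \<open>The \<open>q\<close>-derivative is a difference of two values divided by \<open>x\<close>, so it lowers the order of every
remainder by one, and at infinity it cannot spoil rapid decay.\<close>

lemma tame_q_deriv:
  assumes "tame F"
  shows "tame (q_deriv q F)"
proof -
  obtain a where a: "\<And>M. \<exists>C. \<forall>x. \<bar>x\<bar> \<le> 1 \<longrightarrow> norm (F x - (\<Sum>n<M. a n * of_real x ^ n)) \<le> C * \<bar>x\<bar> ^ M"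
    using assms unfolding tame_def by blast
  have decay: "\<exists>C. \<forall>x. \<bar>x\<bar> ^ M * norm (F x) \<le> C" for M
    using assms unfolding tame_def by blast
  define b where "b = (\<lambda>n. a (Suc n) * of_real ((1 - q ^ Suc n) / (1 - q)))"
  have deriv0: "q_deriv q F 0 = b 0"
  proof -
    have "(F has_vector_derivative a 1) (at 0)" using a[of 2] taylor_imp_derivative by blast
    thus ?thesis using q_less_1 by (simp add: q_deriv_def b_def vector_derivative_at)
  qed
  have poly: "(\<Sum>n<Suc M. a n * of_real x ^ n) - (\<Sum>n<Suc M. a n * of_real (q * x) ^ n)
      = of_real ((1 - q) * x) * (\<Sum>n<M. b n * of_real x ^ n)" for M x
  proof -
    have "b n * of_real ((1 - q) / (1 - q ^ Suc n)) = a (Suc n)" for n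
    proof -
      have "q ^ Suc n < 1" using q_pos q_less_1 by (intro power_Suc_less_one) auto
      hence "(1 - q ^ Suc n) / (1 - q) * ((1 - q) / (1 - q ^ Suc n)) = 1" using q_less_1 by simp
      thus ?thesis unfolding b_def mult.assoc of_real_mult[symmetric] by simp
    qed
    thus ?thesis using taylor_shift[where M = M and b = b and x = x] unfolding sum.lessThan_Suc_shift by simp
  qed
  have taylor: "\<exists>C. \<forall>x. \<bar>x\<bar> \<le> 1 \<longrightarrow> norm (q_deriv q F x - (\<Sum>n<M. b n * of_real x ^ n)) \<le> C * \<bar>x\<bar> ^ M" for M
  proof -
    obtain C where C: "\<And>x. \<bar>x\<bar> \<le> 1 \<Longrightarrow> norm (F x - (\<Sum>n<Suc M. a n * of_real x ^ n)) \<le> C * \<bar>x\<bar> ^ Suc M"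
      using a[of "Suc M"] by blast
    have C0: "0 \<le> C" using order_trans[OF norm_ge_zero C[of 1]] by simp
    have "norm (q_deriv q F x - (\<Sum>n<M. b n * of_real x ^ n)) \<le> (2 * C / (1 - q) + norm (b 0)) * \<bar>x\<bar> ^ M" if x: "\<bar>x\<bar> \<le> 1" for x
    proof (cases "x = 0")
      case True
      thus ?thesis
      proof (cases M)
        case 0
        thus ?thesis using True deriv0 C0 q_less_1 by simp
      next
        case (Suc m)
        have "(\<Sum>n<M. b n * of_real x ^ n) = b 0"
          unfolding Suc True sum.lessThan_Suc_shift by simp
        thus ?thesis using True deriv0 Suc by simp
      qed
    next
      case False
      let ?G = "\<lambda>x. F x - (\<Sum>n<Suc M. a n * of_real x ^ n)"
      have nz: "complex_of_real ((1 - q) * x) \<noteq> 0" using False q_less_1 by simp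
      have "q_deriv q F x - (\<Sum>n<M. b n * of_real x ^ n) = (?G x - ?G (q * x)) / of_real ((1 - q) * x)"
      proof -
        have "?G x - ?G (q * x) = (F x - F (q * x)) - of_real ((1 - q) * x) * (\<Sum>n<M. b n * of_real x ^ n)"
          unfolding poly[symmetric] by simp
        moreover have "q_deriv q F x = (F x - F (q * x)) / of_real ((1 - q) * x)"
          using False by (simp add: q_deriv_def)
        moreover have "u / d - S = (u - d * S) / d" if "d \<noteq> 0" for u S d :: complex
          using that by (simp add: field_simps)
        ultimately show ?thesis using nz by metis
      qed
      also have "norm \<dots> \<le> (C * \<bar>x\<bar> ^ Suc M + C * \<bar>x\<bar> ^ Suc M) / ((1 - q) * \<bar>x\<bar>)"
      proof -
        have qx: "\<bar>q * x\<bar> \<le> 1" using x q_pos q_less_1 by (simp add: abs_mult mult_le_one)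
        have "C * \<bar>q * x\<bar> ^ Suc M \<le> C * \<bar>x\<bar> ^ Suc M"
          using C0 q_pos q_less_1 by (intro mult_left_mono power_mono) (auto simp: abs_mult mult_left_le_one_le)
        hence "norm (?G x - ?G (q * x)) \<le> C * \<bar>x\<bar> ^ Suc M + C * \<bar>x\<bar> ^ Suc M"
          using C[OF x] C[OF qx] norm_triangle_ineq4[of "?G x" "?G (q * x)"] by linarith
        moreover have "norm (complex_of_real ((1 - q) * x)) = (1 - q) * \<bar>x\<bar>"
          using q_less_1 by (simp only: norm_of_real abs_mult)
        ultimately show ?thesis unfolding norm_divide using False q_less_1 by (intro divide_mono) auto
      qed
      also have "\<dots> = (2 * C * \<bar>x\<bar> ^ M) * \<bar>x\<bar> / ((1 - q) * \<bar>x\<bar>)" by simp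
      also have "\<dots> = (2 * C * \<bar>x\<bar> ^ M) / (1 - q)"
        using False by (intro mult_divide_mult_cancel_right) simp
      also have "\<dots> = 2 * C / (1 - q) * \<bar>x\<bar> ^ M" by simp
      also have "\<dots> \<le> (2 * C / (1 - q) + norm (b 0)) * \<bar>x\<bar> ^ M" by (intro mult_right_mono) auto
      finally show ?thesis .
    qed
    thus ?thesis by blast
  qed
  moreover have "\<exists>C. \<forall>x. \<bar>x\<bar> ^ M * norm (q_deriv q F x) \<le> C" for M
  proof -
    obtain D where D: "\<And>x. \<bar>x\<bar> \<le> 1 \<Longrightarrow> norm (q_deriv q F x) \<le> D" using taylor[of 0] by auto
    obtain C where C: "\<And>x. \<bar>x\<bar> ^ M * norm (F x) \<le> C" using decay[of M] by blast
    have C0: "0 \<le> C" using order_trans[OF _ C[of 1]] by simp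
    have D0: "0 \<le> D" using order_trans[OF norm_ge_zero D[of 1]] by simp
    let ?E = "(C + C / q ^ M) / (1 - q)"
    have E0: "0 \<le> ?E" using C0 q_pos q_less_1 by simp
    have "\<bar>x\<bar> ^ M * norm (q_deriv q F x) \<le> D + ?E" for x
    proof (cases "\<bar>x\<bar> \<le> 1")
      case True
      have "\<bar>x\<bar> ^ M * norm (q_deriv q F x) \<le> 1 * D"
        using True D0 by (intro mult_mono D power_le_one) auto
      thus ?thesis using E0 by simp
    next
      case False
      have Fq: "\<bar>x\<bar> ^ M * norm (F (q * x)) \<le> C / q ^ M"
        using C[of "q * x"] q_pos by (simp add: abs_mult power_mult_distrib field_simps)
      have "norm (q_deriv q F x) = norm (F x - F (q * x)) / ((1 - q) * \<bar>x\<bar>)"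
      proof -
        have "norm (complex_of_real ((1 - q) * x)) = (1 - q) * \<bar>x\<bar>"
          using q_less_1 by (simp only: norm_of_real abs_mult)
        moreover have "x \<noteq> 0" using False by auto
        ultimately show ?thesis by (simp only: q_deriv_def norm_divide if_False)
      qed
      also have "\<dots> \<le> (norm (F x) + norm (F (q * x))) / (1 - q)"
        using False q_less_1 norm_triangle_ineq4[of "F x" "F (q * x)"]
        by (intro frac_le) (auto simp: mult_le_cancel_left1)
      finally have "\<bar>x\<bar> ^ M * norm (q_deriv q F x) \<le> \<bar>x\<bar> ^ M * ((norm (F x) + norm (F (q * x))) / (1 - q))"
        by (intro mult_left_mono) auto
      also have "\<dots> = (\<bar>x\<bar> ^ M * norm (F x) + \<bar>x\<bar> ^ M * norm (F (q * x))) / (1 - q)"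
        by (simp add: distrib_left)
      also have "\<dots> \<le> ?E"
        using C[of x] Fq q_less_1 by (intro divide_right_mono) auto
      finally show ?thesis using D0 by simp
    qed
    thus ?thesis by blast
  qed
  ultimately show ?thesis unfolding tame_def by blast
qed

lemma tame_funpow: "tame F \<Longrightarrow> tame ((q_deriv q ^^ k) F)"
  by (induction k) (auto intro: tame_q_deriv)

lemma restrict_tame_in_q_schwartz:
  assumes "tame F" "\<And>x. F (- x) = F x"
  shows "restrict F (Rq q) \<in> q_schwartz q"
proof -
  have bdd: "bdd_above {norm (of_real ((1 + x\<^sup>2) ^ m) * (q_deriv q ^^ k) F x) | x k. k \<le> n}" for n m
  proof -
    have "\<exists>C. \<forall>x. norm (of_real ((1 + x\<^sup>2) ^ m) * (q_deriv q ^^ k) F x) \<le> C" for k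
    proof -
      let ?H = "(q_deriv q ^^ k) F"
      have t: "\<forall>M. \<exists>C. \<forall>x. \<bar>x\<bar> ^ M * norm (?H x) \<le> C"
        using tame_funpow[OF assms(1), of k] unfolding tame_def by blast
      obtain C where C: "\<And>x. \<bar>x\<bar> ^ 0 * norm (?H x) \<le> C" using t by blast
      obtain D where D: "\<And>x. \<bar>x\<bar> ^ (2 * m) * norm (?H x) \<le> D" using t by blast
      have "norm (of_real ((1 + x\<^sup>2) ^ m) * ?H x) \<le> 2 ^ m * (C + D)" for x
      proof -
        have "(1 + x\<^sup>2) ^ m \<le> 2 ^ m * (1 + \<bar>x\<bar> ^ (2 * m))"
        proof (cases "x\<^sup>2 \<le> 1")
          case True
          have "(1 + x\<^sup>2) ^ m \<le> 2 ^ m * 1" using True by (simp add: power_mono)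
          also have "\<dots> \<le> 2 ^ m * (1 + \<bar>x\<bar> ^ (2 * m))" by (intro mult_left_mono) auto
          finally show ?thesis .
        next
          case False
          have "(1 + x\<^sup>2) ^ m \<le> (2 * x\<^sup>2) ^ m" using False by (intro power_mono) auto
          also have "\<dots> = 2 ^ m * \<bar>x\<bar> ^ (2 * m)" by (simp add: power_mult_distrib power_mult)
          also have "\<dots> \<le> 2 ^ m * (1 + \<bar>x\<bar> ^ (2 * m))" by (intro mult_left_mono) auto
          finally show ?thesis .
        qed
        hence "(1 + x\<^sup>2) ^ m * norm (?H x) \<le> 2 ^ m * (1 + \<bar>x\<bar> ^ (2 * m)) * norm (?H x)"
          by (intro mult_right_mono) auto
        also have "\<dots> = 2 ^ m * (\<bar>x\<bar> ^ 0 * norm (?H x) + \<bar>x\<bar> ^ (2 * m) * norm (?H x))"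
          by (simp add: algebra_simps)
        also have "\<dots> \<le> 2 ^ m * (C + D)" by (intro mult_left_mono add_mono C D) auto
        finally show ?thesis by (simp add: norm_mult norm_power flip: of_real_power of_real_add)
      qed
      thus ?thesis by blast
    qed
    then obtain C where C: "\<And>k x. norm (of_real ((1 + x\<^sup>2) ^ m) * (q_deriv q ^^ k) F x) \<le> C k" by metis
    show ?thesis
    proof (rule bdd_aboveI)
      fix y assume "y \<in> {norm (of_real ((1 + x\<^sup>2) ^ m) * (q_deriv q ^^ k) F x) | x k. k \<le> n}"
      then obtain x k where k: "k \<le> n" "y = norm (of_real ((1 + x\<^sup>2) ^ m) * (q_deriv q ^^ k) F x)" by blast
      have "y \<le> C k" unfolding k(2) by (rule C)
      also have "C k \<le> Max (C ` {..n})" using k(1) by (intro Max_ge) auto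
      finally show "y \<le> Max (C ` {..n})" .
    qed
  qed
  have "inf_q_differentiable q F"
    unfolding inf_q_differentiable_def using tame_differentiable[OF tame_funpow[OF assms(1)]] by blast
  thus ?thesis
    unfolding q_schwartz_def by (intro CollectI exI[of _ F] conjI allI refl assms(2) bdd)
qed

text \<open>The expansion of a transform has even powers only; remainders of odd order are obtained from the
next even one by moving a monomial to the other side.\<close>

lemma tame_hankel_ext:
  assumes "\<beta> > -1" "flat \<psi>"
  shows "tame (hankel_ext \<beta> \<psi>)"
  unfolding tame_def
proof
  define a where "a = (\<lambda>n. if even n then of_real (amp \<beta> * bessel_coeff \<beta> (n div 2)) * moment \<beta> \<psi> (n div 2) else 0)"
  let ?d = "\<lambda>M x. norm (hankel_ext \<beta> \<psi> x - (\<Sum>n<M. a n * of_real x ^ n))"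
  have even_sum: "(\<Sum>n<2 * M. a n * of_real x ^ n)
      = of_real (amp \<beta>) * (\<Sum>n<M. of_real (bessel_coeff \<beta> n * x ^ (2 * n)) * moment \<beta> \<psi> n)" for M x
    by (induction M) (simp_all add: a_def distrib_left mult_ac)
  have even_case: "\<exists>C. \<forall>x. \<bar>x\<bar> \<le> 1 \<longrightarrow> ?d (2 * M) x \<le> C * \<bar>x\<bar> ^ (2 * M)" for M
    unfolding even_sum using hankel_ext_taylor[OF assms(1) flat_rapid[OF assms(2)], of M] by blast
  have lower: "\<exists>C. \<forall>x. \<bar>x\<bar> \<le> 1 \<longrightarrow> ?d M x \<le> C * \<bar>x\<bar> ^ M"
    if "\<exists>C. \<forall>x. \<bar>x\<bar> \<le> 1 \<longrightarrow> ?d (M + k) x \<le> C * \<bar>x\<bar> ^ (M + k)" for M k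
    using that
  proof (induction k)
    case (Suc k)
    then obtain C where C: "\<And>x. \<bar>x\<bar> \<le> 1 \<Longrightarrow> ?d (Suc (M + k)) x \<le> C * \<bar>x\<bar> ^ Suc (M + k)" by auto
    have C0: "0 \<le> C" using order_trans[OF norm_ge_zero C[of 1]] by simp
    have "?d (M + k) x \<le> (C + norm (a (M + k))) * \<bar>x\<bar> ^ (M + k)" if x: "\<bar>x\<bar> \<le> 1" for x
    proof -
      have "?d (M + k) x \<le> ?d (Suc (M + k)) x + norm (a (M + k) * of_real x ^ (M + k))"
        using norm_triangle_ineq[of "hankel_ext \<beta> \<psi> x - (\<Sum>n<Suc (M + k). a n * of_real x ^ n)" "a (M + k) * of_real x ^ (M + k)"]
        by simp
      also have "\<dots> \<le> C * \<bar>x\<bar> ^ Suc (M + k) + norm (a (M + k)) * \<bar>x\<bar> ^ (M + k)"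
        using C[OF x] by (simp add: norm_mult norm_power)
      also have "C * \<bar>x\<bar> ^ Suc (M + k) \<le> C * \<bar>x\<bar> ^ (M + k)"
        using C0 x by (intro mult_left_mono power_decreasing) auto
      finally show ?thesis by (simp add: distrib_right)
    qed
    thus ?case using Suc.IH by blast
  qed simp
  have "\<exists>C. \<forall>x. \<bar>x\<bar> \<le> 1 \<longrightarrow> ?d M x \<le> C * \<bar>x\<bar> ^ M" for M
    by (rule lower[of M M]) (use even_case[of M] in \<open>simp only: mult_2\<close>)
  thus "\<exists>a. \<forall>M. \<exists>C. \<forall>x. \<bar>x\<bar> \<le> 1 \<longrightarrow> norm (hankel_ext \<beta> \<psi> x - (\<Sum>n<M. a n * of_real x ^ n)) \<le> C * \<bar>x\<bar> ^ M"
    by blast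
  show "\<forall>M. \<exists>C. \<forall>x. \<bar>x\<bar> ^ M * norm (hankel_ext \<beta> \<psi> x) \<le> C"
    using hankel_ext_decay[OF assms] by blast
qed

lemma q_powi_Rq [simp]: "q powi k \<in> Rq q" "- (q powi k) \<in> Rq q" "0 \<in> Rq q"
  using q_powi_pos[of k] by (auto simp: Rq_def Rq_plus_def)

lemma Rq_cases:
  assumes "x \<in> Rq q"
  obtains "x = 0" | k where "x = q powi k" | k where "x = - (q powi k)"
proof -
  consider "x = 0" | k where "\<bar>x\<bar> = q powi k" using assms by (auto simp: Rq_def Rq_plus_def)
  thus ?thesis
  proof cases
    case (2 k)
    hence "x = q powi k \<or> x = - (q powi k)" by linarith
    thus ?thesis using that by blast
  qed (use that in blast)
qed

lemma q_schwartzE: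
  assumes "f \<in> q_schwartz q"
  obtains F where "f = restrict F (Rq q)" "\<And>x. F (- x) = F x"
    "\<And>k. (q_deriv q ^^ k) F differentiable (at 0)"
    "\<And>k. \<exists>C. \<forall>x. norm ((q_deriv q ^^ k) F x) \<le> C"
    "\<And>M. \<exists>C. \<forall>x. \<bar>x\<bar> ^ (2 * M) * norm (F x) \<le> C"
proof -
  obtain F where F: "f = restrict F (Rq q)" "\<And>x. F (- x) = F x" "inf_q_differentiable q F"
    "\<And>n m. bdd_above {norm (of_real ((1 + x\<^sup>2) ^ m) * (q_deriv q ^^ k) F x) | x k. k \<le> n}"
    using assms unfolding q_schwartz_def by blast
  have bound: "\<exists>C. \<forall>x. (1 + x\<^sup>2) ^ m * norm ((q_deriv q ^^ k) F x) \<le> C" for m k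
  proof -
    obtain C where C: "\<And>y. y \<in> {norm (of_real ((1 + x\<^sup>2) ^ m) * (q_deriv q ^^ k') F x) | x k'. k' \<le> k} \<Longrightarrow> y \<le> C"
      using F(4)[of m k] unfolding bdd_above_def by blast
    have "(1 + x\<^sup>2) ^ m * norm ((q_deriv q ^^ k) F x) \<le> C" for x
    proof -
      have "(1 + x\<^sup>2) ^ m * norm ((q_deriv q ^^ k) F x) = norm (of_real ((1 + x\<^sup>2) ^ m) * (q_deriv q ^^ k) F x)"
        unfolding norm_mult norm_of_real by simp
      also have "\<dots> \<le> C" by (rule C) blast
      finally show ?thesis .
    qed
    thus ?thesis by blast
  qed
  show ?thesis
  proof (rule that[OF F(1,2)])
    show "(q_deriv q ^^ k) F differentiable (at 0)" for k
      using F(3) unfolding inf_q_differentiable_def by blast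
    show "\<exists>C. \<forall>x. norm ((q_deriv q ^^ k) F x) \<le> C" for k
      using bound[of 0 k] by simp
    show "\<exists>C. \<forall>x. \<bar>x\<bar> ^ (2 * M) * norm (F x) \<le> C" for M
    proof -
      obtain C where C: "\<And>x. (1 + x\<^sup>2) ^ M * norm (F x) \<le> C" using bound[of M 0] by auto
      have "\<bar>x\<bar> ^ (2 * M) * norm (F x) \<le> C" for x
      proof -
        have "\<bar>x\<bar> ^ (2 * M) = (x\<^sup>2) ^ M" by (simp add: power_mult)
        also have "\<dots> \<le> (1 + x\<^sup>2) ^ M" by (intro power_mono) auto
        finally have "\<bar>x\<bar> ^ (2 * M) * norm (F x) \<le> (1 + x\<^sup>2) ^ M * norm (F x)" by (intro mult_right_mono) auto
        thus ?thesis using C[of x] by linarith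
      qed
      thus ?thesis by blast
    qed
  qed
qed

lemma q_schwartz_rapid:
  assumes "f \<in> q_schwartz q"
  shows "rapid (on_grid f)"
proof -
  obtain F where F: "f = restrict F (Rq q)" "\<And>M. \<exists>C. \<forall>x. \<bar>x\<bar> ^ (2 * M) * norm (F x) \<le> C"
    using assms by (rule q_schwartzE) blast
  have *: "of_order (- real (2 * M)) (on_grid f)" for M
  proof -
    obtain C where C: "\<And>x. \<bar>x\<bar> ^ (2 * M) * norm (F x) \<le> C" using F(2) by blast
    show ?thesis
    proof (rule of_orderI)
      fix k
      have "q powr (real (2 * M) * k) * norm (F (q powi k)) \<le> C"
        using C[of "q powi k"] unfolding abs_of_pos[OF q_powi_pos] q_powi_power .
      hence "q powr (- real (2 * M) * k) * (q powr (real (2 * M) * k) * norm (F (q powi k))) \<le> q powr (- real (2 * M) * k) * C"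
        by (intro mult_left_mono) auto
      thus "norm (f (q powi k)) \<le> C * q powr (- real (2 * M) * k)"
        unfolding mult.assoc[symmetric] powr_add[symmetric] using q_pos by (simp add: F(1) mult.commute)
    qed
  qed
  show ?thesis unfolding rapid_def
  proof (intro allI impI)
    fix e :: real assume e: "e \<le> 0"
    have "- e \<le> real (nat \<lceil>- e\<rceil>)" by linarith
    hence "- real (2 * nat \<lceil>- e\<rceil>) \<le> e" using e unfolding of_nat_mult by linarith
    moreover have "e \<le> - real (2 * 0)" using e by simp
    ultimately show "of_order e (on_grid f)" by (rule of_order_between[OF * *])
  qed
qed

text \<open>Averaging the expansions at \<open>x\<close> and \<open>-x\<close> removes the odd powers.\<close>

lemma q_schwartz_taylor:
  assumes "f \<in> q_schwartz q"
  shows "\<exists>a. of_order (2 * real M) (\<lambda>k. f (q powi k) - (\<Sum>n<M. a n * of_real (qpow (2 * real n) k)))"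
proof -
  obtain F where F: "f = restrict F (Rq q)" "\<And>x. F (- x) = F x"
    "\<And>k. (q_deriv q ^^ k) F differentiable (at 0)"
    "\<And>k. \<exists>C. \<forall>x. norm ((q_deriv q ^^ k) F x) \<le> C"
    using assms by (rule q_schwartzE) blast
  obtain a C where C: "\<And>x. norm (F x - (\<Sum>n<2 * M. a n * of_real x ^ n)) \<le> C * \<bar>x\<bar> ^ (2 * M)"
    using taylor_of_inf_q_differentiable[OF F(3,4), of "2 * M"] by blast
  have even_part: "(\<Sum>n<2 * M. a n * of_real x ^ n) + (\<Sum>n<2 * M. a n * of_real (- x) ^ n) = 2 * (\<Sum>n<M. a (2 * n) * of_real x ^ (2 * n))" for x
    by (induction M) (auto simp: algebra_simps)
  have bound: "norm (F x - (\<Sum>n<M. a (2 * n) * of_real x ^ (2 * n))) \<le> C * \<bar>x\<bar> ^ (2 * M)" for x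
  proof -
    let ?G = "\<lambda>x. F x - (\<Sum>n<2 * M. a n * of_real x ^ n)"
    have "?G x + ?G (- x) = 2 * F x - ((\<Sum>n<2 * M. a n * of_real x ^ n) + (\<Sum>n<2 * M. a n * of_real (- x) ^ n))"
      using F(2)[of x] by simp
    also have "\<dots> = 2 * (F x - (\<Sum>n<M. a (2 * n) * of_real x ^ (2 * n)))"
      unfolding even_part by (simp add: right_diff_distrib)
    finally have "2 * norm (F x - (\<Sum>n<M. a (2 * n) * of_real x ^ (2 * n))) = norm (?G x + ?G (- x))"
      by (simp only: norm_mult norm_numeral)
    also have "\<dots> \<le> C * \<bar>x\<bar> ^ (2 * M) + C * \<bar>- x\<bar> ^ (2 * M)"
      by (rule norm_triangle_le[OF add_mono[OF C C]])
    finally show ?thesis by simp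
  qed
  have "of_order (2 * real M) (\<lambda>k. f (q powi k) - (\<Sum>n<M. a (2 * n) * of_real (qpow (2 * real n) k)))"
  proof (rule of_orderI)
    fix k
    have eq: "of_real (q powi k) ^ (2 * n) = complex_of_real (qpow (2 * real n) k)" for n
      unfolding of_real_power[symmetric] q_powi_power by simp
    show "norm (f (q powi k) - (\<Sum>n<M. a (2 * n) * of_real (qpow (2 * real n) k))) \<le> C * q powr (2 * real M * k)"
      using bound[of "q powi k"] unfolding eq abs_of_pos[OF q_powi_pos] q_powi_power by (simp add: F(1))
  qed
  thus ?thesis by (rule exI[of _ "\<lambda>n. a (2 * n)"])
qed

lemma q_schwartz_at_0:
  assumes "f \<in> q_schwartz q"
  shows "(\<lambda>n. f (q powi (int n))) \<longlonglongrightarrow> f 0"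
proof -
  obtain F where F: "f = restrict F (Rq q)" "\<And>k. (q_deriv q ^^ k) F differentiable (at 0)"
    using assms by (rule q_schwartzE) blast
  have "isCont F 0" using F(2)[of 0] by (simp add: differentiable_imp_continuous_within)
  moreover have "(\<lambda>n. q ^ n) \<longlonglongrightarrow> 0" using q_pos q_less_1 by (intro LIMSEQ_power_zero) auto
  ultimately have "(\<lambda>n. F (q ^ n)) \<longlonglongrightarrow> F 0" by (rule isCont_tendsto_compose)
  moreover have "q ^ n \<in> Rq q" for n using q_powi_Rq(1)[of "int n"] by simp
  ultimately show ?thesis by (simp add: F(1))
qed

lemma q_schwartz_even:
  assumes "f \<in> q_schwartz q"
  shows "f (- (q powi k)) = f (q powi k)" "f \<in> extensional (Rq q)"
proof -
  obtain F where F: "f = restrict F (Rq q)" "\<And>x. F (- x) = F x"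
    using assms by (rule q_schwartzE) blast
  show "f (- (q powi k)) = f (q powi k)" "f \<in> extensional (Rq q)"
    unfolding F(1) by (auto simp: F(2))
qed

text \<open>A \<open>q\<close>-Schwartz function is determined by its values at \<open>q\<^sup>k\<close>: the rest of \<open>Rq q\<close> is reached by
evenness and by continuity at 0.\<close>

lemma q_schwartz_eqI:
  assumes f: "f \<in> q_schwartz q" and g: "g \<in> extensional (Rq q)"
    and grid: "\<And>k. g (q powi k) = f (q powi k)" and neg: "\<And>k. g (- (q powi k)) = g (q powi k)"
    and lim: "(\<lambda>n. g (q powi (int n))) \<longlonglongrightarrow> g 0"
  shows "g = f"
proof (rule extensionalityI[OF g q_schwartz_even(2)[OF f]])
  fix x assume "x \<in> Rq q"
  thus "g x = f x"
  proof (cases rule: Rq_cases)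
    case 1
    have "g 0 = f 0"
      using lim q_schwartz_at_0[OF f] unfolding grid by (rule LIMSEQ_unique)
    thus ?thesis using 1 by simp
  next
    case (3 k)
    thus ?thesis using neg[of k] grid[of k] q_schwartz_even(1)[OF f, of k] by simp
  qed (use grid in auto)
qed

lemma jackson_moment:
  "jackson q (\<lambda>x. f x * of_real (x powr (2 * real n + 2 * \<beta> + 1)) :: complex)
     = of_real (1 - q) * moment \<beta> (on_grid f) n"
  unfolding moment_def jackson_weight[symmetric] by (simp add: algebra_simps)

lemma q_schwartz0_iff:
  "f \<in> q_schwartz0 q \<beta> \<longleftrightarrow> f \<in> q_schwartz q \<and> (\<forall>n. moment \<beta> (on_grid f) n = 0)"
  unfolding q_schwartz0_def jackson_moment using q_less_1 by simp

text \<open>Subtract from \<open>s\<close> its expansion at 0.  The transforms of the monomials vanish, and the remainder of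
order \<open>2M\<close> turns into decay of the transform, as the substitution \<open>k \<mapsto> k - m\<close> shows.\<close>

lemma hankel_order_at_infinity:
  assumes "\<beta> > -1" "rapid s"
    and taylor: "of_order (2 * real M) (\<lambda>k. s k - (\<Sum>n<M. a n * of_real (qpow (2 * real n) k)))"
  shows "of_order (- (2 * (\<beta> + real M) + 2)) (hankel \<beta> s)"
proof -
  define r where "r = (\<lambda>k. s k - (\<Sum>n<M. a n * of_real (qpow (2 * real n) k)))"
  obtain C where C: "0 \<le> C" "\<And>k. norm (r k) \<le> C * qpow (2 * real M) k"
    using taylor unfolding r_def[symmetric] by (rule of_orderE) blast
  have sJ: "(\<lambda>k. weight (\<beta> + real n) k * \<bar>J \<beta> (k + m)\<bar>) summable_on UNIV" for n m
  proof -
    have "of_order (2 * (\<beta> + real n) + 2 + e) (\<lambda>k. weight (\<beta> + real n) k * J \<beta> (k + m))" if "e \<le> 0" for e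
      by (rule of_order_mult[OF of_order_powr of_order_shift[OF of_order_J[OF assms(1) that]]])
    from of_order_summable[OF this[of "- (2 * (\<beta> + real n) + 2) - 1"] this[of 0]] assms(1) show ?thesis
      by (simp add: abs_mult)
  qed
  have "norm (hankel \<beta> s m) \<le> (\<bar>amp \<beta>\<bar> * (C * (\<Sum>\<^sub>\<infinity>k. weight (\<beta> + real M) k * \<bar>J \<beta> k\<bar>))) * qpow (- (2 * (\<beta> + real M) + 2)) m" for m
  proof -
    let ?t = "\<lambda>n k. a n * of_real (weight \<beta> k * qpow (2 * real n) k * J \<beta> (k + m))"
    have t: "?t n summable_on UNIV" for n
    proof (rule summable_on_cmult_right, rule dominated_infsum(1)[OF sJ[of n m]])
      show "norm (complex_of_real (weight \<beta> k * qpow (2 * real n) k * J \<beta> (k + m))) \<le> weight (\<beta> + real n) k * \<bar>J \<beta> (k + m)\<bar>" for k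
        unfolding weight_add by (simp add: norm_mult abs_mult)
    qed
    have t0: "(\<Sum>\<^sub>\<infinity>k. ?t n k) = 0" for n
      unfolding infsum_cmult_right' infsum_of_real J_moment[OF assms(1)] by simp
    have bound: "norm (of_real (weight \<beta> k * J \<beta> (k + m)) * r k) \<le> C * (weight (\<beta> + real M) k * \<bar>J \<beta> (k + m)\<bar>)" for k
    proof -
      have "norm (of_real (weight \<beta> k * J \<beta> (k + m)) * r k) = (weight \<beta> k * \<bar>J \<beta> (k + m)\<bar>) * norm (r k)"
        by (simp add: norm_mult abs_mult)
      also have "\<dots> \<le> (weight \<beta> k * \<bar>J \<beta> (k + m)\<bar>) * (C * qpow (2 * real M) k)"
        by (intro mult_left_mono C) simp
      finally show ?thesis unfolding weight_add by (simp only: mult_ac)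
    qed
    have sr: "(\<lambda>k. of_real (weight \<beta> k * J \<beta> (k + m)) * r k) summable_on UNIV"
      by (rule dominated_infsum(1)[OF summable_on_cmult_right[OF sJ] bound])
    have "of_real (weight \<beta> k * J \<beta> (k + m)) * s k
        = of_real (weight \<beta> k * J \<beta> (k + m)) * r k + (\<Sum>n<M. ?t n k)" for k
    proof -
      have "(\<Sum>n<M. ?t n k) = of_real (weight \<beta> k * J \<beta> (k + m)) * (\<Sum>n<M. a n * of_real (qpow (2 * real n) k))"
        unfolding sum_distrib_left by (rule sum.cong[OF refl]) (simp only: of_real_mult mult_ac)
      thus ?thesis by (simp only: r_def right_diff_distrib) simp
    qed
    hence "(\<Sum>\<^sub>\<infinity>k. of_real (weight \<beta> k * J \<beta> (k + m)) * s k)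
        = (\<Sum>\<^sub>\<infinity>k. of_real (weight \<beta> k * J \<beta> (k + m)) * r k) + (\<Sum>\<^sub>\<infinity>k. \<Sum>n<M. ?t n k)"
      by (simp only:) (rule infsum_add[OF sr summable_on_sum_finite], rule finite_lessThan, rule t)
    also have "(\<Sum>\<^sub>\<infinity>k. \<Sum>n<M. ?t n k) = (\<Sum>n<M. \<Sum>\<^sub>\<infinity>k. ?t n k)"
      by (rule infsum_sum_finite) (rule finite_lessThan, rule t)
    also have "\<dots> = 0" unfolding t0 by simp
    finally have h: "hankel \<beta> s m = of_real (amp \<beta>) * (\<Sum>\<^sub>\<infinity>k. of_real (weight \<beta> k * J \<beta> (k + m)) * r k)"
      unfolding hankel_def by simp
    have "norm (\<Sum>\<^sub>\<infinity>k. of_real (weight \<beta> k * J \<beta> (k + m)) * r k) \<le> (\<Sum>\<^sub>\<infinity>k. C * (weight (\<beta> + real M) k * \<bar>J \<beta> (k + m)\<bar>))"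
      by (rule dominated_infsum(2)[OF summable_on_cmult_right[OF sJ] bound])
    also have "\<dots> = (\<Sum>\<^sub>\<infinity>k. (C * qpow (- (2 * (\<beta> + real M) + 2)) m) * (weight (\<beta> + real M) (k + m) * \<bar>J \<beta> (k + m)\<bar>))"
    proof (rule infsum_cong)
      fix k
      have "weight (\<beta> + real M) k = qpow (- (2 * (\<beta> + real M) + 2)) m * weight (\<beta> + real M) (k + m)"
        unfolding powr_add[symmetric] by (simp add: algebra_simps)
      thus "C * (weight (\<beta> + real M) k * \<bar>J \<beta> (k + m)\<bar>)
         = (C * qpow (- (2 * (\<beta> + real M) + 2)) m) * (weight (\<beta> + real M) (k + m) * \<bar>J \<beta> (k + m)\<bar>)"
        by (simp only: mult_ac)
    qed
    also have "\<dots> = (C * qpow (- (2 * (\<beta> + real M) + 2)) m) * (\<Sum>\<^sub>\<infinity>k. weight (\<beta> + real M) k * \<bar>J \<beta> k\<bar>)"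
      unfolding infsum_cmult_right' by (simp only: infsum_shift[of "\<lambda>k. weight (\<beta> + real M) k * \<bar>J \<beta> k\<bar>" m])
    finally have "\<bar>amp \<beta>\<bar> * norm (\<Sum>\<^sub>\<infinity>k. of_real (weight \<beta> k * J \<beta> (k + m)) * r k)
        \<le> \<bar>amp \<beta>\<bar> * ((C * qpow (- (2 * (\<beta> + real M) + 2)) m) * (\<Sum>\<^sub>\<infinity>k. weight (\<beta> + real M) k * \<bar>J \<beta> k\<bar>))"
      by (rule mult_left_mono) simp
    thus ?thesis unfolding h norm_mult norm_of_real by (simp only: mult_ac)
  qed
  thus ?thesis by (rule of_orderI)
qed

text \<open>Near 0 the expansion of the transform consists of moments, all of which vanish; at infinity the
smoothness of \<open>f\<close> at 0 gives the decay.\<close>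

theorem hankel_q_schwartz0_flat:
  assumes "\<beta> > -1" "f \<in> q_schwartz0 q \<beta>"
  shows "flat (hankel \<beta> (on_grid f))"
  unfolding flat_def
proof
  fix e :: real
  have f: "f \<in> q_schwartz q" "\<And>n. moment \<beta> (on_grid f) n = 0"
    using assms(2) by (auto simp: q_schwartz0_iff)
  have r: "rapid (on_grid f)" by (rule q_schwartz_rapid[OF f(1)])
  have up: "of_order (2 * real M) (hankel \<beta> (on_grid f))" for M
    using hankel_taylor[OF assms(1) r, of M] unfolding f(2) by (simp add: of_order_def)
  have down: "of_order (- (2 * (\<beta> + real M) + 2)) (hankel \<beta> (on_grid f))" for M
    using q_schwartz_taylor[OF f(1), of M] hankel_order_at_infinity[OF assms(1) r] by blast
  have "\<bar>e\<bar> \<le> real (nat \<lceil>\<bar>e\<bar>\<rceil>)" by linarith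
  hence "e \<le> 2 * real (nat \<lceil>\<bar>e\<bar>\<rceil>)" "- (2 * (\<beta> + real (nat \<lceil>\<bar>e\<bar>\<rceil>)) + 2) \<le> e"
    using assms(1) unfolding abs_le_iff distrib_left by linarith+
  thus "of_order e (hankel \<beta> (on_grid f))" using of_order_between[OF down up] by blast
qed

lemma rapid_hankel:
  assumes "\<beta> > -1" "flat \<psi>"
  shows "rapid (hankel \<beta> \<psi>)"
  using q_schwartz_rapid[OF restrict_tame_in_q_schwartz[OF tame_hankel_ext[OF assms] hankel_ext_even]]
  by (simp add: hankel_ext_grid)

text \<open>The transform of \<open>u = hankel \<beta> \<psi>\<close> is a multiple of \<open>\<psi>\<close> and hence flat at 0.  Its expansion at 0 has
the moments of \<open>u\<close> as coefficients, so that the first nonvanishing moment would contradict flatness.\<close>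

lemma moment_hankel_flat:
  assumes "\<beta> > -1" "flat \<psi>"
  shows "moment \<beta> (hankel \<beta> \<psi>) n = 0"
proof (induction n rule: less_induct)
  case (less n)
  define u where "u = hankel \<beta> \<psi>"
  have u: "rapid u" unfolding u_def by (rule rapid_hankel[OF assms])
  \<comment> \<open>The coefficient of \<open>x\<^bsup>2n\<^esup>\<close>; by induction those of lower degree vanish, so it is \<open>O(q\<^bsup>2m\<^esup>)\<close> for every \<open>m\<close>.\<close>
  let ?z = "of_real (amp \<beta>) * (of_real (bessel_coeff \<beta> n) * moment \<beta> u n)"
  obtain C where C: "\<And>m. norm (hankel \<beta> u m - of_real (amp \<beta>) * (\<Sum>i<Suc n. of_real (bessel_coeff \<beta> i * qpow (2 * real i) m) * moment \<beta> u i))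
      \<le> C * qpow (2 * real (Suc n)) m"
    using hankel_taylor[OF assms(1) u, of "Suc n"] by blast
  have hu: "hankel \<beta> u m = of_real (q powr (4 * \<beta> + 2)) * \<psi> m" for m
    unfolding u_def by (rule hankel_inversion[OF assms(1) rapid_l1[OF flat_rapid[OF assms(2)] assms(1)]])
  have "of_order (2 * real (Suc n)) \<psi>" using assms(2) by (simp add: flat_def)
  then obtain D where D: "\<And>m. norm (\<psi> m) \<le> D * qpow (2 * real (Suc n)) m"
    by (rule of_orderE) blast
  have "norm ?z \<le> (C + q powr (4 * \<beta> + 2) * D) * (q\<^sup>2) ^ m" for m :: nat
  proof -
    let ?qm = "q powr (2 * real n * real m)"
    have "(\<Sum>i<Suc n. of_real (bessel_coeff \<beta> i * qpow (2 * real i) (int m)) * moment \<beta> u i)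
        = of_real (bessel_coeff \<beta> n * ?qm) * moment \<beta> u n"
      using less.IH by (simp add: u_def)
    hence "norm (hankel \<beta> u (int m) - ?z * of_real ?qm) \<le> C * q powr (2 * real (Suc n) * real m)"
      using C[of "int m"] by (simp add: mult_ac)
    moreover have "norm (hankel \<beta> u (int m)) \<le> q powr (4 * \<beta> + 2) * (D * q powr (2 * real (Suc n) * real m))"
      unfolding hu norm_mult using D[of "int m"] by (auto intro!: mult_left_mono)
    ultimately have "norm (?z * of_real ?qm) \<le> C * q powr (2 * real (Suc n) * real m) + q powr (4 * \<beta> + 2) * (D * q powr (2 * real (Suc n) * real m))"
      using norm_triangle_sub[of "?z * of_real ?qm" "hankel \<beta> u (int m)"] by (simp add: norm_minus_commute)
    also have "q powr (2 * real (Suc n) * real m) = ?qm * (q\<^sup>2) ^ m"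
    proof -
      have "(q\<^sup>2) ^ m = q powr (2 * real m)" using powi_q2[of "int m"] by (simp only: power_int_of_nat of_int_of_nat_eq)
      thus ?thesis by (simp add: powr_add[symmetric] algebra_simps)
    qed
    also have "C * (?qm * (q\<^sup>2) ^ m) + q powr (4 * \<beta> + 2) * (D * (?qm * (q\<^sup>2) ^ m)) = ((C + q powr (4 * \<beta> + 2) * D) * (q\<^sup>2) ^ m) * ?qm"
      by (simp add: algebra_simps)
    finally have "norm ?z * ?qm \<le> ((C + q powr (4 * \<beta> + 2) * D) * (q\<^sup>2) ^ m) * ?qm"
      unfolding norm_mult by simp
    thus ?thesis using q_pos by (simp only: mult_le_cancel_right_pos powr_gt_zero[THEN iffD2])
  qed
  moreover have "(\<lambda>m. (C + q powr (4 * \<beta> + 2) * D) * (q\<^sup>2) ^ m) \<longlonglongrightarrow> (C + q powr (4 * \<beta> + 2) * D) * 0"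
    using base.p_pos base.p_less_1 by (intro tendsto_intros) auto
  ultimately have "norm ?z \<le> 0" using LIMSEQ_le_const by fastforce
  hence "?z = 0" by simp
  thus ?case using amp_pos[OF assms(1)] bessel_coeff_nonzero[OF assms(1), of n] by (simp add: u_def)
qed

theorem hankel_ext_in_q_schwartz0:
  assumes "\<beta> > -1" "flat \<psi>"
  shows "restrict (hankel_ext \<beta> \<psi>) (Rq q) \<in> q_schwartz0 q \<beta>"
  using moment_hankel_flat[OF assms] restrict_tame_in_q_schwartz[OF tame_hankel_ext[OF assms] hankel_ext_even]
  by (simp add: q_schwartz0_iff hankel_ext_grid)

end

section \<open>The q-Riemann-Liouville and q-Weyl transforms\<close>

text \<open>Here \<open>\<gamma> = -1/2\<close> is the index of the cosine transform.\<close>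

locale q_grid_index = q_grid +
  fixes \<alpha> :: real
  assumes \<alpha>_gt: "-1/2 < \<alpha>"
begin

abbreviation "\<gamma> \<equiv> (-1/2 :: real)"

lemma \<alpha>_gt_m1: "-1 < \<alpha>" and \<gamma>_gt_m1: "-1 < \<gamma>"
  using \<alpha>_gt by auto

text \<open>The Riemann-Liouville kernel at the node \<open>t = q\<^sup>j\<close>.  The Weyl kernel at \<open>t = x q\<^bsup>-j\<^esup>\<close> has the same value.\<close>

definition rl_coeff :: "nat \<Rightarrow> real" where
  "rl_coeff j = qpoch_inf ((q ^ j)\<^sup>2 * q\<^sup>2) (q\<^sup>2) / qpoch_inf ((q ^ j)\<^sup>2 * q powr (2 * \<alpha> + 1)) (q\<^sup>2)"

lemma sqr_power: "(q ^ j)\<^sup>2 = (q\<^sup>2) ^ j"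
  by (simp add: power_mult[symmetric] mult.commute)

lemma weyl_parameter_bounds: "0 < q powr (2 * \<alpha> + 1)" "q powr (2 * \<alpha> + 1) < 1"
  using q_powr_less_1[of "2 * \<alpha> + 1"] \<alpha>_gt q_pos by auto

lemma rl_coeff_eq:
  "rl_coeff j = qpoch_inf (q\<^sup>2) (q\<^sup>2) / qpoch_inf (q powr (2 * \<alpha> + 1)) (q\<^sup>2)
      * (qpoch (q powr (2 * \<alpha> + 1)) (q\<^sup>2) j / qpoch (q\<^sup>2) (q\<^sup>2) j)"
proof -
  have "qpoch_inf (q\<^sup>2) (q\<^sup>2) = qpoch (q\<^sup>2) (q\<^sup>2) j * qpoch_inf ((q ^ j)\<^sup>2 * q\<^sup>2) (q\<^sup>2)"
    unfolding sqr_power using base.qpoch_inf_split[of "q\<^sup>2" j] by (simp add: mult.commute)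
  moreover have "qpoch_inf (q powr (2 * \<alpha> + 1)) (q\<^sup>2)
      = qpoch (q powr (2 * \<alpha> + 1)) (q\<^sup>2) j * qpoch_inf ((q ^ j)\<^sup>2 * q powr (2 * \<alpha> + 1)) (q\<^sup>2)"
    unfolding sqr_power using base.qpoch_inf_split[of "q powr (2 * \<alpha> + 1)" j] by (simp add: mult.commute)
  moreover have "qpoch (q\<^sup>2) (q\<^sup>2) j > 0" "qpoch (q powr (2 * \<alpha> + 1)) (q\<^sup>2) j > 0"
    using base.qpoch_pos base.p_less_1 weyl_parameter_bounds by auto
  ultimately show ?thesis unfolding rl_coeff_def by simp
qed

lemma rl_coeff_tendsto: "rl_coeff \<longlonglongrightarrow> 1"
proof -
  let ?P = "qpoch_inf (q\<^sup>2) (q\<^sup>2)" and ?A = "qpoch_inf (q powr (2 * \<alpha> + 1)) (q\<^sup>2)"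
  have pos: "0 < ?P" "0 < ?A"
    using qpoch_inf_q2_q2_pos qpoch_inf_q2_pos[of "2 * \<alpha> + 1"] \<alpha>_gt by auto
  have "(\<lambda>j. ?P / ?A * (qpoch (q powr (2 * \<alpha> + 1)) (q\<^sup>2) j / qpoch (q\<^sup>2) (q\<^sup>2) j)) \<longlonglongrightarrow> ?P / ?A * (?A / ?P)"
    using pos by (intro tendsto_intros base.qpoch_LIMSEQ) auto
  thus ?thesis unfolding rl_coeff_eq[symmetric] using pos by simp
qed

lemma rl_coeff_bounded:
  obtains B where "0 \<le> B" "\<And>j. \<bar>rl_coeff j\<bar> \<le> B"
proof -
  have "Bseq rl_coeff" by (rule convergent_imp_Bseq[OF convergentI[OF rl_coeff_tendsto]])
  then obtain K where "0 < K" "\<forall>j. norm (rl_coeff j) \<le> K" by (rule BseqE)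
  thus ?thesis by (intro that[of K]) auto
qed

lemma rl_coeff_summable: "(\<lambda>j. q ^ j * \<bar>rl_coeff j\<bar>) summable_on UNIV"
proof -
  obtain B where B: "0 \<le> B" "\<And>j. \<bar>rl_coeff j\<bar> \<le> B" using rl_coeff_bounded by blast
  have "(\<lambda>j. q ^ j * B) summable_on UNIV"
    by (rule infsum_eq_suminf(1)) (use q_pos q_less_1 in \<open>simp add: abs_mult summable_mult2 summable_geometric\<close>)
  thus ?thesis
    by (rule dominated_infsum(1)) (use B q_pos in \<open>simp add: abs_mult mult_left_mono\<close>)
qed

text \<open>The normalising factor of the transform together with the \<open>1 - q\<close> of the Jackson integral;
likewise for \<open>weyl_const\<close>.\<close>

definition rl_const :: real where
  "rl_const = (1 + q) * q_Gamma (q\<^sup>2) (\<alpha> + 1) / (q_Gamma (q\<^sup>2) (1 / 2) * q_Gamma (q\<^sup>2) (\<alpha> + 1 / 2)) * (1 - q)"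

lemma rl_const_eq:
  "rl_const * (qpoch_inf (q\<^sup>2) (q\<^sup>2) / qpoch_inf (q powr (2 * \<alpha> + 1)) (q\<^sup>2))
     = qpoch_inf q (q\<^sup>2) / qpoch_inf (q powr (2 * \<alpha> + 2)) (q\<^sup>2)"
proof -
  define P A Q W e where "P = qpoch_inf (q\<^sup>2) (q\<^sup>2)" and "A = qpoch_inf (q powr (2 * \<alpha> + 1)) (q\<^sup>2)"
    and "Q = qpoch_inf q (q\<^sup>2)" and "W = qpoch_inf (q powr (2 * \<alpha> + 2)) (q\<^sup>2)" and "e = 1 - q\<^sup>2"
  have pos: "0 < P" "0 < A" "0 < Q" "0 < W" "0 < e"
    using qpoch_inf_q2_q2_pos qpoch_inf_q2_pos[of "2 * \<alpha> + 1"] qpoch_inf_q2_pos[of 1] qpoch_inf_q2_pos[of "2 * \<alpha> + 2"]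
      \<alpha>_gt q_pos one_minus_q2_pos by (auto simp: P_def A_def Q_def W_def e_def)
  have "q_Gamma (q\<^sup>2) (\<alpha> + 1) = P / W * e powr (- \<alpha>)"
    unfolding q_Gamma_q2 P_def W_def e_def by (simp add: algebra_simps)
  moreover have "q_Gamma (q\<^sup>2) (1 / 2) = P / Q * e powr (1 / 2)"
    unfolding q_Gamma_q2 P_def Q_def e_def using q_pos by simp
  moreover have "q_Gamma (q\<^sup>2) (\<alpha> + 1 / 2) = P / A * e powr (1 / 2 - \<alpha>)"
    unfolding q_Gamma_q2 P_def A_def e_def by (simp add: algebra_simps)
  moreover have "e powr (1 / 2) * e powr (1 / 2 - \<alpha>) = e * e powr (- \<alpha>)"
  proof -
    have "e powr (1 / 2) * e powr (1 / 2 - \<alpha>) = e powr (1 + - \<alpha>)" by (simp add: powr_add[symmetric])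
    also have "\<dots> = e * e powr (- \<alpha>)" unfolding powr_add using pos by simp
    finally show ?thesis .
  qed
  moreover have "(1 + q) * (P / W * E) / ((P / Q * h) * (P / A * g)) * (1 - q) * (P / A) = (1 + q) * (1 - q) / e * (Q / W)"
    if "0 < E" "0 < h" "0 < g" "h * g = e * E" for E h g
  proof -
    have "(1 + q) * (P / W * E) / ((P / Q * h) * (P / A * g)) * (1 - q) * (P / A)
        = (1 + q) * (1 - q) * (E / (h * g)) * (Q / W)"
      using pos that(1-3) by (simp add: field_simps)
    thus ?thesis unfolding that(4) using that(1) by simp
  qed
  ultimately have "rl_const * (P / A) = (1 + q) * (1 - q) / e * (Q / W)"
    unfolding rl_const_def using pos by simp
  also have "(1 + q) * (1 - q) / e = 1"
    using pos unfolding e_def by (simp add: power2_eq_square algebra_simps)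
  finally show ?thesis by (simp add: P_def A_def Q_def W_def)
qed

text \<open>The \<open>q\<close>-beta integral of \<open>t\<^bsup>2n\<^esup>\<close>, evaluated by the \<open>q\<close>-binomial theorem, turns the \<open>n\<close>-th coefficient of
\<open>j\<^sub>-\<^sub>1\<^sub>/\<^sub>2\<close> into that of \<open>j\<^sub>\<alpha>\<close>.\<close>

lemma rl_coeff_bessel:
  "rl_const * (\<Sum>\<^sub>\<infinity>j. q ^ j * rl_coeff j * (q ^ j) ^ (2 * n)) * bessel_coeff \<gamma> n = bessel_coeff \<alpha> n"
proof -
  define a where "a = q powr (2 * \<alpha> + 1)"
  define w where "w = q powr (2 * \<alpha> + 2)"
  define P where "P = qpoch_inf (q\<^sup>2) (q\<^sup>2)"
  define A where "A = qpoch_inf a (q\<^sup>2)"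
  define z where "z = q * (q\<^sup>2) ^ n"
  define b where "b = (\<lambda>j. qpoch a (q\<^sup>2) j / qpoch (q\<^sup>2) (q\<^sup>2) j)"
  have a: "0 < a" "a < 1" using weyl_parameter_bounds by (auto simp: a_def)
  have z: "0 < z" "z < 1"
  proof -
    have "q * (q\<^sup>2) ^ n \<le> q * 1" using q_pos q_less_1 by (intro mult_left_mono power_le_one) auto
    thus "z < 1" using q_less_1 by (simp add: z_def)
  qed (use q_pos in \<open>simp add: z_def\<close>)
  have b0: "0 \<le> b j" for j
    unfolding b_def using base.qpoch_pos[of a j] base.qpoch_pos[of "q\<^sup>2" j] a base.p_less_1 by simp
  have az: "a * z = w * (q\<^sup>2) ^ n"
  proof -
    have "a * q = w" unfolding a_def w_def using q_pos powr_add[of q "2 * \<alpha> + 1" 1] by (simp add: add.commute)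
    thus ?thesis by (simp add: z_def mult.assoc[symmetric])
  qed
  have "(\<Sum>\<^sub>\<infinity>j. q ^ j * rl_coeff j * (q ^ j) ^ (2 * n)) = (\<Sum>\<^sub>\<infinity>j. P / A * (b j * z ^ j))"
  proof (rule infsum_cong)
    fix j
    have "q ^ j * (q ^ j) ^ (2 * n) = z ^ j"
      by (simp add: z_def power_mult_distrib power_mult[symmetric] mult_ac)
    thus "q ^ j * rl_coeff j * (q ^ j) ^ (2 * n) = P / A * (b j * z ^ j)"
      unfolding rl_coeff_eq b_def P_def A_def a_def by (simp add: mult_ac)
  qed
  also have "\<dots> = P / A * (\<Sum>j. b j * z ^ j)"
  proof -
    have "summable (\<lambda>j. b j * z ^ j)" unfolding b_def by (rule base.summable_q_binomial) (use z in auto)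
    hence "(\<Sum>\<^sub>\<infinity>j. b j * z ^ j) = (\<Sum>j. b j * z ^ j)"
      using z b0 by (intro infsum_eq_suminf(2)) simp
    thus ?thesis by (simp only: infsum_cmult_right')
  qed
  also have "(\<Sum>j. b j * z ^ j) = qpoch_inf (w * (q\<^sup>2) ^ n) (q\<^sup>2) / qpoch_inf z (q\<^sup>2)"
    unfolding b_def az[symmetric] by (rule base.q_binomial_theorem) (use z in auto)
  finally have "rl_const * (\<Sum>\<^sub>\<infinity>j. q ^ j * rl_coeff j * (q ^ j) ^ (2 * n))
      = (rl_const * (P / A)) * (qpoch_inf (w * (q\<^sup>2) ^ n) (q\<^sup>2) / qpoch_inf z (q\<^sup>2))"
    by simp
  also have "rl_const * (P / A) = qpoch_inf q (q\<^sup>2) / qpoch_inf w (q\<^sup>2)"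
    using rl_const_eq by (simp add: P_def A_def a_def w_def)
  also have "qpoch_inf q (q\<^sup>2) / qpoch_inf w (q\<^sup>2) * (qpoch_inf (w * (q\<^sup>2) ^ n) (q\<^sup>2) / qpoch_inf z (q\<^sup>2))
      = qpoch q (q\<^sup>2) n / qpoch w (q\<^sup>2) n"
  proof -
    have "qpoch_inf q (q\<^sup>2) = qpoch q (q\<^sup>2) n * qpoch_inf z (q\<^sup>2)"
      unfolding z_def by (rule base.qpoch_inf_split)
    moreover have "qpoch_inf w (q\<^sup>2) = qpoch w (q\<^sup>2) n * qpoch_inf (w * (q\<^sup>2) ^ n) (q\<^sup>2)"
      by (rule base.qpoch_inf_split)
    moreover have "qpoch_inf z (q\<^sup>2) > 0" using z by (intro base.qpoch_inf_pos)
    moreover have "qpoch_inf w (q\<^sup>2) > 0" unfolding w_def using \<alpha>_gt by (intro qpoch_inf_q2_pos) auto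
    ultimately show ?thesis by auto
  qed
  finally show ?thesis
    using base.qpoch_pos[OF q_less_1, of n] q_pos unfolding bessel_coeff_def w_def by simp
qed

lemma J_series:
  assumes "\<beta> > -1"
  shows "(\<lambda>n. \<bar>bessel_coeff \<beta> n\<bar> * (q powi k) ^ (2 * n)) summable_on UNIV"
    and "J \<beta> k = (\<Sum>\<^sub>\<infinity>n. bessel_coeff \<beta> n * (q powi k) ^ (2 * n))"
proof -
  have s: "summable (\<lambda>n. \<bar>bessel_coeff \<beta> n * (q powi k) ^ (2 * n)\<bar>)" by (rule q_bessel_j_series(1)[OF assms])
  show "(\<lambda>n. \<bar>bessel_coeff \<beta> n\<bar> * (q powi k) ^ (2 * n)) summable_on UNIV"
    by (rule infsum_eq_suminf(1)) (use s q_powi_pos[of k] in \<open>simp add: abs_mult\<close>)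
  show "J \<beta> k = (\<Sum>\<^sub>\<infinity>n. bessel_coeff \<beta> n * (q powi k) ^ (2 * n))"
    unfolding q_bessel_j_series(2)[OF assms] by (rule infsum_eq_suminf(2)[symmetric]) (use s in simp)
qed

lemma rl_bessel: "rl_const * (\<Sum>\<^sub>\<infinity>j. q ^ j * rl_coeff j * J \<gamma> (k + int j)) = J \<alpha> k"
proof -
  have pw: "(q powi (k + int j)) ^ (2 * n) = (q powi k) ^ (2 * n) * (q ^ j) ^ (2 * n)" for j n
    using q_pos by (simp add: power_int_add power_mult_distrib)
  have "(\<Sum>\<^sub>\<infinity>j. q ^ j * rl_coeff j * J \<gamma> (k + int j))
      = (\<Sum>\<^sub>\<infinity>j. \<Sum>\<^sub>\<infinity>n. (q ^ j * rl_coeff j) * (bessel_coeff \<gamma> n * (q powi (k + int j)) ^ (2 * n)))"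
    unfolding J_series(2)[OF \<gamma>_gt_m1] infsum_cmult_right' by (rule refl)
  also have "\<dots> = (\<Sum>\<^sub>\<infinity>n. \<Sum>\<^sub>\<infinity>j. (q ^ j * rl_coeff j) * (bessel_coeff \<gamma> n * (q powi (k + int j)) ^ (2 * n)))"
  proof (rule infsum_swap_product_bound[OF rl_coeff_summable J_series(1)[OF \<gamma>_gt_m1, of k]])
    fix j n :: nat
    have "(q ^ j) ^ (2 * n) \<le> 1" using q_pos q_less_1 by (intro power_le_one) auto
    hence "(q powi k) ^ (2 * n) * (q ^ j) ^ (2 * n) \<le> (q powi k) ^ (2 * n)"
      using q_powi_pos[of k] by (intro mult_left_le) auto
    hence "(q ^ j * \<bar>rl_coeff j\<bar>) * (\<bar>bessel_coeff \<gamma> n\<bar> * ((q powi k) ^ (2 * n) * (q ^ j) ^ (2 * n)))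
       \<le> (q ^ j * \<bar>rl_coeff j\<bar>) * (\<bar>bessel_coeff \<gamma> n\<bar> * (q powi k) ^ (2 * n))"
      using q_pos by (intro mult_left_mono) auto
    thus "norm ((q ^ j * rl_coeff j) * (bessel_coeff \<gamma> n * (q powi (k + int j)) ^ (2 * n)))
       \<le> (q ^ j * \<bar>rl_coeff j\<bar>) * (\<bar>bessel_coeff \<gamma> n\<bar> * (q powi k) ^ (2 * n))"
      unfolding pw using q_pos q_powi_pos[of k] by (simp add: abs_mult)
  qed (use q_pos q_powi_pos[of k] in auto)
  also have "\<dots> = (\<Sum>\<^sub>\<infinity>n. (\<Sum>\<^sub>\<infinity>j. q ^ j * rl_coeff j * (q ^ j) ^ (2 * n)) * (bessel_coeff \<gamma> n * (q powi k) ^ (2 * n)))"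
  proof (rule infsum_cong)
    fix n
    have "(q ^ j * rl_coeff j) * (bessel_coeff \<gamma> n * (q powi (k + int j)) ^ (2 * n))
      = (q ^ j * rl_coeff j * (q ^ j) ^ (2 * n)) * (bessel_coeff \<gamma> n * (q powi k) ^ (2 * n))" for j
      unfolding pw by simp
    thus "(\<Sum>\<^sub>\<infinity>j. (q ^ j * rl_coeff j) * (bessel_coeff \<gamma> n * (q powi (k + int j)) ^ (2 * n)))
      = (\<Sum>\<^sub>\<infinity>j. q ^ j * rl_coeff j * (q ^ j) ^ (2 * n)) * (bessel_coeff \<gamma> n * (q powi k) ^ (2 * n))"
      by (simp only: infsum_cmult_left')
  qed
  finally have eq: "(\<Sum>\<^sub>\<infinity>j. q ^ j * rl_coeff j * J \<gamma> (k + int j))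
      = (\<Sum>\<^sub>\<infinity>n. (\<Sum>\<^sub>\<infinity>j. q ^ j * rl_coeff j * (q ^ j) ^ (2 * n)) * (bessel_coeff \<gamma> n * (q powi k) ^ (2 * n)))" .
  have "rl_const * (\<Sum>\<^sub>\<infinity>n. (\<Sum>\<^sub>\<infinity>j. q ^ j * rl_coeff j * (q ^ j) ^ (2 * n)) * (bessel_coeff \<gamma> n * (q powi k) ^ (2 * n)))
      = (\<Sum>\<^sub>\<infinity>n. (rl_const * (\<Sum>\<^sub>\<infinity>j. q ^ j * rl_coeff j * (q ^ j) ^ (2 * n)) * bessel_coeff \<gamma> n) * (q powi k) ^ (2 * n))"
    by (subst infsum_cmult_right'[symmetric]) (simp only: mult.assoc)
  thus ?thesis unfolding eq rl_coeff_bessel J_series(2)[OF \<alpha>_gt_m1, of k] .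
qed

definition rl :: "(int \<Rightarrow> complex) \<Rightarrow> int \<Rightarrow> complex" where
  "rl f k = of_real rl_const * (\<Sum>\<^sub>\<infinity>j. of_real (q ^ j * rl_coeff j) * f (k + int j))"

lemma q_riemann_liouville_eq:
  assumes "x \<in> Rq q"
  shows "q_riemann_liouville q \<alpha> f x = of_real rl_const * (\<Sum>\<^sub>\<infinity>j. of_real (q ^ j * rl_coeff j) * f (x * q ^ j))"
proof -
  have "jackson_to q 1 (\<lambda>t. of_real (qpoch_inf (t\<^sup>2 * q\<^sup>2) (q\<^sup>2) / qpoch_inf (t\<^sup>2 * q powr (2 * \<alpha> + 1)) (q\<^sup>2)) * f (x * t))
      = of_real (1 - q) * (\<Sum>\<^sub>\<infinity>j. of_real (q ^ j * rl_coeff j) * f (x * q ^ j))"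
    unfolding jackson_to_def rl_coeff_def by (simp add: scaleR_conv_of_real mult_ac)
  thus ?thesis using assms unfolding q_riemann_liouville_def rl_const_def by simp
qed

lemma q_riemann_liouville_grid: "q_riemann_liouville q \<alpha> f (q powi k) = rl (on_grid f) k"
  unfolding rl_def q_riemann_liouville_eq[OF q_powi_Rq(1)] using q_pos by (simp add: power_int_add)

lemma rl_bessel_superposition:
  assumes "(\<lambda>m. norm (\<psi> m)) summable_on UNIV"
  shows "rl (\<lambda>k. \<Sum>\<^sub>\<infinity>m. of_real (J \<gamma> (m + k)) * \<psi> m) k = (\<Sum>\<^sub>\<infinity>m. of_real (J \<alpha> (m + k)) * \<psi> m)"
proof -
  obtain C where C: "0 \<le> C" "\<And>k. \<bar>J \<gamma> k\<bar> \<le> C" using J_bounded[OF \<gamma>_gt_m1] by blast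
  have "(\<Sum>\<^sub>\<infinity>j. of_real (q ^ j * rl_coeff j) * (\<Sum>\<^sub>\<infinity>m. of_real (J \<gamma> (m + (k + int j))) * \<psi> m))
      = (\<Sum>\<^sub>\<infinity>j. \<Sum>\<^sub>\<infinity>m. of_real (q ^ j * rl_coeff j * J \<gamma> (m + k + int j)) * \<psi> m)"
    unfolding infsum_cmult_right'[symmetric] by (simp add: add.assoc mult.assoc)
  also have "\<dots> = (\<Sum>\<^sub>\<infinity>m. \<Sum>\<^sub>\<infinity>j. of_real (q ^ j * rl_coeff j * J \<gamma> (m + k + int j)) * \<psi> m)"
  proof (rule infsum_swap_product_bound[OF summable_on_cmult_right[OF rl_coeff_summable] assms])
    fix j :: nat and m :: int
    have "q ^ j * \<bar>rl_coeff j\<bar> * norm (\<psi> m) * \<bar>J \<gamma> (m + k + int j)\<bar> \<le> q ^ j * \<bar>rl_coeff j\<bar> * norm (\<psi> m) * C"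
      using q_pos by (intro mult_left_mono C) auto
    thus "norm (of_real (q ^ j * rl_coeff j * J \<gamma> (m + k + int j)) * \<psi> m) \<le> C * (q ^ j * \<bar>rl_coeff j\<bar>) * norm (\<psi> m)"
      unfolding norm_mult norm_of_real abs_mult using q_pos by (simp add: mult_ac)
  qed (use q_pos C in auto)
  also have "\<dots> = (\<Sum>\<^sub>\<infinity>m. of_real (\<Sum>\<^sub>\<infinity>j. q ^ j * rl_coeff j * J \<gamma> (m + k + int j)) * \<psi> m)"
    unfolding infsum_cmult_left' infsum_of_real by (rule refl)
  finally have eq: "(\<Sum>\<^sub>\<infinity>j. of_real (q ^ j * rl_coeff j) * (\<Sum>\<^sub>\<infinity>m. of_real (J \<gamma> (m + (k + int j))) * \<psi> m))
      = (\<Sum>\<^sub>\<infinity>m. of_real (\<Sum>\<^sub>\<infinity>j. q ^ j * rl_coeff j * J \<gamma> (m + k + int j)) * \<psi> m)" .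
  have "of_real rl_const * (\<Sum>\<^sub>\<infinity>m. of_real (\<Sum>\<^sub>\<infinity>j. q ^ j * rl_coeff j * J \<gamma> (m + k + int j)) * \<psi> m)
      = (\<Sum>\<^sub>\<infinity>m. of_real (rl_const * (\<Sum>\<^sub>\<infinity>j. q ^ j * rl_coeff j * J \<gamma> (m + k + int j))) * \<psi> m)"
    by (subst infsum_cmult_right'[symmetric]) (simp only: of_real_mult mult.assoc)
  thus ?thesis unfolding rl_def eq rl_bessel .
qed

lemma weight_\<gamma>: "weight \<gamma> k = weight \<alpha> k * qpow (- (2 * \<alpha> + 1)) k"
  unfolding powr_add[symmetric] by (simp add: algebra_simps)

text \<open>The Riemann-Liouville transform replaces the kernel \<open>j\<^sub>-\<^sub>1\<^sub>/\<^sub>2\<close> by \<open>j\<^sub>\<alpha>\<close>; the power of \<open>q\<^sup>m\<close> adjusts the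
weights of the two transforms.\<close>

lemma rl_hankel:
  assumes "flat \<psi>"
  shows "rl (hankel \<gamma> \<psi>) k = of_real (amp \<gamma> / amp \<alpha>) * hankel \<alpha> (\<lambda>m. of_real (qpow (- (2 * \<alpha> + 1)) m) * \<psi> m) k"
proof -
  have "(\<lambda>m. norm (of_real (amp \<gamma> * weight \<gamma> m) * \<psi> m)) summable_on UNIV"
    using summable_on_cmult_right[OF flat_weighted_summable[OF assms, of "2 * \<gamma> + 2"], of "\<bar>amp \<gamma>\<bar>"]
    unfolding norm_mult norm_of_real abs_mult mult.assoc abs_of_nonneg[OF powr_ge_zero] .
  from rl_bessel_superposition[OF this, of k]
  have "rl (hankel \<gamma> \<psi>) k = (\<Sum>\<^sub>\<infinity>m. of_real (J \<alpha> (m + k)) * (of_real (amp \<gamma> * weight \<gamma> m) * \<psi> m))"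
    unfolding hankel_def infsum_cmult_right'[symmetric] of_real_mult by (simp only: mult_ac)
  also have "\<dots> = of_real (amp \<gamma> / amp \<alpha>) * hankel \<alpha> (\<lambda>m. of_real (qpow (- (2 * \<alpha> + 1)) m) * \<psi> m) k"
    unfolding hankel_def infsum_cmult_right'[symmetric] weight_\<gamma>
    using amp_pos[OF \<alpha>_gt_m1] by (simp add: mult_ac)
  finally show ?thesis .
qed

definition weyl_const :: real where
  "weyl_const = q * (1 + 1 / q) powr (- \<alpha> + 1 / 2) / q_Gamma (q\<^sup>2) (\<alpha> + 1 / 2) * (1 - q)"

definition weyl :: "(int \<Rightarrow> complex) \<Rightarrow> int \<Rightarrow> complex" where
  "weyl f k = of_real weyl_const * (\<Sum>\<^sub>\<infinity>j. of_real (qpow (2 * \<alpha> + 1) (k - int j) * rl_coeff j) * f (k - int j))"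

text \<open>The Weyl transform is the adjoint of the Riemann-Liouville transform for the two weights only up to a
constant.  This identity makes the constants cancel in \<open>hankel_weyl\<close>.\<close>

lemma amp_weyl_const: "amp \<gamma> * weyl_const = rl_const * amp \<alpha>"
proof -
  let ?h = "1 + 1 / q"
  have h: "0 < ?h" using q_pos by (simp add: add_pos_pos)
  have G: "0 < q_Gamma (q\<^sup>2) (1 / 2)" "0 < q_Gamma (q\<^sup>2) (\<alpha> + 1 / 2)" "0 < q_Gamma (q\<^sup>2) (\<alpha> + 1)"
    using \<alpha>_gt by (auto intro!: q_Gamma_q2_pos)
  have "?h powr (1 / 2) * ?h powr (- \<alpha> + 1 / 2) = ?h powr (1 + - \<alpha>)" unfolding powr_add[symmetric] by simp
  also have "\<dots> = ?h * ?h powr (- \<alpha>)" unfolding powr_add using h by simp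
  finally have "q * (?h powr (1 / 2) * ?h powr (- \<alpha> + 1 / 2)) = (1 + q) * ?h powr (- \<alpha>)"
    using q_pos by (simp add: field_simps)
  moreover have "amp \<gamma> * weyl_const = (q * (?h powr (1 / 2) * ?h powr (- \<alpha> + 1 / 2)))
      * (1 - q) * (1 - q) / (q_Gamma (q\<^sup>2) (1 / 2) * q_Gamma (q\<^sup>2) (\<alpha> + 1 / 2))"
    unfolding amp_def q_const_def weyl_const_def by simp
  moreover have "rl_const * amp \<alpha> = ((1 + q) * ?h powr (- \<alpha>)) * (1 - q) * (1 - q) / (q_Gamma (q\<^sup>2) (1 / 2) * q_Gamma (q\<^sup>2) (\<alpha> + 1 / 2))"
    unfolding amp_def q_const_def rl_const_def using G by simp
  ultimately show ?thesis by simp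
qed

abbreviation weyl_bound :: "(int \<Rightarrow> complex) \<Rightarrow> nat \<Rightarrow> int \<Rightarrow> real" where
  "weyl_bound f j k \<equiv> qpow (2 * \<alpha> + 1) (k - int j) * \<bar>rl_coeff j\<bar> * norm (f (k - int j))"

text \<open>After the substitution \<open>k = l + j\<close> the summand is dominated by a product.\<close>

lemma weyl_summable:
  assumes "rapid f"
  shows "(\<lambda>(j, k). q powr (real_of_int k) * weyl_bound f j k) summable_on UNIV \<times> UNIV"
proof -
  let ?T = "\<lambda>(j, k). q powr (real_of_int k) * weyl_bound f j k"
  have "(\<lambda>(j, l). ?T (j, l + int j)) summable_on UNIV \<times> UNIV"
  proof (rule summable_on_product_bound[OF rl_coeff_summable])
    show "(\<lambda>l. weight \<alpha> l * norm (f l)) summable_on UNIV"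
      using rapid_l1[OF assms \<alpha>_gt_m1] unfolding l1_def .
    fix j :: nat and l :: int
    have "q powr real_of_int (l + int j) * qpow (2 * \<alpha> + 1) l = q ^ j * weight \<alpha> l"
    proof -
      have "q ^ j = q powr (real j)" using q_pos by (simp add: powr_realpow)
      thus ?thesis by (simp add: powr_add[symmetric] algebra_simps)
    qed
    thus "norm (?T (j, l + int j)) \<le> q ^ j * \<bar>rl_coeff j\<bar> * (weight \<alpha> l * norm (f l))"
      using q_pos by (simp add: abs_mult mult_ac)
  qed (use q_pos in auto)
  hence "(\<lambda>x. ?T ((\<lambda>(j, l). (j, l + int j)) x)) summable_on UNIV \<times> UNIV"
    by (simp add: case_prod_unfold)
  moreover have "bij_betw (\<lambda>(j, l). (j, l + int j)) (UNIV \<times> UNIV) (UNIV \<times> UNIV)"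
    by (rule bij_betw_byWitness[where f' = "\<lambda>(j, k). (j, k - int j)"]) auto
  ultimately show ?thesis
    using summable_on_reindex_bij_betw[of "\<lambda>(j, l). (j, l + int j)" "UNIV \<times> UNIV" "UNIV \<times> UNIV" ?T] by blast
qed

lemma weight_\<gamma>_eq: "weight \<gamma> k = q powr (real_of_int k)" "weight \<gamma> k = q powi k"
  using q_pos by (simp_all add: powi_eq_powr)

lemma weyl_summable_pointwise:
  assumes "rapid f"
  shows "(\<lambda>j. weyl_bound f j k) summable_on UNIV"
proof -
  let ?T = "\<lambda>j k. q powr (real_of_int k) * weyl_bound f j k"
  have "(\<lambda>(k, j). ?T j k) summable_on UNIV \<times> UNIV"
    using weyl_summable[OF assms] by (subst summable_on_swap) simp
  hence "(\<lambda>j. ?T j k) summable_on UNIV"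
    by (rule summable_on_SigmaD1[where f = "\<lambda>k j. ?T j k" and x = k]) simp
  hence "(\<lambda>j. q powr (- real_of_int k) * ?T j k) summable_on UNIV"
    by (rule summable_on_cmult_right)
  moreover have "q powr (- real_of_int k) * ?T j k = weyl_bound f j k" for j
  proof -
    have "q powr (- real_of_int k) * q powr (real_of_int k) = 1" unfolding powr_add[symmetric] using q_pos by simp
    thus ?thesis unfolding mult.assoc[symmetric] by simp
  qed
  ultimately show ?thesis by (simp only:)
qed

lemma l1_weyl:
  assumes "rapid f"
  shows "l1 \<gamma> (weyl f)"
proof -
  let ?T = "\<lambda>j k. q powr (real_of_int k) * weyl_bound f j k"
  have "(\<lambda>(k, j). ?T j k) summable_on UNIV \<times> UNIV"
    using weyl_summable[OF assms] by (subst summable_on_swap) simp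
  hence s: "(\<lambda>k. \<Sum>\<^sub>\<infinity>j. ?T j k) summable_on UNIV"
    by (rule summable_on_Sigma_banach)
  have "weight \<gamma> k * norm (weyl f k) \<le> \<bar>weyl_const\<bar> * (\<Sum>\<^sub>\<infinity>j. ?T j k)" for k
  proof -
    let ?t = "\<lambda>j. weyl_bound f j k"
    have "norm (\<Sum>\<^sub>\<infinity>j. of_real (qpow (2 * \<alpha> + 1) (k - int j) * rl_coeff j) * f (k - int j)) \<le> (\<Sum>\<^sub>\<infinity>j. ?t j)"
      by (rule dominated_infsum(2)[OF weyl_summable_pointwise[OF assms]]) (simp add: norm_mult abs_mult)
    hence "\<bar>weyl_const\<bar> * (q powr real_of_int k * norm (\<Sum>\<^sub>\<infinity>j. of_real (qpow (2 * \<alpha> + 1) (k - int j) * rl_coeff j) * f (k - int j)))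
       \<le> \<bar>weyl_const\<bar> * (q powr real_of_int k * (\<Sum>\<^sub>\<infinity>j. ?t j))"
      by (intro mult_left_mono) auto
    thus ?thesis unfolding weyl_def weight_\<gamma>_eq(1) norm_mult norm_of_real infsum_cmult_right' by (simp only: mult_ac)
  qed
  hence "(\<lambda>k. weight \<gamma> k * norm (weyl f k)) summable_on UNIV"
    by (intro dominated_infsum(1)[OF summable_on_cmult_right[OF s, of "\<bar>weyl_const\<bar>"]]) simp
  thus ?thesis unfolding l1_def .
qed

text \<open>Move the Weyl transform to the kernel, where it becomes the Riemann-Liouville transform, which maps
\<open>j\<^sub>-\<^sub>1\<^sub>/\<^sub>2\<close> to \<open>j\<^sub>\<alpha>\<close>.\<close>

theorem hankel_weyl:
  assumes "rapid f"
  shows "hankel \<gamma> (weyl f) m = hankel \<alpha> f m"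
proof -
  obtain C where C: "0 \<le> C" "\<And>k. \<bar>J \<gamma> k\<bar> \<le> C" using J_bounded[OF \<gamma>_gt_m1] by blast
  define F where "F = (\<lambda>j k. of_real (J \<gamma> (k + m)) * (of_real (q powr (real_of_int k))
      * (of_real (qpow (2 * \<alpha> + 1) (k - int j) * rl_coeff j) * f (k - int j))))"
  have sF: "(\<lambda>(j, k). F j k) summable_on UNIV \<times> UNIV"
  proof (rule dominated_infsum(1)[OF summable_on_cmult_right[OF weyl_summable[OF assms], of C]])
    fix x :: "nat \<times> int"
    obtain j k where x: "x = (j, k)" by (cases x)
    have "norm (F j k) = \<bar>J \<gamma> (k + m)\<bar> * (q powr (real_of_int k) * weyl_bound f j k)"
      unfolding F_def norm_mult norm_of_real abs_mult by simp
    also have "\<dots> \<le> C * (q powr (real_of_int k) * weyl_bound f j k)"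
      by (intro mult_right_mono C) simp
    finally show "norm (case x of (j, k) \<Rightarrow> F j k) \<le> C * (case x of (j, k) \<Rightarrow> q powr (real_of_int k) * weyl_bound f j k)"
      by (simp add: x)
  qed
  have sf: "(\<lambda>l. weight \<alpha> l * norm (f l)) summable_on UNIV"
    using rapid_l1[OF assms \<alpha>_gt_m1] unfolding l1_def .
  have Fshift: "F j (l + int j) = of_real (q ^ j * rl_coeff j * J \<gamma> (l + m + int j)) * (of_real (weight \<alpha> l) * f l)" for j l
  proof -
    have "q powr real_of_int (l + int j) * qpow (2 * \<alpha> + 1) l = q ^ j * weight \<alpha> l"
    proof -
      have "q ^ j = q powr (real j)" using q_pos by (simp add: powr_realpow)
      thus ?thesis by (simp add: powr_add[symmetric] algebra_simps)
    qed
    hence e: "complex_of_real (q powr real_of_int (l + int j)) * of_real (qpow (2 * \<alpha> + 1) l) = of_real (q ^ j) * of_real (weight \<alpha> l)"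
      by (simp only: of_real_mult[symmetric])
    have i: "l + int j - int j = l" "l + int j + m = l + m + int j" by simp_all
    have "F j (l + int j) = of_real (J \<gamma> (l + m + int j)) * ((of_real (q powr real_of_int (l + int j)) * of_real (qpow (2 * \<alpha> + 1) l)) * of_real (rl_coeff j) * f l)"
      unfolding F_def i of_real_mult by (simp only: mult.assoc)
    thus ?thesis unfolding e of_real_mult by (simp only: mult_ac)
  qed
  have "(\<Sum>\<^sub>\<infinity>k. \<Sum>\<^sub>\<infinity>j. F j k) = (\<Sum>\<^sub>\<infinity>j. \<Sum>\<^sub>\<infinity>k. F j k)"
    by (rule infsum_swap_banach[symmetric, OF sF])
  also have "\<dots> = (\<Sum>\<^sub>\<infinity>j. \<Sum>\<^sub>\<infinity>l. F j (l + int j))"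
    by (simp only: infsum_shift)
  also have "\<dots> = (\<Sum>\<^sub>\<infinity>l. \<Sum>\<^sub>\<infinity>j. F j (l + int j))"
  proof (rule infsum_swap_product_bound[OF summable_on_cmult_right[OF rl_coeff_summable, of C] sf])
    fix j :: nat and l :: int
    have "norm (F j (l + int j)) = (q ^ j * \<bar>rl_coeff j\<bar> * (weight \<alpha> l * norm (f l))) * \<bar>J \<gamma> (l + m + int j)\<bar>"
      unfolding Fshift norm_mult norm_of_real abs_mult using q_pos by simp
    also have "\<dots> \<le> (q ^ j * \<bar>rl_coeff j\<bar> * (weight \<alpha> l * norm (f l))) * C"
      using q_pos by (intro mult_left_mono C) simp
    finally show "norm (F j (l + int j)) \<le> C * (q ^ j * \<bar>rl_coeff j\<bar>) * (weight \<alpha> l * norm (f l))"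
      by (simp only: mult_ac)
  qed (use C q_pos in auto)
  also have "\<dots> = (\<Sum>\<^sub>\<infinity>l. of_real (\<Sum>\<^sub>\<infinity>j. q ^ j * rl_coeff j * J \<gamma> (l + m + int j)) * (of_real (weight \<alpha> l) * f l))"
    unfolding Fshift infsum_cmult_left' infsum_of_real by (rule refl)
  finally have sum_eq: "(\<Sum>\<^sub>\<infinity>k. \<Sum>\<^sub>\<infinity>j. F j k)
      = (\<Sum>\<^sub>\<infinity>l. of_real (\<Sum>\<^sub>\<infinity>j. q ^ j * rl_coeff j * J \<gamma> (l + m + int j)) * (of_real (weight \<alpha> l) * f l))" .
  have h1: "hankel \<gamma> (weyl f) m = of_real (amp \<gamma> * weyl_const) * (\<Sum>\<^sub>\<infinity>k. \<Sum>\<^sub>\<infinity>j. F j k)"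
  proof -
    have inner: "of_real (weight \<gamma> k * J \<gamma> (k + m)) * weyl f k = of_real weyl_const * (\<Sum>\<^sub>\<infinity>j. F j k)" for k
      unfolding F_def weyl_def weight_\<gamma>_eq(1) infsum_cmult_right' of_real_mult by (simp only: mult_ac)
    have "(\<Sum>\<^sub>\<infinity>k. of_real (weight \<gamma> k * J \<gamma> (k + m)) * weyl f k) = of_real weyl_const * (\<Sum>\<^sub>\<infinity>k. \<Sum>\<^sub>\<infinity>j. F j k)"
      unfolding inner by (rule infsum_cmult_right')
    thus ?thesis unfolding hankel_def by (simp only: of_real_mult mult.assoc)
  qed
  have "of_real rl_const * (\<Sum>\<^sub>\<infinity>l. of_real (\<Sum>\<^sub>\<infinity>j. q ^ j * rl_coeff j * J \<gamma> (l + m + int j)) * (of_real (weight \<alpha> l) * f l))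
     = (\<Sum>\<^sub>\<infinity>l. of_real (rl_const * (\<Sum>\<^sub>\<infinity>j. q ^ j * rl_coeff j * J \<gamma> (l + m + int j))) * (of_real (weight \<alpha> l) * f l))"
    by (subst infsum_cmult_right'[symmetric]) (simp only: of_real_mult mult.assoc)
  also have "\<dots> = (\<Sum>\<^sub>\<infinity>l. of_real (weight \<alpha> l * J \<alpha> (l + m)) * f l)"
    unfolding rl_bessel of_real_mult by (simp only: mult_ac)
  finally have h2: "of_real rl_const * (\<Sum>\<^sub>\<infinity>l. of_real (\<Sum>\<^sub>\<infinity>j. q ^ j * rl_coeff j * J \<gamma> (l + m + int j)) * (of_real (weight \<alpha> l) * f l))
     = (\<Sum>\<^sub>\<infinity>l. of_real (weight \<alpha> l * J \<alpha> (l + m)) * f l)" .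
  have "of_real (rl_const * amp \<alpha>) * S = of_real (amp \<alpha>) * (of_real rl_const * S)" for S :: complex
    by simp
  thus ?thesis
    unfolding h1 sum_eq amp_weyl_const by (simp only: h2 hankel_def)
qed

lemma hankel_inversion_\<gamma>: "l1 \<gamma> f \<Longrightarrow> hankel \<gamma> (hankel \<gamma> f) n = f n"
  using hankel_inversion[OF \<gamma>_gt_m1, of f n] q_pos by simp

lemma q_powr_cancel: "qpow (- (2 * \<alpha> + 1)) m * qpow (2 * \<alpha> + 1) m = 1"
  unfolding powr_add[symmetric] distrib_right[symmetric] using q_pos by simp

text \<open>Both sides have the same cosine transform, which is injective on \<open>l1 \<gamma>\<close>.\<close>

lemma weyl_hankel:
  assumes "flat P"
  shows "weyl (hankel \<alpha> P) k = of_real (q powr (4 * \<alpha> + 2)) * hankel \<gamma> P k"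
proof -
  have r: "rapid (hankel \<alpha> P)" by (rule rapid_hankel[OF \<alpha>_gt_m1 assms])
  have "hankel \<gamma> (weyl (hankel \<alpha> P)) = (\<lambda>m. of_real (q powr (4 * \<alpha> + 2)) * P m)"
    using hankel_weyl[OF r] hankel_inversion[OF \<alpha>_gt_m1 flat_l1[OF assms \<alpha>_gt_m1]] by (intro ext) simp
  hence "hankel \<gamma> (hankel \<gamma> (weyl (hankel \<alpha> P))) k = of_real (q powr (4 * \<alpha> + 2)) * hankel \<gamma> P k"
    by (simp only: hankel_scale)
  thus ?thesis unfolding hankel_inversion_\<gamma>[OF l1_weyl[OF r]] .
qed

text \<open>For \<open>n > k\<close> the numerator is \<open>(q\<^bsup>2i\<^esup>; q\<^sup>2)\<^sub>\<infinity>\<close> with \<open>i \<le> 0\<close>, hence 0.\<close>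

lemma weyl_kernel:
  "qpoch_inf (q\<^sup>2 * (q powi k)\<^sup>2 / (q powi n)\<^sup>2) (q\<^sup>2) / qpoch_inf (q powr (2 * \<alpha> + 1) * (q powi k)\<^sup>2 / (q powi n)\<^sup>2) (q\<^sup>2)
     = (if n \<le> k then rl_coeff (nat (k - n)) else 0)"
proof (cases "n \<le> k")
  case True
  have "(q powi k)\<^sup>2 / (q powi n)\<^sup>2 = (q ^ nat (k - n))\<^sup>2"
    using True q_pos by (simp add: power_divide[symmetric] power_int_diff[symmetric] power_int_nonneg_exp)
  hence "c * (q powi k)\<^sup>2 / (q powi n)\<^sup>2 = (q ^ nat (k - n))\<^sup>2 * c" for c
    by (metis mult.commute times_divide_eq_right)
  thus ?thesis using True by (simp only: rl_coeff_def if_True)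
next
  case False
  have "q\<^sup>2 * (q powi k)\<^sup>2 / (q powi n)\<^sup>2 = (q\<^sup>2) powi (1 + k - n)"
  proof -
    have "(q powi j)\<^sup>2 = (q\<^sup>2) powi j" for j by (simp add: power2_eq_square power_int_mult_distrib)
    thus ?thesis using q_pos by (simp add: power_int_diff power_int_add)
  qed
  thus ?thesis using False by (simp add: base.qpoch_inf_powi_nonpos)
qed

lemma powi_powr_weight: "q powi n * (q powi n) powr (2 * \<alpha>) = qpow (2 * \<alpha> + 1) n"
  unfolding powi_eq_powr[OF q_pos] powr_powr powr_add[symmetric] by (simp add: algebra_simps)

text \<open>The nodes \<open>t < \<bar>x\<bar>\<close> do not contribute, so the subtraction inside \<open>jackson_from\<close> is harmless and a
one-sided convolution remains.\<close>

lemma q_weyl_abs: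
  assumes "\<bar>x\<bar> = q powi k" "x \<in> Rq q"
  shows "q_weyl q \<alpha> f x = weyl (on_grid f) k"
proof -
  define h where "h = (\<lambda>t. of_real (qpoch_inf (q\<^sup>2 * x\<^sup>2 / t\<^sup>2) (q\<^sup>2) / qpoch_inf (q powr (2 * \<alpha> + 1) * x\<^sup>2 / t\<^sup>2) (q\<^sup>2)) *
       f t * of_real (t powr (2 * \<alpha>)))"
  have x2: "x\<^sup>2 = (q powi k)\<^sup>2" using assms(1) by (metis power2_abs)
  have hn: "h (q powi n) = (if n \<le> k then of_real (rl_coeff (nat (k - n))) * f (q powi n) * of_real ((q powi n) powr (2 * \<alpha>)) else 0)" for n
    unfolding h_def x2 weyl_kernel by simp
  have "jackson_to q (q * \<bar>x\<bar>) h = 0"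
  proof -
    have "h (q * \<bar>x\<bar> * q ^ n) = 0" for n :: nat
    proof -
      have "q * \<bar>x\<bar> * q ^ n = q powi (k + 1 + int n)"
        unfolding assms(1) using q_pos by (simp add: power_int_add)
      thus ?thesis by (simp add: hn)
    qed
    thus ?thesis by (simp add: jackson_to_def)
  qed
  moreover have "jackson q h = of_real (1 - q) * (\<Sum>\<^sub>\<infinity>j. of_real (qpow (2 * \<alpha> + 1) (k - int j) * rl_coeff j) * f (q powi (k - int j)))"
  proof -
    let ?F = "\<lambda>n. of_real (qpow (2 * \<alpha> + 1) n * rl_coeff (nat (k - n))) * f (q powi n)"
    have "of_real (q powi n) * h (q powi n) = (if n \<le> k then ?F n else 0)" for n
      unfolding hn powi_powr_weight[symmetric] by simp
    hence "jackson q h = of_real (1 - q) * (\<Sum>\<^sub>\<infinity>n. if n \<le> k then ?F n else 0)"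
      unfolding jackson_eq by simp
    also have "(\<Sum>\<^sub>\<infinity>n. if n \<le> k then ?F n else 0) = (\<Sum>\<^sub>\<infinity>j::nat. ?F (k - int j))"
      by (rule infsum_int_atMost[symmetric])
    finally show ?thesis by simp
  qed
  ultimately have "jackson_from q (q * \<bar>x\<bar>) h
      = of_real (1 - q) * (\<Sum>\<^sub>\<infinity>j. of_real (qpow (2 * \<alpha> + 1) (k - int j) * rl_coeff j) * f (q powi (k - int j)))"
    by (simp add: jackson_from_def)
  moreover have "q_weyl q \<alpha> f x = of_real (q * (1 + 1 / q) powr (- \<alpha> + 1 / 2) / q_Gamma (q\<^sup>2) (\<alpha> + 1 / 2)) * jackson_from q (q * \<bar>x\<bar>) h"
    using assms(2) unfolding q_weyl_def h_def by (simp only: restrict_apply if_True)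
  ultimately show ?thesis
    unfolding weyl_def weyl_const_def by (simp only: of_real_mult mult.assoc)
qed

lemma q_weyl_grid: "q_weyl q \<alpha> f (q powi k) = weyl (on_grid f) k"
  and q_weyl_neg: "q_weyl q \<alpha> f (- (q powi k)) = weyl (on_grid f) k"
  using q_powi_pos[of k] by (simp_all add: q_weyl_abs)

lemma q_weyl_0: "q_weyl q \<alpha> f 0 = of_real weyl_const * (\<Sum>\<^sub>\<infinity>l. of_real (qpow (2 * \<alpha> + 1) l) * f (q powi l))"
proof -
  have "of_real (q powi n) * (f (q powi n) * of_real ((q powi n) powr (2 * \<alpha>))) = of_real (qpow (2 * \<alpha> + 1) n) * f (q powi n)" for n
    unfolding powi_powr_weight[symmetric] of_real_mult by (simp only: mult_ac)
  hence "jackson q (\<lambda>t. f t * of_real (t powr (2 * \<alpha>))) = of_real (1 - q) * (\<Sum>\<^sub>\<infinity>l. of_real (qpow (2 * \<alpha> + 1) l) * f (q powi l))"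
    unfolding jackson_eq by (simp only:)
  thus ?thesis unfolding q_weyl_def weyl_const_def by (simp add: jackson_from_def jackson_to_def)
qed

lemma weyl_tendsto:
  assumes "rapid f"
  shows "(\<lambda>K. weyl f (int K)) \<longlonglongrightarrow> of_real weyl_const * (\<Sum>\<^sub>\<infinity>l. of_real (qpow (2 * \<alpha> + 1) l) * f l)"
proof -
  obtain B where B: "0 \<le> B" "\<And>j. \<bar>rl_coeff j\<bar> \<le> B" using rl_coeff_bounded by blast
  let ?F = "\<lambda>K l. of_real (qpow (2 * \<alpha> + 1) l * rl_coeff (nat (int K - l))) * f l"
  have eq: "weyl f (int K) = of_real weyl_const * (\<Sum>\<^sub>\<infinity>l. if l \<le> int K then ?F K l else 0)" for K
    unfolding weyl_def infsum_int_atMost[symmetric] by simp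
  have "(\<lambda>K. \<Sum>\<^sub>\<infinity>l. if l \<le> int K then ?F K l else 0) \<longlonglongrightarrow> (\<Sum>\<^sub>\<infinity>l. of_real (qpow (2 * \<alpha> + 1) l) * f l)"
  proof (rule tendsto_infsum_dominated)
    show "(\<lambda>l. B * (qpow (2 * \<alpha> + 1) l * norm (f l))) summable_on UNIV"
      by (intro summable_on_cmult_right rapid_weighted_summable assms) (use \<alpha>_gt in simp)
    fix l :: int
    show "norm (if l \<le> int K then ?F K l else 0) \<le> B * (qpow (2 * \<alpha> + 1) l * norm (f l))" for K
      using mult_right_mono[OF B(2)[of "nat (int K - l)"], of "qpow (2 * \<alpha> + 1) l * norm (f l)"] B(1)
      by (simp add: norm_mult abs_mult mult_ac)
    have "filterlim (\<lambda>K. nat (int K - l)) sequentially sequentially"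
    proof (unfold filterlim_at_top, rule allI)
      fix Z
      show "\<forall>\<^sub>F K in sequentially. Z \<le> nat (int K - l)"
        using eventually_ge_at_top[of "nat (int Z + \<bar>l\<bar>)"] by eventually_elim linarith
    qed
    hence "(\<lambda>K. rl_coeff (nat (int K - l))) \<longlonglongrightarrow> 1"
      by (rule filterlim_compose[OF rl_coeff_tendsto])
    hence "(\<lambda>K. ?F K l) \<longlonglongrightarrow> of_real (qpow (2 * \<alpha> + 1) l * 1) * f l"
      by (intro tendsto_intros)
    moreover have "\<forall>\<^sub>F K in sequentially. ?F K l = (if l \<le> int K then ?F K l else 0)"
      using eventually_ge_at_top[of "nat l"] by eventually_elim auto
    ultimately show "(\<lambda>K. if l \<le> int K then ?F K l else 0) \<longlonglongrightarrow> of_real (qpow (2 * \<alpha> + 1) l) * f l"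
      by (simp add: tendsto_cong)
  qed
  thus ?thesis unfolding eq by (intro tendsto_intros)
qed

text \<open>The preimage is \<open>F\<^sub>\<alpha>\<^bsup>-1\<^esup> F f\<close>.\<close>

theorem q_weyl_surj:
  assumes f: "f \<in> q_schwartz0 q \<gamma>"
  shows "\<exists>u\<in>q_schwartz0 q \<alpha>. q_weyl q \<alpha> u = f"
proof -
  define P where "P = (\<lambda>k. of_real (q powr (- (4 * \<alpha> + 2))) * hankel \<gamma> (on_grid f) k)"
  have fs: "f \<in> q_schwartz q" using f by (simp add: q_schwartz0_iff)
  have P: "flat P"
    unfolding P_def by (rule flat_scale[OF hankel_q_schwartz0_flat[OF \<gamma>_gt_m1 f]])
  define u where "u = restrict (hankel_ext \<alpha> P) (Rq q)"
  have u: "u \<in> q_schwartz0 q \<alpha>" unfolding u_def by (rule hankel_ext_in_q_schwartz0[OF \<alpha>_gt_m1 P])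
  hence us: "u \<in> q_schwartz q" by (simp add: q_schwartz0_iff)
  have ug: "(on_grid u) = hankel \<alpha> P"
    by (rule ext) (simp add: u_def hankel_ext_grid)
  have grid: "q_weyl q \<alpha> u (q powi k) = f (q powi k)" for k
  proof -
    have "q_weyl q \<alpha> u (q powi k) = of_real (q powr (4 * \<alpha> + 2)) * hankel \<gamma> P k"
      unfolding q_weyl_grid ug by (rule weyl_hankel[OF P])
    also have "\<dots> = (of_real (q powr (4 * \<alpha> + 2)) * of_real (q powr (- (4 * \<alpha> + 2)))) * hankel \<gamma> (hankel \<gamma> (on_grid f)) k"
      unfolding P_def hankel_scale by (simp only: mult.assoc)
    also have "complex_of_real (q powr (4 * \<alpha> + 2)) * of_real (q powr (- (4 * \<alpha> + 2))) = 1"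
      unfolding of_real_mult[symmetric] powr_add[symmetric] using q_pos by simp
    also have "hankel \<gamma> (hankel \<gamma> (on_grid f)) k = f (q powi k)"
      by (rule hankel_inversion_\<gamma>[OF rapid_l1[OF q_schwartz_rapid[OF fs] \<gamma>_gt_m1]])
    finally show ?thesis by simp
  qed
  have "q_weyl q \<alpha> u = f"
  proof (rule q_schwartz_eqI[OF fs _ grid])
    show "q_weyl q \<alpha> u \<in> extensional (Rq q)" by (simp add: q_weyl_def)
    show "q_weyl q \<alpha> u (- (q powi k)) = q_weyl q \<alpha> u (q powi k)" for k
      unfolding q_weyl_neg q_weyl_grid by (rule refl)
    show "(\<lambda>n. q_weyl q \<alpha> u (q powi (int n))) \<longlonglongrightarrow> q_weyl q \<alpha> u 0"
      unfolding q_weyl_grid q_weyl_0 by (rule weyl_tendsto[OF q_schwartz_rapid[OF us]])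
  qed
  thus ?thesis using u by blast
qed

text \<open>Every preimage has the Bessel transform \<open>F f\<close>, in particular the one that \<open>inv_into\<close> selects.\<close>

lemma q_weyl_inv_spec:
  assumes f: "f \<in> q_schwartz0 q \<gamma>"
  shows "q_weyl_inv q \<alpha> f \<in> q_schwartz0 q \<alpha>"
    and "hankel \<alpha> (on_grid (q_weyl_inv q \<alpha> f)) m = hankel \<gamma> (on_grid f) m"
proof -
  have mem: "f \<in> q_weyl q \<alpha> ` q_schwartz0 q \<alpha>" using q_weyl_surj[OF f] by blast
  let ?u = "q_weyl_inv q \<alpha> f"
  show u: "?u \<in> q_schwartz0 q \<alpha>" unfolding q_weyl_inv_def by (rule inv_into_into[OF mem])
  have "q_weyl q \<alpha> ?u = f" unfolding q_weyl_inv_def by (rule f_inv_into_f[OF mem])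
  hence "f (q powi k) = weyl (on_grid ?u) k" for k by (metis q_weyl_grid)
  hence eq: "(on_grid f) = weyl (on_grid ?u)" by (rule ext)
  have us: "?u \<in> q_schwartz q" using u by (simp add: q_schwartz0_iff)
  show "hankel \<alpha> (on_grid ?u) m = hankel \<gamma> (on_grid f) m"
    unfolding eq by (rule hankel_weyl[OF q_schwartz_rapid[OF us], symmetric])
qed

text \<open>This is the equation that fixes the constant in \<open>K1\<close> and \<open>K2\<close>.\<close>

lemma K_const_amp: "amp \<gamma> / amp \<alpha> * K_const q \<alpha> * q powr (4 * \<alpha> + 2) = 1"
proof -
  define G H where "G = q_Gamma (q\<^sup>2) (1 / 2)" and "H = q_Gamma (q\<^sup>2) (\<alpha> + 1)"
  have pos: "0 < G" "0 < H" unfolding G_def H_def using \<alpha>_gt by (auto intro!: q_Gamma_q2_pos)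
  define s where "s = (1 + q) powr (\<alpha> + 1 / 2)"
  have s: "0 < s" using q_pos by (simp add: s_def)
  have h1: "1 + 1 / q = (1 + q) / q" using q_pos by (simp add: field_simps)
  have h: "(1 + 1 / q) powr (\<alpha> + 1 / 2) = s * q powr (- (\<alpha> + 1 / 2))"
    unfolding s_def h1 powr_minus using q_pos powr_divide[of "1 + q" q "\<alpha> + 1 / 2"] by (simp only: divide_inverse)
  have "amp \<gamma> / amp \<alpha> = ((1 + 1 / q) powr (1 / 2) / (1 + 1 / q) powr (- \<alpha>)) * (H / G)"
    unfolding amp_def q_const_def G_def H_def using q_less_1 by simp
  also have "(1 + 1 / q) powr (1 / 2) / (1 + 1 / q) powr (- \<alpha>) = (1 + 1 / q) powr (\<alpha> + 1 / 2)"
    by (simp add: powr_diff[symmetric] add.commute)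
  finally have "amp \<gamma> / amp \<alpha> * K_const q \<alpha> * q powr (4 * \<alpha> + 2)
      = (s * q powr (- (\<alpha> + 1 / 2))) * (H / G) * (G / (q powr (3 * \<alpha> + 3 / 2) * s * H)) * q powr (4 * \<alpha> + 2)"
    unfolding h K_const_def G_def H_def s_def by simp
  also have "\<dots> = (q powr (- (\<alpha> + 1 / 2)) * q powr (4 * \<alpha> + 2)) / q powr (3 * \<alpha> + 3 / 2)"
    using pos s by (simp add: field_simps)
  also have "\<dots> = 1"
    unfolding powr_add[symmetric] powr_diff[symmetric] using q_pos by (simp add: algebra_simps)
  finally show ?thesis .
qed

lemma rl_hankel_K:
  assumes "flat \<theta>"
  shows "rl (hankel \<gamma> (\<lambda>m. of_real (K_const q \<alpha> * qpow (2 * \<alpha> + 1) m) * \<theta> m)) k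
    = of_real (q powr (- (4 * \<alpha> + 2))) * hankel \<alpha> \<theta> k"
proof -
  let ?\<psi> = "\<lambda>m. of_real (K_const q \<alpha> * qpow (2 * \<alpha> + 1) m) * \<theta> m"
  have fl: "flat ?\<psi>"
    using flat_scale[OF flat_powr_mult[OF assms], of "of_real (K_const q \<alpha>)"] by (simp add: mult.assoc)
  have cancel: "of_real (qpow (- (2 * \<alpha> + 1)) m) * ?\<psi> m = of_real (K_const q \<alpha>) * \<theta> m" for m
  proof -
    have "qpow (- (2 * \<alpha> + 1)) m * (K_const q \<alpha> * qpow (2 * \<alpha> + 1) m) = K_const q \<alpha>"
    proof -
      have "qpow (- (2 * \<alpha> + 1)) m * qpow (2 * \<alpha> + 1) m = 1"
        by (rule q_powr_cancel)
      thus ?thesis by (metis mult.left_commute mult.right_neutral)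
    qed
    thus ?thesis by (simp only: mult.assoc[symmetric] of_real_mult[symmetric])
  qed
  have "rl (hankel \<gamma> ?\<psi>) k = of_real (amp \<gamma> / amp \<alpha>) * (of_real (K_const q \<alpha>) * hankel \<alpha> \<theta> k)"
    unfolding rl_hankel[OF fl] cancel hankel_scale by (rule refl)
  also have "\<dots> = of_real (amp \<gamma> / amp \<alpha> * K_const q \<alpha>) * hankel \<alpha> \<theta> k"
    by (simp only: of_real_mult mult.assoc)
  also have "amp \<gamma> / amp \<alpha> * K_const q \<alpha> = q powr (- (4 * \<alpha> + 2))"
    unfolding powr_minus by (rule inverse_unique[symmetric]) (use K_const_amp in \<open>simp only: mult_ac\<close>)
  finally show ?thesis .
qed

text \<open>The preimage is \<open>K F\<^bsup>-1\<^esup> (s\<^bsup>2\<alpha>+1\<^esup> F\<^sub>\<alpha> f)\<close> with \<open>K = K_const q \<alpha>\<close>.\<close>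

theorem q_riemann_liouville_surj:
  assumes f: "f \<in> q_schwartz0 q \<alpha>"
  shows "\<exists>v\<in>q_schwartz0 q \<gamma>. q_riemann_liouville q \<alpha> v = f"
proof -
  let ?\<theta> = "hankel \<alpha> (on_grid f)"
  define \<psi> where "\<psi> = (\<lambda>m. of_real (K_const q \<alpha> * qpow (2 * \<alpha> + 1) m) * ?\<theta> m)"
  have fs: "f \<in> q_schwartz q" using f by (simp add: q_schwartz0_iff)
  have \<theta>: "flat ?\<theta>" by (rule hankel_q_schwartz0_flat[OF \<alpha>_gt_m1 f])
  have \<psi>: "flat \<psi>"
    unfolding \<psi>_def using flat_scale[OF flat_powr_mult[OF \<theta>], of "of_real (K_const q \<alpha>)"] by (simp add: mult.assoc)
  define v where "v = restrict (hankel_ext \<gamma> \<psi>) (Rq q)"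
  have v: "v \<in> q_schwartz0 q \<gamma>" unfolding v_def by (rule hankel_ext_in_q_schwartz0[OF \<gamma>_gt_m1 \<psi>])
  hence vs: "v \<in> q_schwartz q" by (simp add: q_schwartz0_iff)
  have vg: "(on_grid v) = hankel \<gamma> \<psi>"
    by (rule ext) (simp add: v_def hankel_ext_grid)
  have grid: "q_riemann_liouville q \<alpha> v (q powi k) = f (q powi k)" for k
  proof -
    have "q_riemann_liouville q \<alpha> v (q powi k) = of_real (q powr (- (4 * \<alpha> + 2))) * hankel \<alpha> ?\<theta> k"
      unfolding q_riemann_liouville_grid vg \<psi>_def by (rule rl_hankel_K[OF \<theta>])
    also have "hankel \<alpha> ?\<theta> k = of_real (q powr (4 * \<alpha> + 2)) * f (q powi k)"
      by (rule hankel_inversion[OF \<alpha>_gt_m1 rapid_l1[OF q_schwartz_rapid[OF fs] \<alpha>_gt_m1]])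
    also have "of_real (q powr (- (4 * \<alpha> + 2))) * (of_real (q powr (4 * \<alpha> + 2)) * f (q powi k)) = f (q powi k)"
      unfolding mult.assoc[symmetric] of_real_mult[symmetric] powr_add[symmetric] using q_pos by simp
    finally show ?thesis .
  qed
  have "q_riemann_liouville q \<alpha> v = f"
  proof (rule q_schwartz_eqI[OF fs _ grid])
    show "q_riemann_liouville q \<alpha> v \<in> extensional (Rq q)" by (simp add: q_riemann_liouville_def)
    have "v (- (q powi k) * q ^ j) = v (q powi k * q ^ j)" for k and j :: nat
      using q_schwartz_even(1)[OF vs, of "k + int j"] q_pos by (simp add: power_int_add)
    thus "q_riemann_liouville q \<alpha> v (- (q powi k)) = q_riemann_liouville q \<alpha> v (q powi k)" for k
      by (simp only: q_riemann_liouville_eq q_powi_Rq)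
    obtain C where C: "\<And>k. norm (v (q powi k)) \<le> C * qpow 0 k"
    proof -
      have "of_order 0 (on_grid v)" using q_schwartz_rapid[OF vs] by (simp add: rapid_def)
      thus ?thesis by (rule of_orderE) (rule that)
    qed
    have "(\<lambda>n. \<Sum>\<^sub>\<infinity>j. of_real (q ^ j * rl_coeff j) * v (q powi (int n + int j))) \<longlonglongrightarrow> (\<Sum>\<^sub>\<infinity>j. of_real (q ^ j * rl_coeff j) * v 0)"
    proof (rule tendsto_infsum_dominated)
      show "(\<lambda>j. C * (q ^ j * \<bar>rl_coeff j\<bar>)) summable_on UNIV"
        by (rule summable_on_cmult_right[OF rl_coeff_summable])
      fix j :: nat
      have "norm (v (q powi (int n + int j))) \<le> C" for n using C[of "int n + int j"] q_pos by simp
      thus "norm (of_real (q ^ j * rl_coeff j) * v (q powi (int n + int j))) \<le> C * (q ^ j * \<bar>rl_coeff j\<bar>)" for n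
        unfolding norm_mult norm_of_real abs_mult mult.commute[of C] using q_pos by (simp add: mult_left_mono)
      have "(\<lambda>n. v (q powi (int (n + j)))) \<longlonglongrightarrow> v 0"
        using q_schwartz_at_0[OF vs] by (rule LIMSEQ_ignore_initial_segment)
      thus "(\<lambda>n. of_real (q ^ j * rl_coeff j) * v (q powi (int n + int j))) \<longlonglongrightarrow> of_real (q ^ j * rl_coeff j) * v 0"
        by (intro tendsto_intros) simp
    qed
    hence "(\<lambda>n. of_real rl_const * (\<Sum>\<^sub>\<infinity>j. of_real (q ^ j * rl_coeff j) * v (q powi (int n + int j))))
        \<longlonglongrightarrow> of_real rl_const * (\<Sum>\<^sub>\<infinity>j. of_real (q ^ j * rl_coeff j) * v 0)"
      by (intro tendsto_intros)
    thus "(\<lambda>n. q_riemann_liouville q \<alpha> v (q powi (int n))) \<longlonglongrightarrow> q_riemann_liouville q \<alpha> v 0"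
      unfolding q_riemann_liouville_grid rl_def q_riemann_liouville_eq[OF q_powi_Rq(3)] by simp
  qed
  thus ?thesis using v by blast
qed

text \<open>Any preimage \<open>v\<close> is the cosine transform of \<open>\<psi> = F v\<close>.  Applying the Riemann-Liouville transform and
then \<open>F\<^sub>\<alpha>\<close> recovers \<open>\<psi>\<close> from \<open>f\<close>.\<close>

lemma q_riemann_liouville_inv_spec:
  assumes f: "f \<in> q_schwartz0 q \<alpha>"
  shows "q_riemann_liouville_inv q \<alpha> f (q powi k)
    = hankel \<gamma> (\<lambda>m. of_real (K_const q \<alpha> * qpow (2 * \<alpha> + 1) m) * hankel \<alpha> (on_grid f) m) k"
proof -
  have mem: "f \<in> q_riemann_liouville q \<alpha> ` q_schwartz0 q \<gamma>" using q_riemann_liouville_surj[OF f] by blast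
  define v where "v = q_riemann_liouville_inv q \<alpha> f"
  have v: "v \<in> q_schwartz0 q \<gamma>" unfolding v_def q_riemann_liouville_inv_def by (rule inv_into_into[OF mem])
  have Rv: "q_riemann_liouville q \<alpha> v = f" unfolding v_def q_riemann_liouville_inv_def by (rule f_inv_into_f[OF mem])
  define \<psi> where "\<psi> = hankel \<gamma> (on_grid v)"
  have \<psi>: "flat \<psi>" unfolding \<psi>_def by (rule hankel_q_schwartz0_flat[OF \<gamma>_gt_m1 v])
  have v\<psi>: "v (q powi k) = hankel \<gamma> \<psi> k" for k
    unfolding \<psi>_def using v by (intro hankel_inversion_\<gamma>[symmetric] rapid_l1[OF q_schwartz_rapid \<gamma>_gt_m1]) (simp add: q_schwartz0_iff)
  define \<omega> where "\<omega> = (\<lambda>m. of_real (qpow (- (2 * \<alpha> + 1)) m) * \<psi> m)"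
  have \<omega>: "flat \<omega>" unfolding \<omega>_def by (rule flat_powr_mult[OF \<psi>])
  have "f (q powi k) = of_real (amp \<gamma> / amp \<alpha>) * hankel \<alpha> \<omega> k" for k
  proof -
    have "f (q powi k) = rl (on_grid v) k" unfolding Rv[symmetric] q_riemann_liouville_grid by (rule refl)
    thus ?thesis unfolding v\<psi> \<omega>_def using rl_hankel[OF \<psi>, of k] by simp
  qed
  hence "hankel \<alpha> (on_grid f) m = of_real (amp \<gamma> / amp \<alpha>) * (of_real (q powr (4 * \<alpha> + 2)) * \<omega> m)" for m
    by (simp only: hankel_scale hankel_inversion[OF \<alpha>_gt_m1 flat_l1[OF \<omega> \<alpha>_gt_m1]])
  hence "of_real (K_const q \<alpha> * qpow (2 * \<alpha> + 1) m) * hankel \<alpha> (on_grid f) m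
      = of_real (amp \<gamma> / amp \<alpha> * K_const q \<alpha> * q powr (4 * \<alpha> + 2)) * (of_real (qpow (2 * \<alpha> + 1) m * qpow (- (2 * \<alpha> + 1)) m) * \<psi> m)" for m
    unfolding \<omega>_def of_real_mult by (simp only: mult_ac)
  hence "of_real (K_const q \<alpha> * qpow (2 * \<alpha> + 1) m) * hankel \<alpha> (on_grid f) m = \<psi> m" for m
    unfolding K_const_amp mult.commute[of "q powr ((2 * \<alpha> + 1) * _)"] q_powr_cancel by simp
  thus ?thesis unfolding v_def[symmetric] v\<psi> by simp
qed

end

section \<open>Wavelet atoms and the Calderon formula\<close>

context q_grid
begin

lemma J_of_order_0: "\<beta> > -1 \<Longrightarrow> of_order 0 (\<lambda>m. complex_of_real (J \<beta> (m + n)))"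
  using of_order_shift[OF of_order_J[of \<beta> 0]] by (simp add: of_order_of_real)

lemma flat_J_mult: "\<beta> > -1 \<Longrightarrow> flat H \<Longrightarrow> flat (\<lambda>m. of_real (J \<beta> (m + n)) * H (m + i))"
  by (rule flat_of_order_mult(2)[OF flat_shift J_of_order_0])

text \<open>\<open>H\<close> stands for the transform of the wavelet, \<open>q\<^sup>i\<close> for the scale, \<open>q\<^sup>n\<close> for the translation and \<open>q\<^sup>k\<close>
for the argument.  The two families of atoms in the statement are the cases \<open>\<beta> = \<alpha>\<close> and
\<open>\<beta> = -1/2\<close>.\<close>

definition atom :: "real \<Rightarrow> (int \<Rightarrow> complex) \<Rightarrow> int \<Rightarrow> int \<Rightarrow> int \<Rightarrow> complex" where
  "atom \<beta> H i n k = of_real (sqrt (q powi i) * q powr (- 4 * \<beta> - 2)) * hankel \<beta> (\<lambda>m. of_real (J \<beta> (m + n)) * H (m + i)) k"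

lemma hankel_dilate: "hankel \<beta> (\<lambda>k. s (k - i)) m = of_real (weight \<beta> i) * hankel \<beta> s (m + i)"
proof -
  have "(\<Sum>\<^sub>\<infinity>k. of_real (weight \<beta> k * J \<beta> (k + m)) * s (k - i)) = (\<Sum>\<^sub>\<infinity>k. of_real (weight \<beta> (k + i) * J \<beta> (k + i + m)) * s (k + i - i))"
    by (rule infsum_shift[symmetric, of _ i])
  also have "\<dots> = (\<Sum>\<^sub>\<infinity>k. of_real (weight \<beta> i) * (of_real (weight \<beta> k * J \<beta> (k + (m + i))) * s k))"
  proof (rule infsum_cong)
    fix k
    have "weight \<beta> (k + i) = weight \<beta> i * weight \<beta> k" unfolding powr_add[symmetric] by (simp add: algebra_simps)
    thus "of_real (weight \<beta> (k + i) * J \<beta> (k + i + m)) * s (k + i - i) = of_real (weight \<beta> i) * (of_real (weight \<beta> k * J \<beta> (k + (m + i))) * s k)"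
      by (simp add: add_ac)
  qed
  finally show ?thesis unfolding hankel_def by (simp only: infsum_cmult_right') simp
qed

lemma q_translate_grid:
  "q_translate q \<beta> (q powi n) f (q powi k)
     = of_real (q powr (- 4 * \<beta> - 2)) * hankel \<beta> (\<lambda>m. of_real (J \<beta> (m + n)) * hankel \<beta> (on_grid f) m) k"
proof -
  have "q powi m * q powi n = q powi (m + n)" for m using q_pos by (simp add: power_int_add)
  thus ?thesis unfolding q_translate_def q_fourier_inv_def by (simp only: q_fourier_grid)
qed

text \<open>A dilation by \<open>q\<^sup>i\<close> multiplies the transform by \<open>weight \<beta> i\<close> and shifts it.  Both normalisations of
the dilated wavelets amount to the factor \<open>\<surd>a\<close> on the Fourier side.\<close>

lemma atom_grid:
  assumes "c * weight \<beta> i = sqrt (q powi i)"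
  shows "q_translate q \<beta> (q powi n) (\<lambda>y. of_real c * h (y / q powi i)) (q powi k) = atom \<beta> (hankel \<beta> (on_grid h)) i n k"
proof -
  have "hankel \<beta> (\<lambda>k. of_real c * h (q powi k / q powi i)) m = of_real (sqrt (q powi i)) * hankel \<beta> (on_grid h) (m + i)" for m
  proof -
    have "q powi k / q powi i = q powi (k - i)" for k using q_pos by (simp add: power_int_diff)
    thus ?thesis
      unfolding assms[symmetric] of_real_mult by (simp only: hankel_scale hankel_dilate[of \<beta> "\<lambda>k. h (q powi k)"] mult.assoc)
  qed
  hence "(\<lambda>m. of_real (J \<beta> (m + n)) * hankel \<beta> (\<lambda>k. of_real c * h (q powi k / q powi i)) m)
      = (\<lambda>m. of_real (sqrt (q powi i)) * (of_real (J \<beta> (m + n)) * hankel \<beta> (on_grid h) (m + i)))"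
    by (simp only: mult_ac)
  thus ?thesis unfolding q_translate_grid atom_def by (simp only: hankel_scale of_real_mult mult_ac)
qed

lemma cos_atom_grid: "cos_atom q h (q powi i) (q powi n) (q powi k) = atom (-1/2) (hankel (-1/2) (on_grid h)) i n k"
  unfolding cos_atom_def
proof (rule atom_grid)
  have "sqrt (q powi i) * sqrt (q powi i) = q powi i" using q_pos by simp
  moreover have "weight (-1/2) i = q powi i" using q_pos by (simp add: powi_eq_powr)
  ultimately show "1 / sqrt (q powi i) * weight (-1/2) i = sqrt (q powi i)"
    using q_pos by (simp add: field_simps)
qed

lemma bessel_atom_grid: "bessel_atom q \<beta> g (q powi i) (q powi n) (q powi k) = atom \<beta> (hankel \<beta> (on_grid g)) i n k"
proof -
  let ?c = "(q powi i) powr (- 2 * \<beta> - 2)"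
  have "?c * weight \<beta> i = 1"
    unfolding powi_eq_powr[OF q_pos] powr_powr powr_add[symmetric] using q_pos by (simp add: algebra_simps)
  hence "(sqrt (q powi i) * ?c) * weight \<beta> i = sqrt (q powi i)" by (simp only: mult.assoc mult_1_right)
  note * = atom_grid[OF this, of n g k]
  have "(\<lambda>y. of_real (sqrt (q powi i) * ?c) * g (y / q powi i)) = (\<lambda>y. of_real (sqrt (q powi i)) * (of_real ?c * g (y / q powi i)))"
    by (simp only: of_real_mult mult.assoc)
  hence "q_translate q \<beta> (q powi n) (\<lambda>y. of_real (sqrt (q powi i)) * (of_real ?c * g (y / q powi i))) (q powi k) = atom \<beta> (hankel \<beta> (on_grid g)) i n k"
    using * by (simp only:)
  moreover have "(\<lambda>m. of_real (J \<beta> (m + n)) * (of_real (sqrt (q powi i)) * F m))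
      = (\<lambda>m. of_real (sqrt (q powi i)) * (of_real (J \<beta> (m + n)) * F m))" for F :: "int \<Rightarrow> complex"
    by (simp only: mult_ac)
  ultimately show ?thesis
    unfolding bessel_atom_def q_translate_grid by (simp only: hankel_scale mult_ac)
qed

lemma atom_sym: "atom \<beta> H i n k = atom \<beta> H i k n"
proof -
  have "hankel \<beta> (\<lambda>m. of_real (J \<beta> (m + n)) * H (m + i)) k = hankel \<beta> (\<lambda>m. of_real (J \<beta> (m + k)) * H (m + i)) n"
    unfolding hankel_def of_real_mult by (simp only: mult_ac)
  thus ?thesis by (simp only: atom_def)
qed

text \<open>Parseval: a wavelet coefficient is the transform of \<open>F f(s) cnj (F h(a s))\<close> at the translation
parameter.\<close>

lemma wavelet_transform_grid:
  assumes \<beta>: "\<beta> > -1" and f: "l1 \<beta> f" and H: "flat H"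
  shows "of_real (amp \<beta>) * (\<Sum>\<^sub>\<infinity>k. of_real (weight \<beta> k) * (f k * cnj (atom \<beta> H i n k)))
    = of_real (sqrt (q powi i) * q powr (- 4 * \<beta> - 2)) * hankel \<beta> (\<lambda>m. hankel \<beta> f m * cnj (H (m + i))) n"
proof -
  let ?c = "sqrt (q powi i) * q powr (- 4 * \<beta> - 2)"
  let ?G = "\<lambda>m. of_real (J \<beta> (m + n)) * cnj (H (m + i))"
  have G: "l1 \<beta> ?G"
    by (intro flat_l1 flat_J_mult[of \<beta> "\<lambda>m. cnj (H m)"] \<beta>) (simp add: flat_cnj H)
  have "of_real (weight \<beta> k) * (f k * cnj (atom \<beta> H i n k)) = of_real ?c * (of_real (weight \<beta> k) * f k * hankel \<beta> ?G k)" for k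
  proof -
    have "cnj (atom \<beta> H i n k) = of_real ?c * hankel \<beta> ?G k"
      unfolding atom_def complex_cnj_mult hankel_cnj[symmetric] complex_cnj_complex_of_real by (rule refl)
    thus ?thesis by (simp only: mult_ac)
  qed
  hence "(\<Sum>\<^sub>\<infinity>k. of_real (weight \<beta> k) * (f k * cnj (atom \<beta> H i n k)))
      = of_real ?c * (\<Sum>\<^sub>\<infinity>k. of_real (weight \<beta> k) * f k * hankel \<beta> ?G k)"
    by (simp only: infsum_cmult_right')
  also have "(\<Sum>\<^sub>\<infinity>k. of_real (weight \<beta> k) * f k * hankel \<beta> ?G k) = (\<Sum>\<^sub>\<infinity>k. of_real (weight \<beta> k) * hankel \<beta> f k * ?G k)"
    by (rule hankel_adjoint[OF \<beta> f G, symmetric])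
  finally show ?thesis
    unfolding hankel_def[of \<beta> "\<lambda>m. hankel \<beta> f m * cnj (H (m + i))"] of_real_mult by (simp only: mult_ac)
qed

text \<open>The integral over translations.  The atom is symmetric in \<open>n\<close> and \<open>k\<close>, so it is itself a transform in
the variable of integration and Parseval applies again.\<close>

lemma atom_reconstruction:
  assumes \<beta>: "\<beta> > -1" and P: "flat P" and H: "flat H"
  shows "(\<Sum>\<^sub>\<infinity>n. of_real (weight \<beta> n) * hankel \<beta> P n * atom \<beta> H i n k)
    = of_real (sqrt (q powi i)) * (\<Sum>\<^sub>\<infinity>m. of_real (weight \<beta> m * J \<beta> (m + k)) * (P m * H (m + i)))"
proof -
  let ?c = "sqrt (q powi i) * q powr (- 4 * \<beta> - 2)"
  let ?Q = "\<lambda>m. of_real (J \<beta> (m + k)) * H (m + i)"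
  have Q: "flat ?Q" by (rule flat_J_mult[OF \<beta> H])
  have "of_real (weight \<beta> n) * hankel \<beta> P n * atom \<beta> H i n k = of_real ?c * (of_real (weight \<beta> n) * hankel \<beta> P n * hankel \<beta> ?Q n)" for n
    unfolding atom_sym[of \<beta> H i n k] unfolding atom_def by (simp only: mult_ac)
  hence "(\<Sum>\<^sub>\<infinity>n. of_real (weight \<beta> n) * hankel \<beta> P n * atom \<beta> H i n k)
    = of_real ?c * (\<Sum>\<^sub>\<infinity>n. of_real (weight \<beta> n) * hankel \<beta> P n * hankel \<beta> ?Q n)"
    by (simp only: infsum_cmult_right')
  also have "(\<Sum>\<^sub>\<infinity>n. of_real (weight \<beta> n) * hankel \<beta> P n * hankel \<beta> ?Q n)
      = (\<Sum>\<^sub>\<infinity>n. of_real (weight \<beta> n) * P n * hankel \<beta> (hankel \<beta> ?Q) n)"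
    by (rule hankel_adjoint[OF \<beta> flat_l1[OF P \<beta>] rapid_l1[OF rapid_hankel[OF \<beta> Q] \<beta>]])
  also have "\<dots> = (\<Sum>\<^sub>\<infinity>n. of_real (q powr (4 * \<beta> + 2)) * (of_real (weight \<beta> n * J \<beta> (n + k)) * (P n * H (n + i))))"
    unfolding hankel_inversion[OF \<beta> flat_l1[OF Q \<beta>]] of_real_mult by (simp only: mult_ac)
  also have "\<dots> = of_real (q powr (4 * \<beta> + 2)) * (\<Sum>\<^sub>\<infinity>n. of_real (weight \<beta> n * J \<beta> (n + k)) * (P n * H (n + i)))"
    by (rule infsum_cmult_right')
  also have "of_real ?c * (of_real (q powr (4 * \<beta> + 2)) * (\<Sum>\<^sub>\<infinity>n. of_real (weight \<beta> n * J \<beta> (n + k)) * (P n * H (n + i))))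
      = of_real (?c * q powr (4 * \<beta> + 2)) * (\<Sum>\<^sub>\<infinity>n. of_real (weight \<beta> n * J \<beta> (n + k)) * (P n * H (n + i)))"
    by (simp only: of_real_mult mult.assoc)
  also have "?c * q powr (4 * \<beta> + 2) = sqrt (q powi i)"
    unfolding mult.assoc powr_add[symmetric] using q_pos by simp
  finally show ?thesis .
qed

text \<open>The common core of both formulas.  By hypothesis the integrand \<open>V\<close> is a constant times a product of a
transform and an atom, divided by \<open>a\<surd>a\<close>.  The atom contributes \<open>\<surd>a\<close>, so that \<open>1 / a\<close> remains, the
density of the dilation invariant measure; this is why the scale integral factors.\<close>

theorem calderon_reproducing:
  fixes V :: "real \<Rightarrow> real \<Rightarrow> complex"
  assumes \<beta>: "\<beta> > -1" and \<phi>: "flat \<phi>" and H: "flat H"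
    and V: "\<And>i n. of_real (q powi i * sqrt (q powi i)) * (of_real (q powi n) * V (q powi i) (q powi n))
       = of_real c * (of_real (weight \<beta> n) * hankel \<beta> (\<lambda>m. \<phi> m * cnj (H (m + i))) n * atom \<beta> H i n k)"
  shows "of_real (amp \<beta>) * jackson q (\<lambda>a. jackson q (V a))
     = of_real ((1 - q)\<^sup>2 * c * (\<Sum>\<^sub>\<infinity>i. (norm (H i))\<^sup>2)) * hankel \<beta> \<phi> k"
proof -
  let ?A = "\<lambda>m. of_real (weight \<beta> m * J \<beta> (m + k)) * \<phi> m"
  have A: "(\<lambda>m. norm (?A m)) summable_on UNIV"
  proof -
    have "flat (\<lambda>m. of_real (J \<beta> (m + k)) * \<phi> (m + 0))" by (rule flat_J_mult[OF \<beta> \<phi>])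
    from flat_weighted_summable[OF this, of "2 * \<beta> + 2"] show ?thesis
      by (simp add: norm_mult abs_mult mult.assoc)
  qed
  have B: "(\<lambda>i. norm (of_real ((norm (H i))\<^sup>2) :: complex)) summable_on UNIV"
  proof -
    have "of_order 0 H" using H by (simp add: flat_def)
    hence "flat (\<lambda>i. H i * H i)" by (rule flat_of_order_mult(1)[OF H])
    from flat_weighted_summable[OF this, of 0] show ?thesis
      using q_pos by (simp add: norm_mult power2_eq_square)
  qed
  have inner: "of_real (q powi i) * jackson q (V (q powi i)) = of_real ((1 - q) * c) * (\<Sum>\<^sub>\<infinity>m. ?A m * of_real ((norm (H (m + i)))\<^sup>2))" for i
  proof -
    let ?P = "\<lambda>m. \<phi> m * cnj (H (m + i))"
    have "of_order 0 (\<lambda>m. cnj (H (m + i)))" using flat_shift[OF H, of i] by (simp add: of_order_cnj flat_def)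
    hence P: "flat ?P" by (rule flat_of_order_mult(1)[OF \<phi>])
    have s: "sqrt (q powi i) > 0" using q_pos by simp
    have "of_real (q powi i * sqrt (q powi i)) * jackson q (V (q powi i))
        = of_real (1 - q) * (\<Sum>\<^sub>\<infinity>n. of_real (q powi i * sqrt (q powi i)) * (of_real (q powi n) * V (q powi i) (q powi n)))"
      unfolding jackson_eq infsum_cmult_right' by (simp only: mult_ac)
    also have "\<dots> = of_real (1 - q) * (of_real c * (\<Sum>\<^sub>\<infinity>n. of_real (weight \<beta> n) * hankel \<beta> ?P n * atom \<beta> H i n k))"
      unfolding V infsum_cmult_right' by (rule refl)
    also have "\<dots> = of_real (1 - q) * (of_real c * (of_real (sqrt (q powi i)) * (\<Sum>\<^sub>\<infinity>m. of_real (weight \<beta> m * J \<beta> (m + k)) * (?P m * H (m + i)))))"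
      unfolding atom_reconstruction[OF \<beta> P H] by (rule refl)
    also have "(\<Sum>\<^sub>\<infinity>m. of_real (weight \<beta> m * J \<beta> (m + k)) * (?P m * H (m + i))) = (\<Sum>\<^sub>\<infinity>m. ?A m * of_real ((norm (H (m + i)))\<^sup>2))"
      by (rule infsum_cong) (simp add: complex_norm_square[unfolded of_real_power] mult_ac)
    finally have eq: "of_real (sqrt (q powi i)) * (of_real (q powi i) * jackson q (V (q powi i)))
      = of_real (sqrt (q powi i)) * (of_real ((1 - q) * c) * (\<Sum>\<^sub>\<infinity>m. ?A m * of_real ((norm (H (m + i)))\<^sup>2)))"
      by (simp only: of_real_mult mult_ac)
    have nz: "complex_of_real (sqrt (q powi i)) \<noteq> 0" using s by (metis of_real_eq_0_iff less_irrefl)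
    show ?thesis by (rule mult_left_cancel[OF nz, THEN iffD1, OF eq])
  qed
  have "jackson q (\<lambda>a. jackson q (V a)) = of_real (1 - q) * (\<Sum>\<^sub>\<infinity>i. of_real (q powi i) * jackson q (V (q powi i)))"
    by (rule jackson_eq)
  also have "\<dots> = of_real (1 - q) * (of_real ((1 - q) * c) * (\<Sum>\<^sub>\<infinity>i. \<Sum>\<^sub>\<infinity>m. ?A m * of_real ((norm (H (m + i)))\<^sup>2)))"
    unfolding inner infsum_cmult_right' by (rule refl)
  also have "(\<Sum>\<^sub>\<infinity>i. \<Sum>\<^sub>\<infinity>m. ?A m * of_real ((norm (H (m + i)))\<^sup>2)) = (\<Sum>\<^sub>\<infinity>m. ?A m) * (\<Sum>\<^sub>\<infinity>i. of_real ((norm (H i))\<^sup>2))"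
    by (rule infsum_swap_convolution[OF A B])
  finally show ?thesis
    unfolding hankel_def infsum_of_real of_real_mult power2_eq_square[of "1 - q"] by (simp only: mult_ac)
qed

lemma q_adm_const_grid: "q_adm_const q \<beta> g = (1 - q) * (\<Sum>\<^sub>\<infinity>i. (norm (hankel \<beta> (on_grid g) i))\<^sup>2)"
  unfolding q_adm_const_def jackson_def q_fourier_grid using q_pos by simp

lemma cos_wavelet_transform_grid:
  assumes f: "l1 (-1/2) (on_grid f)" and H: "flat (hankel (-1/2) (on_grid h))"
  shows "cos_wavelet_transform q h f (q powi i) (q powi n) =
     of_real (sqrt (q powi i)) * hankel (-1/2) (\<lambda>m. hankel (-1/2) (on_grid f) m * cnj (hankel (-1/2) (on_grid h) (m + i))) n"
proof -
  have w: "weight (-1/2) k = q powi k" for k using q_pos by (simp add: powi_eq_powr)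
  have "cos_wavelet_transform q h f (q powi i) (q powi n)
      = of_real (amp (-1/2)) * (\<Sum>\<^sub>\<infinity>k. of_real (weight (-1/2) k) * (f (q powi k) * cnj (atom (-1/2) (hankel (-1/2) (on_grid h)) i n k)))"
    unfolding cos_wavelet_transform_def jackson_eq cos_atom_grid w amp_def of_real_mult by (simp add: mult.assoc)
  also have "\<dots> = of_real (sqrt (q powi i) * q powr (- 4 * (-1/2) - 2)) * hankel (-1/2) (\<lambda>m. hankel (-1/2) (on_grid f) m * cnj (hankel (-1/2) (on_grid h) (m + i))) n"
    by (rule wavelet_transform_grid[OF _ f H]) simp
  finally show ?thesis using q_pos by simp
qed

lemma bessel_wavelet_transform_grid:
  assumes \<beta>: "\<beta> > -1" and f: "l1 \<beta> (on_grid f)" and H: "flat (hankel \<beta> (on_grid g))"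
  shows "bessel_wavelet_transform q \<beta> g f (q powi i) (q powi n) =
     of_real (sqrt (q powi i) * q powr (- 4 * \<beta> - 2)) * hankel \<beta> (\<lambda>m. hankel \<beta> (on_grid f) m * cnj (hankel \<beta> (on_grid g) (m + i))) n"
proof -
  have "bessel_wavelet_transform q \<beta> g f (q powi i) (q powi n)
      = of_real (amp \<beta>) * (\<Sum>\<^sub>\<infinity>k. of_real (weight \<beta> k) * (f (q powi k) * cnj (atom \<beta> (hankel \<beta> (on_grid g)) i n k)))"
    unfolding bessel_wavelet_transform_def jackson_weight bessel_atom_grid amp_def of_real_mult by (simp only: mult.assoc)
  also have "\<dots> = of_real (sqrt (q powi i) * q powr (- 4 * \<beta> - 2)) * hankel \<beta> (\<lambda>m. hankel \<beta> (on_grid f) m * cnj (hankel \<beta> (on_grid g) (m + i))) n"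
    by (rule wavelet_transform_grid[OF \<beta> f H])
  finally show ?thesis .
qed

end

section \<open>Inversion of the two transforms by wavelets\<close>

context q_grid_index
begin

lemma abs_q_powi_powr: "\<bar>q powi m\<bar> powr e = qpow e m"
  unfolding abs_of_pos[OF q_powi_pos] powi_eq_powr[OF q_pos] by (simp add: powr_powr mult.commute)

lemma hankel_K1:
  assumes "flat (hankel \<gamma> (on_grid f))"
  shows "hankel \<gamma> (on_grid (K1 q \<alpha> f)) m
    = of_real (K_const q \<alpha> * qpow (2 * \<alpha> + 1) m) * hankel \<gamma> (on_grid f) m"
proof -
  let ?\<psi> = "\<lambda>m. of_real (qpow (2 * \<alpha> + 1) m) * hankel \<gamma> (on_grid f) m"
  have "K1 q \<alpha> f (q powi k) = of_real (K_const q \<alpha>) * hankel \<gamma> ?\<psi> k" for k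
  proof -
    have "K1 q \<alpha> f (q powi k) = of_real (K_const q \<alpha>) * q_fourier_inv q \<gamma>
        (\<lambda>s. of_real (\<bar>s\<bar> powr (2 * \<alpha> + 1)) * q_fourier q \<gamma> f s) (q powi k)"
      by (simp only: K1_def restrict_apply q_powi_Rq if_True)
    moreover have "q powr (- 4 * \<gamma> - 2) = 1" using q_pos by simp
    ultimately show ?thesis
      unfolding q_fourier_inv_def by (simp only: q_fourier_grid abs_q_powi_powr of_real_1 mult_1)
  qed
  hence "hankel \<gamma> (on_grid (K1 q \<alpha> f)) m = of_real (K_const q \<alpha>) * hankel \<gamma> (hankel \<gamma> ?\<psi>) m"
    by (simp only: hankel_scale)
  also have "hankel \<gamma> (hankel \<gamma> ?\<psi>) m = ?\<psi> m"
    by (rule hankel_inversion_\<gamma>[OF flat_l1[OF flat_powr_mult[OF assms] \<gamma>_gt_m1]])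
  finally show ?thesis by (simp only: of_real_mult mult.assoc)
qed

lemma hankel_K2:
  assumes "flat (hankel \<alpha> (on_grid f))"
  shows "hankel \<alpha> (on_grid (K2 q \<alpha> f)) m
    = of_real (K_const q \<alpha> * qpow (2 * \<alpha> + 1) m) * hankel \<alpha> (on_grid f) m"
proof -
  let ?\<psi> = "\<lambda>m. of_real (qpow (2 * \<alpha> + 1) m) * hankel \<alpha> (on_grid f) m"
  have "K2 q \<alpha> f (q powi k) = of_real (K_const q \<alpha>) * (of_real (q powr (- 4 * \<alpha> - 2)) * hankel \<alpha> ?\<psi> k)" for k
    by (simp only: K2_def restrict_apply q_powi_Rq if_True q_fourier_inv_def q_fourier_grid abs_q_powi_powr)
  hence "hankel \<alpha> (on_grid (K2 q \<alpha> f)) m = of_real (K_const q \<alpha>) * (of_real (q powr (- 4 * \<alpha> - 2)) * hankel \<alpha> (hankel \<alpha> ?\<psi>) m)"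
    by (simp only: hankel_scale)
  also have "hankel \<alpha> (hankel \<alpha> ?\<psi>) m = of_real (q powr (4 * \<alpha> + 2)) * ?\<psi> m"
    by (rule hankel_inversion[OF \<alpha>_gt_m1 flat_l1[OF flat_powr_mult[OF assms] \<alpha>_gt_m1]])
  also have "of_real (q powr (- 4 * \<alpha> - 2)) * (of_real (q powr (4 * \<alpha> + 2)) * ?\<psi> m) = ?\<psi> m"
    unfolding mult.assoc[symmetric] of_real_mult[symmetric] powr_add[symmetric] using q_pos by simp
  finally show ?thesis by (simp only: of_real_mult mult.assoc)
qed

lemma scale_powers: "q powi i * sqrt (q powi i) * (sqrt (q powi i) * qpow (2 * \<alpha> + 1) i) = (q powi i) powr (2 * \<alpha> + 3)"
proof -
  have "q powi i * sqrt (q powi i) * (sqrt (q powi i) * qpow (2 * \<alpha> + 1) i) = q powi i * q powi i * qpow (2 * \<alpha> + 1) i"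
    using q_pos by simp
  also have "\<dots> = (q powi i) powr (2 * \<alpha> + 3)"
    unfolding powi_eq_powr[OF q_pos] powr_powr powr_add[symmetric] by (simp add: algebra_simps)
  finally show ?thesis .
qed

lemma rl_scale: "rl (\<lambda>k. c * f k) k = c * rl f k"
proof -
  have "(\<Sum>\<^sub>\<infinity>j. of_real (q ^ j * rl_coeff j) * (c * f (k + int j))) = (\<Sum>\<^sub>\<infinity>j. c * (of_real (q ^ j * rl_coeff j) * f (k + int j)))"
    by (simp only: mult_ac)
  thus ?thesis unfolding rl_def by (simp only: infsum_cmult_right' mult_ac)
qed

lemma weyl_scale: "weyl (\<lambda>k. c * f k) k = c * weyl f k"
proof -
  have "(\<Sum>\<^sub>\<infinity>j. of_real (qpow (2 * \<alpha> + 1) (k - int j) * rl_coeff j) * (c * f (k - int j)))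
      = (\<Sum>\<^sub>\<infinity>j. c * (of_real (qpow (2 * \<alpha> + 1) (k - int j) * rl_coeff j) * f (k - int j)))"
    by (simp only: mult_ac)
  thus ?thesis unfolding weyl_def by (simp only: infsum_cmult_right' mult_ac)
qed

lemma q_powr_mult_shift:
  "qpow (2 * \<alpha> + 1) (m + i) = qpow (2 * \<alpha> + 1) i * qpow (2 * \<alpha> + 1) m"
  unfolding powr_add[symmetric] by (simp add: algebra_simps)

context
  fixes g :: "real \<Rightarrow> complex"
  assumes g: "g \<in> q_schwartz0 q \<alpha>" and adm: "0 < q_adm_const q \<alpha> g"
begin

abbreviation "H \<equiv> hankel \<alpha> (on_grid g)"

lemma flat_H: "flat H"
  by (rule hankel_q_schwartz0_flat[OF \<alpha>_gt_m1 g])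

lemma hankel_q_weyl_g: "hankel \<gamma> (on_grid (q_weyl q \<alpha> g)) = H"
  unfolding q_weyl_grid using g by (intro ext hankel_weyl[OF q_schwartz_rapid]) (simp add: q_schwartz0_iff)

lemma flat_power_H: "flat (\<lambda>m. of_real (K_const q \<alpha> * qpow (2 * \<alpha> + 1) m) * H m)"
  using flat_scale[OF flat_powr_mult[OF flat_H], of "of_real (K_const q \<alpha>)"] by (simp add: mult.assoc)

text \<open>With \<open>u\<close> the preimage of \<open>f\<close> under the Weyl transform, \<open>F f = F\<^sub>\<alpha> u\<close>.  The Riemann-Liouville transform
of the cosine coefficients of \<open>f\<close> consists of Bessel coefficients of \<open>u\<close>, and the Calderon formula
for \<open>F\<^sub>\<alpha>\<close> returns \<open>u\<close>.\<close>

theorem weyl_inversion: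
  assumes f: "f \<in> q_schwartz0 q \<gamma>"
  shows "q_weyl_inv q \<alpha> f (q powi k) =
        of_real (q_const q \<alpha> / q_adm_const q \<alpha> g) *
        jackson q (\<lambda>a. jackson q (\<lambda>b.
          q_riemann_liouville q \<alpha> (cos_wavelet_transform q ((K1 q \<alpha> \<circ> q_weyl q \<alpha>) g) f a) b *
          bessel_atom q \<alpha> g a b (q powi k) * of_real (b powr (2 * \<alpha> + 1) / a powr (2 * \<alpha> + 3))))"
proof -
  let ?u = "q_weyl_inv q \<alpha> f"
  let ?h = "(K1 q \<alpha> \<circ> q_weyl q \<alpha>) g"
  define \<phi> where "\<phi> = hankel \<gamma> (on_grid f)"
  define R where "R = amp \<gamma> / amp \<alpha> * K_const q \<alpha>"
  have fl1: "l1 \<gamma> (on_grid f)"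
    using f by (intro rapid_l1[OF q_schwartz_rapid \<gamma>_gt_m1]) (simp add: q_schwartz0_iff)
  have \<phi>: "flat \<phi>" unfolding \<phi>_def by (rule hankel_q_schwartz0_flat[OF \<gamma>_gt_m1 f])
  have u: "hankel \<alpha> (on_grid ?u) = \<phi>"
    unfolding \<phi>_def by (rule ext) (rule q_weyl_inv_spec(2)[OF f])
  have ul1: "l1 \<alpha> (on_grid ?u)"
    using q_weyl_inv_spec(1)[OF f] by (intro rapid_l1[OF q_schwartz_rapid \<alpha>_gt_m1]) (simp add: q_schwartz0_iff)
  have h: "hankel \<gamma> (on_grid ?h) = (\<lambda>m. of_real (K_const q \<alpha> * qpow (2 * \<alpha> + 1) m) * H m)"
  proof
    have "flat (hankel \<gamma> (on_grid (q_weyl q \<alpha> g)))" unfolding hankel_q_weyl_g by (rule flat_H)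
    from hankel_K1[OF this]
    show "hankel \<gamma> (on_grid ?h) m = of_real (K_const q \<alpha> * qpow (2 * \<alpha> + 1) m) * H m" for m
      by (simp only: o_def hankel_q_weyl_g)
  qed
  have RL: "q_riemann_liouville q \<alpha> (cos_wavelet_transform q ?h f (q powi i)) (q powi n)
      = of_real (sqrt (q powi i) * (R * qpow (2 * \<alpha> + 1) i)) * hankel \<alpha> (\<lambda>m. \<phi> m * cnj (H (m + i))) n" for i n
  proof -
    let ?s = "sqrt (q powi i)" and ?e = "qpow (2 * \<alpha> + 1) i"
    let ?\<psi> = "\<lambda>m. \<phi> m * cnj (of_real (K_const q \<alpha> * qpow (2 * \<alpha> + 1) (m + i)) * H (m + i))"
    have flh: "flat (hankel \<gamma> (on_grid ?h))" unfolding h by (rule flat_power_H)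
    have "of_order 0 (\<lambda>m. cnj (of_real (K_const q \<alpha> * qpow (2 * \<alpha> + 1) (m + i)) * H (m + i)))"
      using flat_shift[OF flat_power_H, of i] unfolding of_order_cnj flat_def by blast
    hence \<psi>: "flat ?\<psi>" by (rule flat_of_order_mult(1)[OF \<phi>])
    have "(\<lambda>k. cos_wavelet_transform q ?h f (q powi i) (q powi k)) = (\<lambda>k. of_real ?s * hankel \<gamma> ?\<psi> k)"
      unfolding cos_wavelet_transform_grid[OF fl1 flh] unfolding h \<phi>_def by (rule refl)
    hence "q_riemann_liouville q \<alpha> (cos_wavelet_transform q ?h f (q powi i)) (q powi n)
       = of_real ?s * (of_real (amp \<gamma> / amp \<alpha>) * hankel \<alpha> (\<lambda>m. of_real (qpow (- (2 * \<alpha> + 1)) m) * ?\<psi> m) n)"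
      unfolding q_riemann_liouville_grid by (simp only: rl_scale rl_hankel[OF \<psi>])
    also have "(\<lambda>m. of_real (qpow (- (2 * \<alpha> + 1)) m) * ?\<psi> m) = (\<lambda>m. of_real (K_const q \<alpha> * ?e) * (\<phi> m * cnj (H (m + i))))"
    proof
      fix m
      have "complex_of_real (qpow (- (2 * \<alpha> + 1)) m) * of_real (qpow (2 * \<alpha> + 1) m) = 1"
        unfolding of_real_mult[symmetric] q_powr_cancel by simp
      moreover have "a * (F * ((K * (E * b)) * G)) = (a * b) * ((K * E) * (F * G))" for a b E F G K :: complex
        by (simp only: mult_ac)
      ultimately show "of_real (qpow (- (2 * \<alpha> + 1)) m) * ?\<psi> m = of_real (K_const q \<alpha> * ?e) * (\<phi> m * cnj (H (m + i)))"
        unfolding q_powr_mult_shift complex_cnj_mult complex_cnj_complex_of_real of_real_mult by simp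
    qed
    finally show ?thesis unfolding hankel_scale R_def by (simp only: of_real_mult mult_ac)
  qed
  have V: "of_real (q powi i * sqrt (q powi i)) * (of_real (q powi n) *
       (q_riemann_liouville q \<alpha> (cos_wavelet_transform q ?h f (q powi i)) (q powi n) *
          bessel_atom q \<alpha> g (q powi i) (q powi n) (q powi k) * of_real ((q powi n) powr (2 * \<alpha> + 1) / (q powi i) powr (2 * \<alpha> + 3))))
    = of_real R * (of_real (weight \<alpha> n) * hankel \<alpha> (\<lambda>m. \<phi> m * cnj (H (m + i))) n * atom \<alpha> H i n k)" for i n
  proof -
    let ?X = "hankel \<alpha> (\<lambda>m. \<phi> m * cnj (H (m + i))) n" and ?Y = "atom \<alpha> H i n k"
    let ?a = "q powi i * sqrt (q powi i)" and ?b = "sqrt (q powi i) * qpow (2 * \<alpha> + 1) i"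
    let ?d = "(q powi i) powr (2 * \<alpha> + 3)" and ?w = "(q powi n) powr (2 * \<alpha> + 1)"
    have d: "?d > 0" using q_pos by simp
    have "of_real ?a * (of_real (q powi n) * (of_real (sqrt (q powi i) * (R * qpow (2 * \<alpha> + 1) i)) * ?X * ?Y * of_real (?w / ?d)))
       = of_real (?a * ?b / ?d * R * (q powi n * ?w)) * (?X * ?Y)"
      by (simp only: of_real_mult of_real_divide divide_inverse mult_ac)
    also have "?a * ?b / ?d = 1" unfolding scale_powers using d by simp
    also have "q powi n * ?w = weight \<alpha> n" by (rule weight_split)
    finally show ?thesis unfolding RL bessel_atom_grid by (simp only: of_real_mult mult_1 mult.assoc)
  qed
  define S where "S = (\<Sum>\<^sub>\<infinity>i. (norm (H i))\<^sup>2)"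
  have C: "q_adm_const q \<alpha> g = (1 - q) * S" unfolding S_def by (rule q_adm_const_grid)
  have S: "S > 0" using adm q_less_1 unfolding C by (simp add: zero_less_mult_iff)
  let ?I = "jackson q (\<lambda>a. jackson q (\<lambda>b.
          q_riemann_liouville q \<alpha> (cos_wavelet_transform q ?h f a) b *
          bessel_atom q \<alpha> g a b (q powi k) * of_real (b powr (2 * \<alpha> + 1) / a powr (2 * \<alpha> + 3))))"
  have "of_real (amp \<alpha>) * ?I = of_real ((1 - q)\<^sup>2 * R * S) * hankel \<alpha> \<phi> k"
    unfolding S_def by (rule calderon_reproducing[OF \<alpha>_gt_m1 \<phi> flat_H V])
  also have "hankel \<alpha> \<phi> k = of_real (q powr (4 * \<alpha> + 2)) * ?u (q powi k)"
    unfolding u[symmetric] by (rule hankel_inversion[OF \<alpha>_gt_m1 ul1])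
  also have "of_real ((1 - q)\<^sup>2 * R * S) * (of_real (q powr (4 * \<alpha> + 2)) * ?u (q powi k))
      = of_real ((1 - q)\<^sup>2 * S * (R * q powr (4 * \<alpha> + 2))) * ?u (q powi k)"
    by (simp only: of_real_mult mult_ac)
  also have "R * q powr (4 * \<alpha> + 2) = 1" unfolding R_def by (rule K_const_amp)
  finally have "of_real (q_const q \<alpha>) * ?I = of_real ((1 - q) * S) * ?u (q powi k)"
    using q_less_1 by (simp add: amp_def power2_eq_square)
  hence "of_real (q_const q \<alpha> / ((1 - q) * S)) * ?I = ?u (q powi k)"
    using q_less_1 S by (simp add: field_simps)
  thus ?thesis unfolding C by simp
qed

text \<open>The Weyl transform turns the Bessel coefficients of \<open>f\<close> into cosine coefficients of the function with
cosine transform \<open>s\<^bsup>2\<alpha>+1\<^esup> F\<^sub>\<alpha> f\<close>, up to a constant the preimage of \<open>f\<close>.  The transform of the second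
wavelet is \<open>F (W g) = F\<^sub>\<alpha> g\<close>, so the admissibility constants agree.\<close>

theorem riemann_liouville_inversion:
  assumes f: "f \<in> q_schwartz0 q \<alpha>"
  shows "q_riemann_liouville_inv q \<alpha> f (q powi k) =
        of_real (q_const q \<gamma> / q_adm_const q \<gamma> (q_weyl q \<alpha> g)) *
        jackson q (\<lambda>a. jackson q (\<lambda>b.
          q_weyl q \<alpha> (bessel_wavelet_transform q \<alpha> (K2 q \<alpha> g) f a) b *
          cos_atom q (q_weyl q \<alpha> g) a b (q powi k) * of_real (1 / a powr (2 * \<alpha> + 3))))"
proof -
  define \<theta> where "\<theta> = hankel \<alpha> (on_grid f)"
  define \<phi> where "\<phi> = (\<lambda>m. of_real (qpow (2 * \<alpha> + 1) m) * \<theta> m)"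
  have fl1: "l1 \<alpha> (on_grid f)"
    using f by (intro rapid_l1[OF q_schwartz_rapid \<alpha>_gt_m1]) (simp add: q_schwartz0_iff)
  have \<theta>: "flat \<theta>" unfolding \<theta>_def by (rule hankel_q_schwartz0_flat[OF \<alpha>_gt_m1 f])
  have \<phi>: "flat \<phi>" unfolding \<phi>_def by (rule flat_powr_mult[OF \<theta>])
  have h: "hankel \<alpha> (on_grid (K2 q \<alpha> g)) = (\<lambda>m. of_real (K_const q \<alpha> * qpow (2 * \<alpha> + 1) m) * H m)"
    by (rule ext) (rule hankel_K2[OF flat_H])
  have W: "q_weyl q \<alpha> (bessel_wavelet_transform q \<alpha> (K2 q \<alpha> g) f (q powi i)) (q powi n)
      = of_real (sqrt (q powi i) * (K_const q \<alpha> * qpow (2 * \<alpha> + 1) i)) * hankel \<gamma> (\<lambda>m. \<phi> m * cnj (H (m + i))) n" for i n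
  proof -
    let ?s = "sqrt (q powi i)" and ?e = "qpow (2 * \<alpha> + 1) i"
    let ?\<psi> = "\<lambda>m. \<theta> m * cnj (of_real (K_const q \<alpha> * qpow (2 * \<alpha> + 1) (m + i)) * H (m + i))"
    have flh: "flat (hankel \<alpha> (on_grid (K2 q \<alpha> g)))" unfolding h by (rule flat_power_H)
    have "of_order 0 (\<lambda>m. cnj (of_real (K_const q \<alpha> * qpow (2 * \<alpha> + 1) (m + i)) * H (m + i)))"
      using flat_shift[OF flat_power_H, of i] unfolding of_order_cnj flat_def by blast
    hence \<psi>: "flat ?\<psi>" by (rule flat_of_order_mult(1)[OF \<theta>])
    have "(\<lambda>k. bessel_wavelet_transform q \<alpha> (K2 q \<alpha> g) f (q powi i) (q powi k)) = (\<lambda>k. of_real (?s * q powr (- 4 * \<alpha> - 2)) * hankel \<alpha> ?\<psi> k)"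
      unfolding bessel_wavelet_transform_grid[OF \<alpha>_gt_m1 fl1 flh] unfolding h \<theta>_def by (rule refl)
    hence "q_weyl q \<alpha> (bessel_wavelet_transform q \<alpha> (K2 q \<alpha> g) f (q powi i)) (q powi n)
       = of_real (?s * q powr (- 4 * \<alpha> - 2)) * (of_real (q powr (4 * \<alpha> + 2)) * hankel \<gamma> ?\<psi> n)"
      unfolding q_weyl_grid by (simp only: weyl_scale weyl_hankel[OF \<psi>])
    also have "\<dots> = of_real (?s * (q powr (- 4 * \<alpha> - 2) * q powr (4 * \<alpha> + 2))) * hankel \<gamma> ?\<psi> n"
      by (simp only: of_real_mult mult.assoc)
    also have "q powr (- 4 * \<alpha> - 2) * q powr (4 * \<alpha> + 2) = 1"
      unfolding powr_add[symmetric] using q_pos by simp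
    also have "?\<psi> = (\<lambda>m. of_real (K_const q \<alpha> * ?e) * (\<phi> m * cnj (H (m + i))))"
      unfolding \<phi>_def q_powr_mult_shift complex_cnj_mult complex_cnj_complex_of_real of_real_mult by (simp only: mult_ac)
    finally show ?thesis unfolding hankel_scale by (simp only: of_real_mult mult_1 mult_1_right of_real_1 mult_ac)
  qed
  have V: "of_real (q powi i * sqrt (q powi i)) * (of_real (q powi n) *
       (q_weyl q \<alpha> (bessel_wavelet_transform q \<alpha> (K2 q \<alpha> g) f (q powi i)) (q powi n) *
          cos_atom q (q_weyl q \<alpha> g) (q powi i) (q powi n) (q powi k) * of_real (1 / (q powi i) powr (2 * \<alpha> + 3))))
    = of_real (K_const q \<alpha>) * (of_real (weight \<gamma> n) * hankel \<gamma> (\<lambda>m. \<phi> m * cnj (H (m + i))) n * atom \<gamma> H i n k)" for i n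
  proof -
    let ?X = "hankel \<gamma> (\<lambda>m. \<phi> m * cnj (H (m + i))) n" and ?Y = "atom \<gamma> H i n k"
    let ?a = "q powi i * sqrt (q powi i)" and ?b = "sqrt (q powi i) * qpow (2 * \<alpha> + 1) i"
    let ?d = "(q powi i) powr (2 * \<alpha> + 3)"
    have d: "?d > 0" using q_pos by simp
    have "of_real ?a * (of_real (q powi n) * (of_real (sqrt (q powi i) * (K_const q \<alpha> * qpow (2 * \<alpha> + 1) i)) * ?X * ?Y * of_real (1 / ?d)))
       = of_real (?a * ?b / ?d * K_const q \<alpha> * q powi n) * (?X * ?Y)"
      by (simp only: of_real_mult of_real_divide divide_inverse of_real_1 mult_1 mult_ac)
    also have "?a * ?b / ?d = 1" unfolding scale_powers using d by simp
    finally show ?thesis unfolding W cos_atom_grid hankel_q_weyl_g weight_\<gamma>_eq(2) by (simp only: of_real_mult mult_1 mult.assoc)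
  qed
  define S where "S = (\<Sum>\<^sub>\<infinity>i. (norm (H i))\<^sup>2)"
  have C: "q_adm_const q \<gamma> (q_weyl q \<alpha> g) = (1 - q) * S"
    unfolding S_def q_adm_const_grid hankel_q_weyl_g by (rule refl)
  have "q_adm_const q \<alpha> g = (1 - q) * S" unfolding S_def by (rule q_adm_const_grid)
  hence S: "S > 0" using adm q_less_1 by (simp add: zero_less_mult_iff)
  let ?I = "jackson q (\<lambda>a. jackson q (\<lambda>b.
          q_weyl q \<alpha> (bessel_wavelet_transform q \<alpha> (K2 q \<alpha> g) f a) b *
          cos_atom q (q_weyl q \<alpha> g) a b (q powi k) * of_real (1 / a powr (2 * \<alpha> + 3))))"
  let ?v = "q_riemann_liouville_inv q \<alpha> f (q powi k)"
  have "of_real (amp \<gamma>) * ?I = of_real ((1 - q)\<^sup>2 * K_const q \<alpha> * S) * hankel \<gamma> \<phi> k"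
    unfolding S_def by (rule calderon_reproducing[OF \<gamma>_gt_m1 \<phi> flat_H V])
  also have "\<dots> = of_real ((1 - q)\<^sup>2 * S) * (of_real (K_const q \<alpha>) * hankel \<gamma> \<phi> k)"
    by (simp only: of_real_mult mult_ac)
  also have "of_real (K_const q \<alpha>) * hankel \<gamma> \<phi> k = ?v"
    unfolding q_riemann_liouville_inv_spec[OF f] hankel_scale[symmetric] \<phi>_def \<theta>_def of_real_mult by (simp only: mult.assoc)
  finally have "of_real (q_const q \<gamma>) * ?I = of_real ((1 - q) * S) * ?v"
    using q_less_1 by (simp add: amp_def power2_eq_square)
  hence "of_real (q_const q \<gamma> / ((1 - q) * S)) * ?I = ?v"
    using q_less_1 S by (simp add: field_simps)
  thus ?thesis unfolding C by simp
qed

end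

end

theorem theorem15:
  fixes q \<alpha> x :: real and g :: "real \<Rightarrow> complex"
  assumes "0 < q" and "q < 1" and "ln (1 - q) / ln q \<in> \<int>" and "\<alpha> > - 1 / 2"
    and "q_wavelet q \<alpha> g" and "g \<in> q_schwartz0 q \<alpha>"
    and "x \<in> Rq_plus q"
  shows "(\<forall>f \<in> q_schwartz0 q (- 1 / 2).
      q_weyl_inv q \<alpha> f x =
        of_real (q_const q \<alpha> / q_adm_const q \<alpha> g) *
        jackson q (\<lambda>a. jackson q (\<lambda>b.
          q_riemann_liouville q \<alpha> (cos_wavelet_transform q ((K1 q \<alpha> \<circ> q_weyl q \<alpha>) g) f a) b *
          bessel_atom q \<alpha> g a b x * of_real (b powr (2 * \<alpha> + 1) / a powr (2 * \<alpha> + 3))))) \<and>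
    (\<forall>f \<in> q_schwartz0 q \<alpha>.
      q_riemann_liouville_inv q \<alpha> f x =
        of_real (q_const q (- 1 / 2) / q_adm_const q (- 1 / 2) (q_weyl q \<alpha> g)) *
        jackson q (\<lambda>a. jackson q (\<lambda>b.
          q_weyl q \<alpha> (bessel_wavelet_transform q \<alpha> (K2 q \<alpha> g) f a) b *
          cos_atom q (q_weyl q \<alpha> g) a b x * of_real (1 / a powr (2 * \<alpha> + 3)))))"
proof -
  obtain N :: int where N: "ln (1 - q) / ln q = of_int N"
    using assms(3) by (rule Ints_cases)
  have "ln (1 - q) = of_int N * ln q"
    using N assms(1,2) by (simp add: field_simps)
  hence "1 - q = q powr of_int N"
    using assms(1,2) by (metis exp_ln diff_gt_0_iff_gt powr_def less_irrefl)
  hence "1 - q = q powi N"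
    using assms(1) by (simp add: powi_eq_powr)
  then interpret q_grid_index q N \<alpha>
    using assms(1,2,4) by unfold_locales auto
  have adm: "0 < q_adm_const q \<alpha> g"
    using assms(5) by (simp add: q_wavelet_def)
  obtain k where x: "x = q powi k"
    using assms(7) by (auto simp: Rq_plus_def)
  show ?thesis
    unfolding x using weyl_inversion[OF assms(6) adm] riemann_liouville_inversion[OF assms(6) adm] by blast
qed

end
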